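(* Let $(A,\mathfrak{m})$ be a Cohen-Macaulay local ring of dimension $d\ge 1$ with infinite residue field, and let $\mathcal{F}=\{F_n\}_{n\in\mathbb{Z}}$ be a Hilbert filtration. Suppose $\operatorname{depth} G(\mathcal{F})\ge d-1$ and that $r:=\operatorname{nr}(\mathcal{F})\ge 2$ is maximal, i.e. $\operatorname{nr}(\mathcal{F})=e_1(\mathcal{F})-e_0(\mathcal{F})+\ell(A/F_1)+1$. Put $\lambda=\ell(A/F_1)$ and $e_0=e_0(\mathcal{F})$. Then the Hilbert series of $G(\mathcal{F})$ is \[HS_{G(\mathcal{F})}(t)=\frac{\lambda+(e_0-\lambda-1)t+t^r}{(1-t)^d}.\]
   Context: A Hilbert filtration is a family $\mathcal{F}=\{F_n\}_{n\in\mathbb{Z}}$ of ideals with $A=F_0\supseteq F_1\supseteq\cdots$, $F_iF_j\subseteq F_{i+j}$ for all $i,j$, $F_n=A$ for $n\le 0$, $F_{n+1}=F_1F_n$ for $n\gg0$, and $F_1$ $\mathfrak{m}$-primary. $G(\mathcal{F})=\bigoplus_{n\ge0}F_n/F_{n+1}$ and $HS_{G(\mathcal{F})}(t)=\sum_{n\ge0}\ell(F_n/F_{n+1})t^n$. The Hilbert coefficients $e_i(\mathcal{F})$ are defined by $\ell(A/F_n)=e_0(\mathcal{F})\binom{n+d-1}{d}-e_1(\mathcal{F})\binom{n+d-2}{d-1}+\cdots+(-1)^de_d(\mathcal{F})$ for $n\gg0$. An ideal $Q\subseteq F_1$ is a reduction of $\mathcal{F}$ if $F_{n+1}=QF_n$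 for $n\gg0$; a minimal reduction is one minimal under inclusion. For a minimal reduction $Q$, $\operatorname{nr}_Q(\mathcal{F})=\min\{r\in\mathbb{Z}_+ : F_{r+1}=QF_r\}$, and $\operatorname{nr}(\mathcal{F})=\min_Q \operatorname{nr}_Q(\mathcal{F})$ over all minimal reductions $Q$. *)

theory Defs
  imports Main "HOL-Computational_Algebra.Formal_Power_Series"
begin

definition is_ideal :: "'a::comm_ring_1 set \<Rightarrow> bool" where
  "is_ideal I \<longleftrightarrow> 0 \<in> I \<and> (\<forall>x\<in>I. \<forall>y\<in>I. x + y \<in> I) \<and> (\<forall>a x. x \<in> I \<longrightarrow> a * x \<in> I)"

definition ideal_gen :: "'a::comm_ring_1 set \<Rightarrow> 'a set" where
  "ideal_gen S = \<Inter>{I. is_ideal I \<and> S \<subseteq> I}"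

definition ideal_prod :: "'a::comm_ring_1 set \<Rightarrow> 'a set \<Rightarrow> 'a set" where
  "ideal_prod I J = ideal_gen {x * y | x y. x \<in> I \<and> y \<in> J}"

definition prime_ideal :: "'a::comm_ring_1 set \<Rightarrow> bool" where
  "prime_ideal P \<longleftrightarrow> is_ideal P \<and> P \<noteq> UNIV \<and> (\<forall>x y. x * y \<in> P \<longrightarrow> x \<in> P \<or> y \<in> P)"

definition maximal_ideal :: "'a::comm_ring_1 set \<Rightarrow> bool" where
  "maximal_ideal M \<longleftrightarrow> is_ideal M \<and> M \<noteq> UNIV \<and>
     (\<forall>I. is_ideal I \<and> M \<subseteq> I \<longrightarrow> I = M \<or> I = UNIV)"

definition noetherian_ring :: "'a::comm_ring_1 itself \<Rightarrow> bool" where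
  "noetherian_ring _ \<longleftrightarrow> (\<forall>I::'a set. is_ideal I \<longrightarrow> (\<exists>S. finite S \<and> I = ideal_gen S))"

definition noetherian_local_ring :: "'a::comm_ring_1 set \<Rightarrow> bool" where
  "noetherian_local_ring m \<longleftrightarrow> noetherian_ring TYPE('a) \<and>
     (\<forall>M::'a set. maximal_ideal M \<longleftrightarrow> M = m)"

definition has_prime_chain :: "'a::comm_ring_1 itself \<Rightarrow> nat \<Rightarrow> bool" where
  "has_prime_chain _ k \<longleftrightarrow> (\<exists>P::nat \<Rightarrow> 'a set.
     (\<forall>i\<le>k. prime_ideal (P i)) \<and> (\<forall>i<k. P i \<subset> P (Suc i)))"

definition krull_dim_eq :: "'a::comm_ring_1 itself \<Rightarrow> nat \<Rightarrow> bool" where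
  "krull_dim_eq T d \<longleftrightarrow> has_prime_chain T d \<and> \<not> has_prime_chain T (Suc d)"

text \<open>Length of the A-module J/I (for ideals I \<subseteq> J): the maximal length of a
strict chain of ideals (= submodules of J/I) from I to J.\<close>
definition has_ideal_chain :: "'a::comm_ring_1 set \<Rightarrow> 'a set \<Rightarrow> nat \<Rightarrow> bool" where
  "has_ideal_chain I J k \<longleftrightarrow> (\<exists>C::nat \<Rightarrow> 'a set. C 0 = I \<and> C k = J \<and>
     (\<forall>i\<le>k. is_ideal (C i)) \<and> (\<forall>i<k. C i \<subset> C (Suc i)))"

definition ell :: "'a::comm_ring_1 set \<Rightarrow> 'a set \<Rightarrow> nat" where
  "ell I J = (GREATEST k. has_ideal_chain I J k)"

definition A_regular_seq :: "'a::comm_ring_1 set \<Rightarrow> 'a list \<Rightarrow> bool" where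
  "A_regular_seq m xs \<longleftrightarrow> set xs \<subseteq> m \<and> ideal_gen (set xs) \<noteq> UNIV \<and>
     (\<forall>i<length xs. \<forall>y. xs ! i * y \<in> ideal_gen (set (take i xs))
                         \<longrightarrow> y \<in> ideal_gen (set (take i xs)))"

definition depth_A :: "'a::comm_ring_1 set \<Rightarrow> nat" where
  "depth_A m = (GREATEST k. \<exists>xs. length xs = k \<and> A_regular_seq m xs)"

definition cohen_macaulay_local :: "'a::comm_ring_1 set \<Rightarrow> bool" where
  "cohen_macaulay_local m \<longleftrightarrow> noetherian_local_ring m \<and>
     krull_dim_eq TYPE('a) (depth_A m)"

definition m_primary :: "'a::comm_ring_1 set \<Rightarrow> 'a set \<Rightarrow> bool" where
  "m_primary m I \<longleftrightarrow> is_ideal I \<and> I \<noteq> UNIV \<and> (\<forall>x. x \<in> m \<longleftrightarrow> (\<exists>n. x ^ n \<in> I))"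

text \<open>Hilbert filtrations, indexed by nat (F_n = A for n \<le> 0 is encoded by F 0 = UNIV).\<close>
definition hilbert_filtration :: "'a::comm_ring_1 set \<Rightarrow> (nat \<Rightarrow> 'a set) \<Rightarrow> bool" where
  "hilbert_filtration m F \<longleftrightarrow> (\<forall>n. is_ideal (F n)) \<and> F 0 = UNIV \<and>
     (\<forall>n. F (Suc n) \<subseteq> F n) \<and> (\<forall>i j. ideal_prod (F i) (F j) \<subseteq> F (i + j)) \<and>
     (\<exists>N. \<forall>n\<ge>N. F (Suc n) = ideal_prod (F 1) (F n)) \<and> m_primary m (F 1)"

text \<open>The associated graded ring G(F) = \<Oplus> F_n/F_{n+1}. An element is represented
by a finitely supported g :: nat \<Rightarrow> 'a with g n \<in> F n (g n a representative of the
degree-n component); two representatives are equal in G(F) iff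
g n - h n \<in> F (n+1) for all n.\<close>
definition gr_elem :: "(nat \<Rightarrow> 'a::comm_ring_1 set) \<Rightarrow> (nat \<Rightarrow> 'a) \<Rightarrow> bool" where
  "gr_elem F g \<longleftrightarrow> (\<forall>n. g n \<in> F n) \<and> (\<exists>N. \<forall>n\<ge>N. g n = 0)"

definition gr_eq :: "(nat \<Rightarrow> 'a::comm_ring_1 set) \<Rightarrow> (nat \<Rightarrow> 'a) \<Rightarrow> (nat \<Rightarrow> 'a) \<Rightarrow> bool" where
  "gr_eq F g h \<longleftrightarrow> (\<forall>n. g n - h n \<in> F (Suc n))"

definition gr_add :: "(nat \<Rightarrow> 'a::comm_ring_1) \<Rightarrow> (nat \<Rightarrow> 'a) \<Rightarrow> nat \<Rightarrow> 'a" where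
  "gr_add g h = (\<lambda>n. g n + h n)"

definition gr_mult :: "(nat \<Rightarrow> 'a::comm_ring_1) \<Rightarrow> (nat \<Rightarrow> 'a) \<Rightarrow> nat \<Rightarrow> 'a" where
  "gr_mult g h = (\<lambda>n. \<Sum>i\<le>n. g i * h (n - i))"

definition gr_one :: "nat \<Rightarrow> 'a::comm_ring_1" where
  "gr_one = (\<lambda>n. if n = 0 then 1 else 0)"

definition gr_in_ideal :: "(nat \<Rightarrow> 'a::comm_ring_1 set) \<Rightarrow> (nat \<Rightarrow> 'a) list \<Rightarrow> (nat \<Rightarrow> 'a) \<Rightarrow> bool" where
  "gr_in_ideal F ys g \<longleftrightarrow> (\<exists>cs. length cs = length ys \<and> (\<forall>c\<in>set cs. gr_elem F c) \<and>
     gr_eq F g (foldr gr_add (map2 gr_mult cs ys) (\<lambda>_. 0)))"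

text \<open>Regular sequences in the unique homogeneous maximal ideal
M = m/F_1 \<oplus> \<Oplus>_{n\<ge>1} F_n/F_{n+1} of G(F), and depth G(F) = grade of M.\<close>
definition gr_regular_seq :: "'a::comm_ring_1 set \<Rightarrow> (nat \<Rightarrow> 'a set) \<Rightarrow> (nat \<Rightarrow> 'a) list \<Rightarrow> bool" where
  "gr_regular_seq m F ys \<longleftrightarrow> (\<forall>y\<in>set ys. gr_elem F y \<and> y 0 \<in> m) \<and>
     \<not> gr_in_ideal F ys gr_one \<and>
     (\<forall>i<length ys. \<forall>g. gr_elem F g \<longrightarrow> gr_in_ideal F (take i ys) (gr_mult (ys ! i) g)
                         \<longrightarrow> gr_in_ideal F (take i ys) g)"

definition depth_G :: "'a::comm_ring_1 set \<Rightarrow> (nat \<Rightarrow> 'a set) \<Rightarrow> nat" where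
  "depth_G m F = (GREATEST k. \<exists>ys. length ys = k \<and> gr_regular_seq m F ys)"

definition hilbert_series :: "(nat \<Rightarrow> 'a::comm_ring_1 set) \<Rightarrow> rat fps" where
  "hilbert_series F = Abs_fps (\<lambda>n. of_nat (ell (F (Suc n)) (F n)))"

definition hilb_poly_coeffs :: "(nat \<Rightarrow> 'a::comm_ring_1 set) \<Rightarrow> nat \<Rightarrow> (nat \<Rightarrow> int) \<Rightarrow> bool" where
  "hilb_poly_coeffs F d e \<longleftrightarrow> (\<forall>i>d. e i = 0) \<and> (\<exists>N. \<forall>n\<ge>N. n \<ge> 1 \<longrightarrow>
     int (ell (F n) UNIV) = (\<Sum>i\<le>d. (-1) ^ i * e i * int ((n + d - 1 - i) choose (d - i))))"

definition hilb_coeff :: "(nat \<Rightarrow> 'a::comm_ring_1 set) \<Rightarrow> nat \<Rightarrow> nat \<Rightarrow> int" where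
  "hilb_coeff F d i = (THE e. hilb_poly_coeffs F d e) i"

definition is_reduction :: "(nat \<Rightarrow> 'a::comm_ring_1 set) \<Rightarrow> 'a set \<Rightarrow> bool" where
  "is_reduction F Q \<longleftrightarrow> is_ideal Q \<and> Q \<subseteq> F 1 \<and>
     (\<exists>N. \<forall>n\<ge>N. F (Suc n) = ideal_prod Q (F n))"

definition minimal_reduction :: "(nat \<Rightarrow> 'a::comm_ring_1 set) \<Rightarrow> 'a set \<Rightarrow> bool" where
  "minimal_reduction F Q \<longleftrightarrow> is_reduction F Q \<and>
     (\<forall>Q'. is_reduction F Q' \<and> Q' \<subseteq> Q \<longrightarrow> Q' = Q)"

definition nr_Q :: "(nat \<Rightarrow> 'a::comm_ring_1 set) \<Rightarrow> 'a set \<Rightarrow> nat" where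
  "nr_Q F Q = (LEAST r. F (Suc r) = ideal_prod Q (F r))"

definition nr :: "(nat \<Rightarrow> 'a::comm_ring_1 set) \<Rightarrow> nat" where
  "nr F = (LEAST r. \<exists>Q. minimal_reduction F Q \<and> nr_Q F Q = r)"

end

theory Submission
  imports Defs "HOL-Computational_Algebra.Polynomial"
begin

text \<open>
  Depth is invariant under exchange of regular elements, so the (possibly inhomogeneous) regular sequence
  witnessing \<open>depth G(F) \<ge> d - 1\<close> can be replaced by initial forms of \<open>x\<^sub>1, \<dots>, x\<^bsub>d-1\<^esub> \<in> F\<^sub>1\<close>.
  Dividing by each of them multiplies the Hilbert series by \<open>1 - t\<close>, which reduces everything to
  \<open>B = A/(x\<^sub>1, \<dots>, x\<^bsub>d-1\<^esub>)\<close> with the induced filtration \<open>E\<^sub>n\<close>, a one-dimensional Cohen-Macaulay ring.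
  There a further superficial element \<open>x\<close> satisfies \<open>E\<^bsub>n+1\<^esub> = x E\<^sub>n\<close> for large \<open>n\<close>, and
  \<open>\<ell>(E\<^sub>n/E\<^bsub>n+1\<^esub>) = e\<^sub>0 - v\<^sub>n\<close> with \<open>v\<^sub>n = \<ell>(E\<^bsub>n+1\<^esub>/x E\<^sub>n)\<close>; hence \<open>v\<^sub>0 = e\<^sub>0 - \<lambda>\<close> and \<open>e\<^sub>1 = \<Sum>v\<^sub>n\<close>.
  The ideal \<open>Q = (x\<^sub>1, \<dots>, x\<^bsub>d-1\<^esub>, x)\<close> is a minimal reduction and \<open>v\<^sub>n = 0\<close> forces \<open>F\<^bsub>n+1\<^esub> = Q F\<^sub>n\<close>, so
  \<open>v\<^sub>n \<ge> 1\<close> for \<open>n < r\<close>. Maximality of \<open>r\<close> says \<open>\<Sum>\<^bsub>n\<ge>1\<^esub> v\<^sub>n = r - 1\<close>, which leaves only \<open>v\<^sub>n = 1\<close> for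
  \<open>1 \<le> n < r\<close> and \<open>v\<^sub>n = 0\<close> for \<open>n \<ge> r\<close>.
\<close>

unbundle fps_syntax

section \<open>Ideals of a subring\<close>

text \<open>Quotients are never formed. Rings are carrier sets inside a fixed type and S/I is
  represented by the ideal I, so exchange of regular elements is proved once and used both for A and
  for the Rees ring, whose quotients are the graded rings. Homological algebra is avoided: exchange
  rests on comparing socles. After d-1 cuts the graded ring of B may have depth 0, so the initial
  form of the last element x may be a zero-divisor. It is chosen regular only modulo the elements
  killed by all high degrees, and regularity of x on B is demanded separately; this suffices for
  E_{n+1} = x E_n in high degrees. Dimension enters without the height theorem: each regular element
  adds one step to a chain of primes, so d of them leave m as the only prime above Q. Minimality of
  Q comes from the fact that fewer elements of m than the depth of A cannot generate an ideal
  containing a power of every element of m.\<close>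

definition subring :: "'b::comm_ring_1 set \<Rightarrow> bool" where
  "subring S \<longleftrightarrow> 1 \<in> S \<and> (\<forall>x\<in>S. \<forall>y\<in>S. x - y \<in> S \<and> x * y \<in> S)"

definition sideal :: "'b::comm_ring_1 set \<Rightarrow> 'b set \<Rightarrow> bool" where
  "sideal S I \<longleftrightarrow> I \<subseteq> S \<and> 0 \<in> I \<and> (\<forall>x\<in>I. \<forall>y\<in>I. x + y \<in> I) \<and> (\<forall>a\<in>S. \<forall>x\<in>I. a * x \<in> I)"

definition colon :: "'b::comm_ring_1 set \<Rightarrow> 'b set \<Rightarrow> 'b \<Rightarrow> 'b set" where
  "colon S J a = {c \<in> S. c * a \<in> J}"

definition nzd :: "'b::comm_ring_1 set \<Rightarrow> 'b \<Rightarrow> 'b set \<Rightarrow> bool" where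
  "nzd S z I \<longleftrightarrow> (\<forall>g\<in>S. z * g \<in> I \<longrightarrow> g \<in> I)"

lemma subring_props:
  assumes "subring S"
  shows "1 \<in> S" "0 \<in> S" "\<And>x y. x \<in> S \<Longrightarrow> y \<in> S \<Longrightarrow> x - y \<in> S" "\<And>x y. x \<in> S \<Longrightarrow> y \<in> S \<Longrightarrow> x * y \<in> S"
    "\<And>x. x \<in> S \<Longrightarrow> - x \<in> S" "\<And>x y. x \<in> S \<Longrightarrow> y \<in> S \<Longrightarrow> x + y \<in> S"
proof -
  show 1: "1 \<in> S" and m: "\<And>x y. x \<in> S \<Longrightarrow> y \<in> S \<Longrightarrow> x - y \<in> S"
    and "\<And>x y. x \<in> S \<Longrightarrow> y \<in> S \<Longrightarrow> x * y \<in> S"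
    using assms by (auto simp: subring_def)
  show 0: "0 \<in> S" using m[OF 1 1] by simp
  show n: "\<And>x. x \<in> S \<Longrightarrow> - x \<in> S" using m[OF 0] by simp
  show "\<And>x y. x \<in> S \<Longrightarrow> y \<in> S \<Longrightarrow> x + y \<in> S" using m n by (metis diff_minus_eq_add)
qed

lemma subring_sum:
  assumes "subring S" "\<And>i. i \<in> B \<Longrightarrow> f i \<in> S"
  shows "sum f B \<in> S"
  using assms(2) by (induction B rule: infinite_finite_induct) (simp_all add: subring_props(2,6)[OF assms(1)])

lemma subring_power: "subring S \<Longrightarrow> x \<in> S \<Longrightarrow> x ^ n \<in> S"
  by (induction n) (simp_all add: subring_props(1,4))

lemma sideal_props:
  assumes "sideal S I"
  shows "\<And>x. x \<in> I \<Longrightarrow> x \<in> S" "0 \<in> I" "\<And>x y. x \<in> I \<Longrightarrow> y \<in> I \<Longrightarrow> x + y \<in> I"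
    "\<And>a x. a \<in> S \<Longrightarrow> x \<in> I \<Longrightarrow> a * x \<in> I" "\<And>a x. a \<in> S \<Longrightarrow> x \<in> I \<Longrightarrow> x * a \<in> I"
  using assms unfolding sideal_def by (blast, blast, blast, blast, metis mult.commute)

lemma sideal_neg:
  assumes "subring S" "sideal S I"
  shows "\<And>x. x \<in> I \<Longrightarrow> - x \<in> I" "\<And>x y. x \<in> I \<Longrightarrow> y \<in> I \<Longrightarrow> x - y \<in> I"
proof -
  show n: "\<And>x. x \<in> I \<Longrightarrow> - x \<in> I"
    using sideal_props(4)[OF assms(2), of "-1"] subring_props[OF assms(1)] by simp
  show "\<And>x y. x \<in> I \<Longrightarrow> y \<in> I \<Longrightarrow> x - y \<in> I"
    using n sideal_props(3)[OF assms(2)] by (metis diff_conv_add_uminus)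
qed

lemma sideal_sum:
  assumes "sideal S I" "\<And>i. i \<in> B \<Longrightarrow> f i \<in> I"
  shows "sum f B \<in> I"
  using assms(2) by (induction B rule: infinite_finite_induct) (simp_all add: sideal_props(2,3)[OF assms(1)])

lemma sideal_colon:
  assumes "subring S" "sideal S J" "a \<in> S"
  shows "sideal S (colon S J a)"
  using subring_props[OF assms(1)] sideal_props[OF assms(2)] assms(3)
  by (auto simp: sideal_def colon_def distrib_right mult.assoc)

text \<open>Two values of g with v + g*u in the same ideal would put u itself there, differences
  being units. So an ideal without u excludes at most one g, and one that contains u but not v
  excludes none. This works for arbitrary ideals, not only primes, which
  \<open>dep_lt_generators\<close> relies on.\<close>

lemma exists_avoiding_finite_union:
  fixes S :: "'b::comm_ring_1 set"
  assumes S: "subring S" and G: "infinite G" "G \<subseteq> S"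
    and unit: "\<And>a b. a \<in> G \<Longrightarrow> b \<in> G \<Longrightarrow> a \<noteq> b \<Longrightarrow> \<exists>u\<in>S. u * (a - b) = 1"
    and V: "sideal S V" and fin: "finite NN"
    and N: "\<And>N. N \<in> NN \<Longrightarrow> sideal S N" "\<And>N. N \<in> NN \<Longrightarrow> \<not> V \<subseteq> N"
  shows "\<exists>v\<in>V. \<forall>N\<in>NN. v \<notin> N"
  using fin N
proof (induction NN rule: finite_induct)
  case empty
  then show ?case using sideal_props(2)[OF V] by auto
next
  case (insert N NN)
  then obtain u where u: "u \<in> V" "\<And>N'. N' \<in> NN \<Longrightarrow> u \<notin> N'" by blast
  show ?case
  proof (cases "u \<in> N")
    case False
    then show ?thesis using u by auto
  next
    case True
    obtain v where v: "v \<in> V" "v \<notin> N" using insert.prems(2)[of N] by auto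
    have N: "sideal S N" and NN: "\<And>N'. N' \<in> NN \<Longrightarrow> sideal S N'" using insert.prems(1) by auto
    have notN: "v + g * u \<notin> N" if "g \<in> G" for g
    proof
      assume "v + g * u \<in> N"
      moreover have "g * u \<in> N" using that G True sideal_props[OF N] by auto
      ultimately have "v + g * u - g * u \<in> N" using sideal_neg[OF S N] by blast
      then show False using v by simp
    qed
    have one: "a = b" if h: "N' \<in> NN" "a \<in> G" "b \<in> G" "v + a * u \<in> N'" "v + b * u \<in> N'" for N' a b
    proof (rule ccontr)
      assume "a \<noteq> b"
      then obtain w where w: "w \<in> S" "w * (a - b) = 1" using unit h by blast
      have "(v + a * u) - (v + b * u) \<in> N'" using h sideal_neg[OF S NN] by blast
      then have "w * ((v + a * u) - (v + b * u)) \<in> N'" using w sideal_props(4)[OF NN] h by blast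
      also have "w * ((v + a * u) - (v + b * u)) = (w * (a - b)) * u" by (simp add: algebra_simps)
      finally show False using w u h by simp
    qed
    define bad where "bad N' = {g \<in> G. v + g * u \<in> N'}" for N'
    have "finite (bad N')" if "N' \<in> NN" for N'
    proof (cases "bad N' = {}")
      case False
      then obtain a where "a \<in> bad N'" by auto
      then have "bad N' \<subseteq> {a}" using one that by (auto simp: bad_def)
      then show ?thesis using finite_subset by blast
    qed auto
    then have "finite (\<Union>N'\<in>NN. bad N')" using insert.hyps by auto
    then obtain g where g: "g \<in> G" "g \<notin> (\<Union>N'\<in>NN. bad N')" using G
      by (meson finite_subset subsetI)
    have "v + g * u \<in> V" using g G u v sideal_props[OF V] by auto
    then show ?thesis using g notN by (auto simp: bad_def)
  qed
qed

section \<open>Colon ideals and associated primes\<close>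

locale noeth_subring =
  fixes S :: "'b::comm_ring_1 set"
  assumes subring: "subring S"
    and noeth: "\<And>C. C \<noteq> {} \<Longrightarrow> (\<And>I. I \<in> C \<Longrightarrow> sideal S I) \<Longrightarrow> \<exists>I\<in>C. \<forall>J\<in>C. I \<subseteq> J \<longrightarrow> J = I"
begin

lemmas S_props = subring_props[OF subring]

lemma chain_stable:
  assumes "\<And>n::nat. sideal S (T n)" "\<And>n. T n \<subseteq> T (Suc n)"
  shows "\<exists>n. \<forall>k\<ge>n. T k = T n"
proof -
  obtain I where I: "I \<in> range T" "\<forall>J\<in>range T. I \<subseteq> J \<longrightarrow> J = I"
    using noeth[of "range T"] assms(1) by blast
  then obtain n where n: "I = T n" by auto
  have "T k = T n" if "k \<ge> n" for k
    using I n lift_Suc_mono_le[of T, OF assms(2) that] by auto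
  then show ?thesis by blast
qed

text \<open>Since c*a is outside J and (J : a) lies in (J : c*a), maximality makes the two equal,
  and b belongs to the latter.\<close>

lemma maximal_colon_prime:
  assumes J: "sideal S J" and a: "a \<in> S - J"
    and mx: "\<And>b. b \<in> S - J \<Longrightarrow> colon S J a \<subseteq> colon S J b \<Longrightarrow> colon S J b = colon S J a"
    and bc: "b \<in> S" "c \<in> S" "b * c \<in> colon S J a" "c \<notin> colon S J a"
  shows "b \<in> colon S J a"
proof -
  have ca: "c * a \<in> S - J" using bc a S_props by (auto simp: colon_def)
  have "colon S J a \<subseteq> colon S J (c * a)"
  proof
    fix x assume "x \<in> colon S J a"
    then have x: "x \<in> S" "x * a \<in> J" by (auto simp: colon_def)
    have "c * (x * a) \<in> J" using x bc sideal_props[OF J] by auto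
    then show "x \<in> colon S J (c * a)" using x by (simp add: colon_def mult.left_commute)
  qed
  then have "colon S J (c * a) = colon S J a" using mx[OF ca] by blast
  moreover have "b \<in> colon S J (c * a)" using bc by (auto simp: colon_def mult.assoc)
  ultimately show ?thesis by simp
qed

text \<open>The associated primes of S/J that are maximal among all annihilators (J : a). They
  already cover the zero-divisors, and their maximality drives the finiteness proof.\<close>

definition ass :: "'b set \<Rightarrow> 'b set set" where
  "ass J = {P. \<exists>a\<in>S - J. P = colon S J a \<and>
      (\<forall>b\<in>S - J. colon S J a \<subseteq> colon S J b \<longrightarrow> colon S J b = colon S J a)}"

lemma assE:
  assumes J: "sideal S J" and P: "P \<in> ass J"
  obtains a where "a \<in> S" "a \<notin> J" "P = colon S J a" "1 \<notin> P" "sideal S P"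
    "\<And>b c. b \<in> S \<Longrightarrow> c \<in> S \<Longrightarrow> b * c \<in> P \<Longrightarrow> b \<in> P \<or> c \<in> P" "J \<subseteq> P"
proof -
  obtain a where a: "a \<in> S - J" "P = colon S J a"
    "\<forall>b\<in>S - J. colon S J a \<subseteq> colon S J b \<longrightarrow> colon S J b = colon S J a"
    using P by (auto simp: ass_def)
  have "J \<subseteq> P" using a sideal_props[OF J] by (auto simp: colon_def)
  moreover have "1 \<notin> P" using a by (auto simp: colon_def)
  moreover have "sideal S P" using a sideal_colon[OF subring J] by simp
  ultimately show ?thesis using that[of a] a maximal_colon_prime[OF J, of a] by blast
qed

lemma zero_divisor_in_ass:
  assumes J: "sideal S J" and "g \<in> S" "g \<notin> J" "c \<in> S" "c * g \<in> J"
  shows "\<exists>P\<in>ass J. c \<in> P"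
proof -
  define C where "C = {colon S J b | b. b \<in> S - J \<and> colon S J g \<subseteq> colon S J b}"
  have "colon S J g \<in> C" using assms by (auto simp: C_def)
  moreover have "\<And>I. I \<in> C \<Longrightarrow> sideal S I" using sideal_colon[OF subring J] by (auto simp: C_def)
  ultimately obtain P where P: "P \<in> C" "\<forall>Q\<in>C. P \<subseteq> Q \<longrightarrow> Q = P" using noeth[of C] by auto
  then obtain b where b: "b \<in> S - J" "P = colon S J b" "colon S J g \<subseteq> colon S J b"
    by (auto simp: C_def)
  have "P \<in> ass J" unfolding ass_def
  proof (intro CollectI bexI[of _ b] conjI ballI impI)
    fix b' assume b': "b' \<in> S - J" "colon S J b \<subseteq> colon S J b'"
    then have "colon S J b' \<in> C" using b unfolding C_def by blast
    then show "colon S J b' = colon S J b" using P(2) b b' by blast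
  qed (use b in auto)
  moreover have "c \<in> P" using b assms by (auto simp: colon_def)
  ultimately show ?thesis by blast
qed

text \<open>For infinitely many distinct f i, the ideals J : (f 0 \<inter> ... \<inter> f (n-1))
  ascend. Where the chain stops, the element defining f n is carried into J by that intersection, so
  the intersection lies in f n. Primality gives f i inside f n for some i < n, and maximality gives
  equality.\<close>

lemma finite_ass:
  assumes J: "sideal S J"
  shows "finite (ass J)"
proof (rule ccontr)
  assume "infinite (ass J)"
  then obtain f :: "nat \<Rightarrow> 'b set" where f: "inj f" "range f \<subseteq> ass J"
    using infinite_countable_subset by blast
  define T where "T n = {g \<in> S. \<forall>c\<in>S. (\<forall>i<n. c \<in> f i) \<longrightarrow> c * g \<in> J}" for n :: nat
  have T: "sideal S (T n)" for n
    using S_props sideal_props[OF J] by (auto simp: sideal_def T_def distrib_left mult.left_commute)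
  have "T n \<subseteq> T (Suc n)" for n by (auto simp: T_def)
  from chain_stable[of T, OF T this] obtain n where n: "T (Suc n) = T n" by (meson le_SucI le_refl)
  have fa: "f i \<in> ass J" for i using f by auto
  from assE[OF J fa[of n]] obtain a where a: "a \<in> S" "a \<notin> J" "f n = colon S J a" "1 \<notin> f n"
    "\<And>b c. b \<in> S \<Longrightarrow> c \<in> S \<Longrightarrow> b * c \<in> f n \<Longrightarrow> b \<in> f n \<or> c \<in> f n"
    by metis
  have "a \<in> T (Suc n)" using a by (auto simp: T_def colon_def)
  then have aT: "a \<in> T n" using n by simp
  have "\<exists>i<n. f i \<subseteq> f n"
  proof (rule ccontr)
    assume "\<not> ?thesis"
    then have "\<forall>i. \<exists>c. i < n \<longrightarrow> c \<in> f i \<and> c \<notin> f n" by blast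
    then obtain c where c: "\<And>i. i < n \<Longrightarrow> c i \<in> f i" "\<And>i. i < n \<Longrightarrow> c i \<notin> f n" by metis
    have fS: "sideal S (f i)" for i using assE[OF J fa[of i]] by metis
    have cS: "c i \<in> S" if "i < n" for i using c(1)[OF that] sideal_props(1)[OF fS] by blast
    \<comment> \<open>The product of the c i lies in every f i with i < n but, by primality, not in
      f n.\<close>
    have prod: "prod c {..<k} \<in> S \<and> (\<forall>i<k. prod c {..<k} \<in> f i) \<and> prod c {..<k} \<notin> f n"
      if "k \<le> n" for k
      using that
    proof (induction k)
      case 0
      then show ?case using a S_props by auto
    next
      case (Suc k)
      then have IH: "prod c {..<k} \<in> S" "\<forall>i<k. prod c {..<k} \<in> f i" "prod c {..<k} \<notin> f n" by auto
      have k: "c k \<in> S" "c k \<in> f k" "c k \<notin> f n" using c cS Suc by auto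
      have "prod c {..<k} * c k \<in> f i" if "i < Suc k" for i
        using IH k that sideal_props[OF fS[of i]] less_Suc_eq by metis
      then show ?case using IH k a(5)[of "prod c {..<k}" "c k"] S_props by auto
    qed
    have "prod c {..<n} * a \<in> J" using prod[of n] aT by (auto simp: T_def)
    then have "prod c {..<n} \<in> f n" using a prod[of n] by (auto simp: colon_def)
    then show False using prod[of n] by auto
  qed
  then obtain i where i: "i < n" "f i \<subseteq> f n" by auto
  from fa[of i] obtain b where "f i = colon S J b"
    "\<forall>c\<in>S - J. colon S J b \<subseteq> colon S J c \<longrightarrow> colon S J c = colon S J b"
    unfolding ass_def by blast
  then have "f n = f i" using i(2) a(1,2,3) by blast
  then show False using f i by (auto dest: injD)
qed

end

text \<open>Regular sequences are taken in M, and G plays the role of an infinite residue field. The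
  instances are A with m, and the Rees ring with \<open>MR\<close>.\<close>

locale depth_subring = noeth_subring S for S :: "'b::comm_ring_1 set" +
  fixes M G :: "'b set"
  assumes M: "sideal S M" and G: "infinite G" "G \<subseteq> S"
    and unit: "\<And>a b. a \<in> G \<Longrightarrow> b \<in> G \<Longrightarrow> a \<noteq> b \<Longrightarrow> \<exists>u\<in>S. u * (a - b) = 1"
begin

lemmas M_props = sideal_props[OF M]

definition ext :: "'b set \<Rightarrow> 'b \<Rightarrow> 'b set" where
  "ext I z = {i + z * b | i b. i \<in> I \<and> b \<in> S}"

text \<open>A weakly regular sequence of length k in M on S/I: depth at least k, without properness
  of the last quotient. Peeling off the first element is the form that the exchange induction
  needs.\<close>

fun dep :: "nat \<Rightarrow> 'b set \<Rightarrow> bool" where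
  "dep 0 I = True"
| "dep (Suc k) I = (\<exists>z\<in>M. nzd S z I \<and> dep k (ext I z))"

lemma dep_mono: "j \<le> k \<Longrightarrow> dep k I \<Longrightarrow> dep j I"
proof (induction k arbitrary: j I)
  case (Suc k)
  obtain z where z: "z \<in> M" "nzd S z I" "dep k (ext I z)" using Suc.prems(2) by auto
  show ?case
  proof (cases j)
    case (Suc i)
    then have "dep i (ext I z)" using Suc.IH z(3) Suc.prems(1) by simp
    then show ?thesis using z Suc by auto
  qed simp
qed simp

lemma extE:
  assumes "g \<in> ext I z"
  obtains i b where "i \<in> I" "b \<in> S" "g = i + z * b"
  using assms by (auto simp: ext_def)

lemma extI:
  assumes "b \<in> S" "g - z * b \<in> I"
  shows "g \<in> ext I z"
  unfolding ext_def using assms by (intro CollectI exI[of _ "g - z * b"] exI[of _ b]) simp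

lemma ext_sideal:
  assumes I: "sideal S I" and z: "z \<in> S"
  shows "sideal S (ext I z)"
  unfolding sideal_def
proof (intro conjI ballI)
  show "ext I z \<subseteq> S" using z sideal_props(1)[OF I] S_props(4,6) by (auto simp: ext_def)
  show "0 \<in> ext I z" using S_props(2) sideal_props(2)[OF I] by (intro extI[of 0]) simp_all
  fix x y
  show "x + y \<in> ext I z" if xy: "x \<in> ext I z" "y \<in> ext I z"
  proof -
    obtain i b where 1: "i \<in> I" "b \<in> S" "x = i + z * b" using xy(1) by (rule extE)
    obtain j c where 2: "j \<in> I" "c \<in> S" "y = j + z * c" using xy(2) by (rule extE)
    have "x + y - z * (b + c) = i + j" unfolding 1 2 by (simp add: algebra_simps)
    moreover have "i + j \<in> I" using 1 2 sideal_props(3)[OF I] by blast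
    ultimately show ?thesis using S_props(6)[OF 1(2) 2(2)] extI by metis
  qed
  show "x * y \<in> ext I z" if xy: "x \<in> S" "y \<in> ext I z"
  proof -
    obtain j c where 2: "j \<in> I" "c \<in> S" "y = j + z * c" using xy(2) by (rule extE)
    have "x * y - z * (x * c) = x * j" using 2 by (simp add: algebra_simps)
    then show ?thesis using 2 xy(1) sideal_props(4)[OF I] S_props(4) by (intro extI[of "x * c"]) simp_all
  qed
qed

lemma ext_commute: "ext (ext I z) w = ext (ext I w) z"
proof -
  have "ext (ext I z) w \<subseteq> ext (ext I w) z" for z w
  proof
    fix g assume "g \<in> ext (ext I z) w"
    then obtain h c where 1: "h \<in> ext I z" "c \<in> S" "g = h + w * c" by (rule extE)
    obtain i b where 2: "i \<in> I" "b \<in> S" "h = i + z * b" using 1(1) by (rule extE)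
    have "i + w * c \<in> ext I w" using 1 2 by (intro extI[of c]) simp_all
    moreover have "g - z * b = i + w * c" using 1 2 by simp
    ultimately show "g \<in> ext (ext I w) z" using extI[OF 2(2), of g z] by simp
  qed
  then show ?thesis by blast
qed

text \<open>The half of permutability of regular sequences that needs no Nakayama: z*g = i + w*b
  forces b into (I,z), after which z can be cancelled.\<close>

lemma nzd_swap:
  assumes I: "sideal S I" and z: "z \<in> M" "nzd S z I" and w: "w \<in> M" "nzd S w (ext I z)"
  shows "nzd S z (ext I w)"
  unfolding nzd_def
proof (intro ballI impI)
  fix g assume g: "g \<in> S" "z * g \<in> ext I w"
  note Ip = sideal_props[OF I] sideal_neg[OF subring I]
  obtain i b where 1: "i \<in> I" "b \<in> S" "z * g = i + w * b" using g(2) by (rule extE)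
  have zS: "z \<in> S" "w \<in> S" using z w M_props by auto
  have "w * b - z * g = - i" using 1 by simp
  then have "w * b \<in> ext I z" using 1 g(1) Ip by (intro extI[of g]) simp_all
  then have "b \<in> ext I z" using w 1 by (auto simp: nzd_def)
  then obtain j c where 2: "j \<in> I" "c \<in> S" "b = j + z * c" by (rule extE)
  have "z * (g - w * c) = z * g - w * (z * c)" by (simp add: algebra_simps)
  also have "\<dots> = i + w * j" unfolding 1 2 by (simp add: algebra_simps)
  finally have "z * (g - w * c) \<in> I" using 1 2 Ip zS by auto
  then have "g - w * c \<in> I" using z 1 2 g zS S_props by (auto simp: nzd_def)
  then show "g \<in> ext I w" using 2 by (intro extI[of c])
qed

text \<open>The vanishing of Hom(S/M, S/J). It stands in for "M contains an S/J-regular element"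
  because it can be transported between quotients.\<close>

definition nosoc :: "'b set \<Rightarrow> bool" where
  "nosoc J \<longleftrightarrow> (\<forall>a\<in>S. (\<forall>c\<in>M. c * a \<in> J) \<longrightarrow> a \<in> J)"

text \<open>A prime of \<open>ass J\<close> is some (J : a) with a outside J, so M inside it would
  make a a socle element. Avoiding both finite sets of primes together yields one w for J and
  K.\<close>

lemma nosoc_common_nzd:
  assumes J: "sideal S J" "nosoc J" and K: "sideal S K" "nosoc K"
  shows "\<exists>w\<in>M. nzd S w J \<and> nzd S w K"
proof -
  have ns: "sideal S N \<and> \<not> M \<subseteq> N" if J: "sideal S J" "nosoc J" and N: "N \<in> ass J" for J N
  proof -
    obtain a where "a \<in> S" "a \<notin> J" "N = colon S J a" "sideal S N" using assE[OF J(1) N] by metis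
    then show ?thesis using J(2) by (auto simp: nosoc_def colon_def)
  qed
  have "\<exists>v\<in>M. \<forall>N\<in>ass J \<union> ass K. v \<notin> N"
    using ns[OF J] ns[OF K] finite_ass[OF J(1)] finite_ass[OF K(1)]
    by (intro exists_avoiding_finite_union[OF subring G unit M]) auto
  then obtain v where v: "v \<in> M" "\<And>N. N \<in> ass J \<Longrightarrow> v \<notin> N" "\<And>N. N \<in> ass K \<Longrightarrow> v \<notin> N" by auto
  have "nzd S v J" using zero_divisor_in_ass[OF J(1)] v M_props(1) unfolding nzd_def by blast
  moreover have "nzd S v K" using zero_divisor_in_ass[OF K(1)] v M_props(1) unfolding nzd_def by blast
  ultimately show ?thesis using v by blast
qed

text \<open>The socles of \<open>S/(I,x)\<close> and \<open>S/(I,z)\<close> are isomorphic when \<open>x\<close> and \<open>z\<close> are both regular on \<open>S/I\<close>.\<close>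
lemma nosoc_exchange:
  assumes I: "sideal S I" and z: "z \<in> M" "nzd S z I" and x: "x \<in> M" "nzd S x I"
    and ns: "nosoc (ext I z)"
  shows "nosoc (ext I x)"
  unfolding nosoc_def
proof (intro ballI impI)
  fix a assume a: "a \<in> S" "\<forall>c\<in>M. c * a \<in> ext I x"
  note Ip = sideal_props[OF I] sideal_neg[OF subring I]
  have zS: "z \<in> S" "x \<in> S" using z x M_props by auto
  \<comment> \<open>The isomorphism of socles sends a to this w, given by z*a = x*w modulo
    I.\<close>
  from a z obtain i w where 1: "i \<in> I" "w \<in> S" "z * a = i + x * w" by (metis extE)
  have "c * w \<in> ext I z" if c: "c \<in> M" for c
  proof -
    have cS: "c \<in> S" using c M_props by auto
    from a c obtain j v where 2: "j \<in> I" "v \<in> S" "c * a = j + x * v" by (metis extE)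
    have "x * (c * w - z * v) = c * (x * w) - z * (x * v)" by (simp add: algebra_simps)
    also have "\<dots> = c * (z * a - i) - z * (c * a - j)" unfolding 1 2 by simp
    also have "\<dots> = z * j - c * i" by (simp add: algebra_simps)
    finally have "x * (c * w - z * v) \<in> I" using 1 2 cS zS Ip by auto
    then have "c * w - z * v \<in> I" using x 1 2 cS zS S_props by (auto simp: nzd_def)
    then show ?thesis using 2 by (intro extI[of v])
  qed
  then have "w \<in> ext I z" using ns 1 by (auto simp: nosoc_def)
  then obtain j b where 2: "j \<in> I" "b \<in> S" "w = j + z * b" by (rule extE)
  have "z * (a - x * b) = z * a - x * (z * b)" by (simp add: algebra_simps)
  also have "\<dots> = i + x * j" unfolding 1 2 by (simp add: algebra_simps)
  finally have "z * (a - x * b) \<in> I" using 1 2 zS Ip by auto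
  then have "a - x * b \<in> I" using z 2 a zS S_props by (auto simp: nzd_def)
  then show "a \<in> ext I x" using 2 by (intro extI[of b])
qed

text \<open>Choosing \<open>w\<close> regular modulo both \<open>(I,z)\<close> and \<open>(I,x)\<close>, the claim follows by
  passing from \<open>z\<close> to \<open>w\<close> and then from \<open>w\<close> to \<open>x\<close>.\<close>
theorem dep_exchange:
  assumes "sideal S I" "dep (Suc k) I" "x \<in> M" "nzd S x I"
  shows "dep k (ext I x)"
  using assms
proof (induction k arbitrary: I x)
  case 0
  then show ?case by simp
next
  case (Suc k)
  note I = \<open>sideal S I\<close> and x = \<open>x \<in> M\<close> \<open>nzd S x I\<close>
  from Suc.prems(2) obtain z z2 where z: "z \<in> M" "nzd S z I" "dep (Suc k) (ext I z)"
    and z2: "z2 \<in> M" "nzd S z2 (ext I z)" by auto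
  have zS: "z \<in> S" "x \<in> S" using z x M_props by auto
  \<comment> \<open>The depth is at least two, so there is a second regular element, and its
    existence rules out a socle.\<close>
  have nz: "nosoc (ext I z)" using z2 unfolding nosoc_def nzd_def by (metis)
  have nx: "nosoc (ext I x)" by (rule nosoc_exchange[OF I z(1,2) x nz])
  from nosoc_common_nzd[OF ext_sideal[OF I zS(1)] nz ext_sideal[OF I zS(2)] nx]
  obtain w where w: "w \<in> M" "nzd S w (ext I z)" "nzd S w (ext I x)" by blast
  have wS: "w \<in> S" using w M_props by auto
  have 1: "dep k (ext (ext I w) z)"
    using Suc.IH[OF ext_sideal[OF I zS(1)] z(3) w(1,2)] ext_commute[of I z w] by simp
  \<comment> \<open>By \<open>nzd_swap\<close> both z and x remain regular modulo (I,w), so over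
    that base the induction hypothesis trades z for x.\<close>
  have "dep (Suc k) (ext I w)" using 1 z nzd_swap[OF I z(1,2) w(1,2)] by auto
  from Suc.IH[OF ext_sideal[OF I wS] this x(1) nzd_swap[OF I x w(1,3)]]
  have "dep k (ext (ext I x) w)" using ext_commute[of I x w] by simp
  then show ?case using w by auto
qed

end

section \<open>Noetherian subrings and ideals of a ring\<close>

lemma noeth_subringI:
  assumes S: "subring S"
    and acc: "\<And>T. (\<And>n::nat. sideal S (T n)) \<Longrightarrow> (\<And>n. T n \<subseteq> T (Suc n)) \<Longrightarrow> \<exists>n. T (Suc n) = T n"
  shows "noeth_subring S"
proof
  show "subring S" by (rule S)
  fix C :: "'a set set"
  assume ne: "C \<noteq> {}" and C: "\<And>I. I \<in> C \<Longrightarrow> sideal S I"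
  show "\<exists>I\<in>C. \<forall>J\<in>C. I \<subseteq> J \<longrightarrow> J = I"
  proof (rule ccontr)
    assume "\<not> ?thesis"
    then have nx: "\<exists>J. J \<in> C \<and> I \<subset> J" if "I \<in> C" for I using that by blast
    have "\<exists>f. \<forall>n::nat. f n \<in> C \<and> f n \<subset> f (Suc n)"
      using ne nx by (intro dependent_nat_choice) auto
    then obtain f where f: "\<And>n::nat. f n \<in> C" "\<And>n. f n \<subset> f (Suc n)" by blast
    have "\<exists>n. f (Suc n) = f n"
    proof (rule acc)
      show "sideal S (f n)" for n using C f by blast
      show "f n \<subseteq> f (Suc n)" for n using f(2)[of n] by blast
    qed
    then show False using f(2) by blast
  qed
qed

section \<open>Hilbert's basis theorem and finitely generated extensions\<close>

definition adjoin :: "'b::comm_ring_1 set \<Rightarrow> 'b \<Rightarrow> 'b set" where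
  "adjoin S x = {poly p x | p. \<forall>i. coeff p i \<in> S}"

lemma adjoin_subring:
  assumes S: "subring S"
  shows "subring (adjoin S x)" "S \<subseteq> adjoin S x" "x \<in> adjoin S x"
proof -
  note Sp = subring_props[OF S]
  show sub: "S \<subseteq> adjoin S x"
  proof
    fix a assume "a \<in> S"
    then have "\<forall>i. coeff [:a:] i \<in> S" using Sp by (simp add: coeff_pCons split: nat.split)
    then show "a \<in> adjoin S x" unfolding adjoin_def by (intro CollectI exI[of _ "[:a:]"]) simp
  qed
  have "\<forall>i. coeff [:0, 1:] i \<in> S" using Sp by (simp add: coeff_pCons split: nat.split)
  then show "x \<in> adjoin S x" unfolding adjoin_def by (intro CollectI exI[of _ "[:0, 1:]"]) simp
  show "subring (adjoin S x)" unfolding subring_def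
  proof (intro conjI ballI)
    show "1 \<in> adjoin S x" using sub Sp by blast
    fix a b assume "a \<in> adjoin S x" "b \<in> adjoin S x"
    then obtain p q where p: "\<forall>i. coeff p i \<in> S" "a = poly p x" and q: "\<forall>i. coeff q i \<in> S" "b = poly q x"
      by (auto simp: adjoin_def)
    have "\<forall>i. coeff (p - q) i \<in> S" using p q Sp by simp
    then show "a - b \<in> adjoin S x" unfolding adjoin_def using p q by (intro CollectI exI[of _ "p - q"]) simp
    have "\<forall>i. coeff (p * q) i \<in> S" using p q Sp by (auto simp: coeff_mult intro!: subring_sum[OF S])
    then show "a * b \<in> adjoin S x" unfolding adjoin_def using p q by (intro CollectI exI[of _ "p * q"]) simp
  qed
qed

text \<open>The classical argument on leading coefficients, except that polynomials are judged by
  their value at x, which may be algebraic over S. \<open>L n k\<close> increases in both indices,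
  so one K serves all degrees n.\<close>

theorem hilbert_basis:
  assumes N: "noeth_subring S"
  shows "noeth_subring (adjoin S x)"
proof -
  interpret noeth_subring S by (rule N)
  let ?A = "adjoin S x"
  note As = adjoin_subring[OF subring, of x]
  show ?thesis
  proof (rule noeth_subringI[OF As(1)])
    fix T :: "nat \<Rightarrow> 'a set"
    assume T: "\<And>n. sideal ?A (T n)" and mono: "\<And>n. T n \<subseteq> T (Suc n)"
    define L where "L n k = {a \<in> S. \<exists>p. (\<forall>i. coeff p i \<in> S) \<and> degree p \<le> n \<and> coeff p n = a \<and> poly p x \<in> T k}"
      for n k
    have L: "sideal S (L n k)" for n k
      unfolding sideal_def
    proof (intro conjI ballI)
      show "L n k \<subseteq> S" by (auto simp: L_def)
      show "0 \<in> L n k" unfolding L_def using S_props sideal_props[OF T]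
        by (intro CollectI conjI exI[of _ 0]) auto
      fix a b assume a: "a \<in> L n k"
      then obtain p where p: "a \<in> S" "\<forall>i. coeff p i \<in> S" "degree p \<le> n" "coeff p n = a" "poly p x \<in> T k"
        by (auto simp: L_def)
      show "a + b \<in> L n k" if "b \<in> L n k"
      proof -
        from that obtain q where q: "b \<in> S" "\<forall>i. coeff q i \<in> S" "degree q \<le> n" "coeff q n = b" "poly q x \<in> T k"
          by (auto simp: L_def)
        show ?thesis unfolding L_def using p q S_props sideal_props[OF T]
          by (intro CollectI conjI exI[of _ "p + q"]) (auto intro: degree_add_le)
      qed
      show "b * a \<in> L n k" if "b \<in> S"
      proof -
        have "b \<in> ?A" using that As by blast
        then show ?thesis unfolding L_def using p that S_props sideal_props[OF T]
          by (intro CollectI conjI exI[of _ "smult b p"]) (auto intro: order.trans[OF degree_smult_le])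
      qed
    qed
    have Ln: "L n k \<subseteq> L (Suc n) k" for n k
    proof
      fix a assume "a \<in> L n k"
      then obtain p where p: "a \<in> S" "\<forall>i. coeff p i \<in> S" "degree p \<le> n" "coeff p n = a" "poly p x \<in> T k"
        by (auto simp: L_def)
      show "a \<in> L (Suc n) k" unfolding L_def using p S_props sideal_props[OF T] As
        by (intro CollectI conjI exI[of _ "pCons 0 p"])
          (auto simp: coeff_pCons split: nat.split intro: order.trans[OF degree_pCons_le])
    qed
    have Lk: "L n k \<subseteq> L n (Suc k)" for n k using mono by (auto simp: L_def)
    have Lk': "L n k \<subseteq> L n' k'" if "n \<le> n'" "k \<le> k'" for n k n' k'
      using lift_Suc_mono_le[of "\<lambda>n. L n k", OF Ln that(1)] lift_Suc_mono_le[of "L n'", OF Lk that(2)] by auto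
    have "\<exists>I\<in>range (case_prod L). \<forall>J\<in>range (case_prod L). I \<subseteq> J \<longrightarrow> J = I"
      by (rule noeth) (use L in auto)
    then obtain n0 k0 where mx: "\<And>n k. L n0 k0 \<subseteq> L n k \<Longrightarrow> L n k = L n0 k0"
      by auto
    have "\<exists>k. \<forall>k'\<ge>k. L n k' = L n k" for n by (rule chain_stable[of "L n", OF L Lk])
    then have "\<forall>n. \<exists>k. \<forall>k'\<ge>k. L n k' = L n k" by blast
    then obtain ks where ks: "\<And>n k'. k' \<ge> ks n \<Longrightarrow> L n k' = L n (ks n)" by metis
    \<comment> \<open>Rows from n0 on are constant from column k0; the finitely many rows below stop
      at \<open>ks n\<close>, and the sum bounds all of these.\<close>
    define K where "K = k0 + (\<Sum>n<n0. ks n)"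
    have LK: "L n (Suc K) = L n K" for n
    proof (cases "n < n0")
      case True
      then have "ks n \<le> (\<Sum>n<n0. ks n)" by (intro member_le_sum) auto
      then show ?thesis using ks[of n K] ks[of n "Suc K"] by (auto simp: K_def)
    next
      case False
      then show ?thesis using mx[OF Lk'[of n0 n k0 K]] mx[OF Lk'[of n0 n k0 "Suc K"]] by (auto simp: K_def)
    qed
    \<comment> \<open>Subtracting a q with value in T K and the same top coefficient lowers the
      degree bound.\<close>
    have main: "poly p x \<in> T K" if "\<forall>i. coeff p i \<in> S" "degree p \<le> n" "poly p x \<in> T (Suc K)" for n p
      using that
    proof (induction n arbitrary: p)
      case 0
      then have "coeff p 0 \<in> L 0 (Suc K)" unfolding L_def by blast
      then have "coeff p 0 \<in> L 0 K" using LK by blast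
      then obtain q where q: "degree q \<le> 0" "coeff q 0 = coeff p 0" "poly q x \<in> T K"
        by (auto simp: L_def)
      have "q = p" using q 0 by (intro poly_eqI) (metis coeff_eq_0 gr0I le_zero_eq)
      then show ?case using q by simp
    next
      case (Suc n)
      then have "coeff p (Suc n) \<in> L (Suc n) (Suc K)" unfolding L_def by blast
      then have "coeff p (Suc n) \<in> L (Suc n) K" using LK by blast
      then obtain q where q: "\<forall>i. coeff q i \<in> S" "degree q \<le> Suc n" "coeff q (Suc n) = coeff p (Suc n)" "poly q x \<in> T K"
        by (auto simp: L_def)
      have "poly (p - q) x \<in> T K"
      proof (rule Suc.IH)
        show "\<forall>i. coeff (p - q) i \<in> S" using q Suc.prems S_props by simp
        show "degree (p - q) \<le> n"
        proof (rule degree_le, intro allI impI)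
          fix i assume "n < i"
          then show "coeff (p - q) i = 0" using q Suc.prems
            by (cases "i = Suc n") (auto simp: coeff_eq_0)
        qed
        show "poly (p - q) x \<in> T (Suc K)"
          using q Suc.prems mono[of K] sideal_neg[OF As(1) T[of "Suc K"]] by auto
      qed
      then have "poly (p - q) x + poly q x \<in> T K" using q sideal_props[OF T] by blast
      then show ?case by simp
    qed
    have "T (Suc K) \<subseteq> T K"
    proof
      fix y assume y: "y \<in> T (Suc K)"
      then have "y \<in> ?A" using sideal_props(1)[OF T] by blast
      then obtain p where "\<forall>i. coeff p i \<in> S" "y = poly p x" by (auto simp: adjoin_def)
      then show "y \<in> T K" using main[of p "degree p"] y by auto
    qed
    then show "\<exists>n. T (Suc n) = T n" using mono by blast
  qed
qed

lemma adjoin_least: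
  assumes T: "subring T" and "S \<subseteq> T" "x \<in> T"
  shows "adjoin S x \<subseteq> T"
proof
  fix y assume "y \<in> adjoin S x"
  then obtain p where p: "\<forall>i. coeff p i \<in> S" "y = poly p x" by (auto simp: adjoin_def)
  have "(\<Sum>i\<le>degree p. coeff p i * x ^ i) \<in> T"
    using p assms subring_props(4)[OF T] subring_power[OF T] by (intro subring_sum[OF T]) blast
  then show "y \<in> T" using p by (simp add: poly_altdef)
qed

text \<open>When B contains enough algebra generators, S' is all of T; this is how the Rees ring is
  shown to be noetherian.\<close>

lemma noeth_finite_adjoin:
  assumes N: "noeth_subring S" and T: "subring T" "S \<subseteq> T" and B: "finite B" "B \<subseteq> T"
  shows "\<exists>S'. noeth_subring S' \<and> S \<subseteq> S' \<and> B \<subseteq> S' \<and> S' \<subseteq> T"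
  using B
proof (induction B rule: finite_induct)
  case empty
  then show ?case using N T by blast
next
  case (insert x B)
  then obtain S' where S': "noeth_subring S'" "S \<subseteq> S'" "B \<subseteq> S'" "S' \<subseteq> T" by auto
  note sr = noeth_subring.subring[OF S'(1)]
  show ?case
    using hilbert_basis[OF S'(1), of x] adjoin_subring[OF sr, of x] adjoin_least[OF T(1) S'(4), of x] S' insert.prems
    by (intro exI[of _ "adjoin S' x"]) auto
qed

section \<open>Ideals of the whole ring\<close>

lemma subring_UNIV: "subring UNIV" by (simp add: subring_def)

lemma sideal_UNIV: "sideal UNIV I \<longleftrightarrow> is_ideal I"
  by (auto simp: sideal_def is_ideal_def)

lemma is_idealD:
  assumes "is_ideal I"
  shows "0 \<in> I" "\<And>x y. x \<in> I \<Longrightarrow> y \<in> I \<Longrightarrow> x + y \<in> I" "\<And>x y. x \<in> I \<Longrightarrow> y \<in> I \<Longrightarrow> x - y \<in> I"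
    "\<And>a x. x \<in> I \<Longrightarrow> a * x \<in> I" "\<And>a x. x \<in> I \<Longrightarrow> x * a \<in> I" "\<And>x. x \<in> I \<Longrightarrow> - x \<in> I"
  using assms sideal_neg[OF subring_UNIV, of I] by (auto simp: is_ideal_def sideal_UNIV mult.commute)

lemma is_ideal_UNIV: "is_ideal UNIV" by (simp add: is_ideal_def)

lemma is_ideal_zero: "is_ideal {0}" by (simp add: is_ideal_def)

lemma is_ideal_Int: "is_ideal I \<Longrightarrow> is_ideal J \<Longrightarrow> is_ideal (I \<inter> J)" by (auto simp: is_ideal_def)

lemma is_ideal_gen: "is_ideal (ideal_gen B)"
  by (auto simp: is_ideal_def ideal_gen_def)

lemma ideal_gen_superset: "B \<subseteq> ideal_gen B" by (auto simp: ideal_gen_def)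

lemma ideal_gen_least: "is_ideal I \<Longrightarrow> B \<subseteq> I \<Longrightarrow> ideal_gen B \<subseteq> I" by (auto simp: ideal_gen_def)

lemma is_ideal_prod: "is_ideal (ideal_prod I J)" by (simp add: ideal_prod_def is_ideal_gen)

lemma ideal_prodI: "x \<in> I \<Longrightarrow> y \<in> J \<Longrightarrow> x * y \<in> ideal_prod I J"
  using ideal_gen_superset[of "{x * y | x y. x \<in> I \<and> y \<in> J}"] by (auto simp: ideal_prod_def)

lemma ideal_prod_least:
  assumes "is_ideal K" "\<And>x y. x \<in> I \<Longrightarrow> y \<in> J \<Longrightarrow> x * y \<in> K"
  shows "ideal_prod I J \<subseteq> K"
  unfolding ideal_prod_def using assms by (intro ideal_gen_least) auto

definition isum :: "'a::comm_ring_1 set \<Rightarrow> 'a set \<Rightarrow> 'a set" where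
  "isum I J = {a + b | a b. a \<in> I \<and> b \<in> J}"

definition xmul :: "'a::comm_ring_1 \<Rightarrow> 'a set \<Rightarrow> 'a set" where
  "xmul x I = {x * a | a. a \<in> I}"

lemma isumI: "a \<in> I \<Longrightarrow> b \<in> J \<Longrightarrow> a + b \<in> isum I J" by (auto simp: isum_def)

lemma isumE: "c \<in> isum I J \<Longrightarrow> (\<And>a b. a \<in> I \<Longrightarrow> b \<in> J \<Longrightarrow> c = a + b \<Longrightarrow> thesis) \<Longrightarrow> thesis"
  by (auto simp: isum_def)

lemma is_ideal_isum:
  assumes "is_ideal I" "is_ideal J"
  shows "is_ideal (isum I J)"
  unfolding is_ideal_def
proof (intro conjI ballI allI impI)
  show "0 \<in> isum I J" using isumI[of 0 I 0 J] is_idealD[OF assms(1)] is_idealD[OF assms(2)] by simp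
  fix x y assume "x \<in> isum I J" "y \<in> isum I J"
  then obtain a b c d where 1: "a \<in> I" "b \<in> J" "c \<in> I" "d \<in> J" "x = a + b" "y = c + d" by (auto simp: isum_def)
  have "(a + c) + (b + d) \<in> isum I J" using 1 is_idealD[OF assms(1)] is_idealD[OF assms(2)] by (intro isumI) auto
  then show "x + y \<in> isum I J" using 1 by (simp add: algebra_simps)
next
  fix e x assume "x \<in> isum I J"
  then obtain a b where 1: "a \<in> I" "b \<in> J" "x = a + b" by (auto simp: isum_def)
  have "e * a + e * b \<in> isum I J" using 1 is_idealD[OF assms(1)] is_idealD[OF assms(2)] by (intro isumI) auto
  then show "e * x \<in> isum I J" using 1 by (simp add: algebra_simps)
qed

lemma is_ideal_xmul:
  assumes "is_ideal I"
  shows "is_ideal (xmul x I)"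
  unfolding is_ideal_def xmul_def
proof (intro conjI ballI allI impI)
  show "0 \<in> {x * a |a. a \<in> I}" using is_idealD[OF assms] by (intro CollectI exI[of _ 0]) simp
  fix y z assume "y \<in> {x * a |a. a \<in> I}" "z \<in> {x * a |a. a \<in> I}"
  then obtain a b where "a \<in> I" "b \<in> I" "y = x * a" "z = x * b" by auto
  then show "y + z \<in> {x * a |a. a \<in> I}" using is_idealD[OF assms]
    by (intro CollectI exI[of _ "a + b"]) (simp add: algebra_simps)
next
  fix e y assume "y \<in> {x * a |a. a \<in> I}"
  then obtain a where "a \<in> I" "y = x * a" by auto
  then show "e * y \<in> {x * a |a. a \<in> I}" using is_idealD[OF assms]
    by (intro CollectI exI[of _ "e * a"]) (simp add: algebra_simps)
qed

lemma isum_superset: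
  assumes "is_ideal I" "is_ideal J"
  shows "I \<subseteq> isum I J" "J \<subseteq> isum I J"
proof -
  show "I \<subseteq> isum I J" using isumI[of _ I 0 J] is_idealD(1)[OF assms(2)] by force
  show "J \<subseteq> isum I J" using isumI[of 0 I _ J] is_idealD(1)[OF assms(1)] by force
qed

lemma isum_least: "is_ideal K \<Longrightarrow> I \<subseteq> K \<Longrightarrow> J \<subseteq> K \<Longrightarrow> isum I J \<subseteq> K"
  by (auto simp: isum_def is_ideal_def)

lemma isum_mono: "I \<subseteq> I' \<Longrightarrow> J \<subseteq> J' \<Longrightarrow> isum I J \<subseteq> isum I' J'"
  by (auto simp: isum_def)

lemma xmul_mono: "I \<subseteq> J \<Longrightarrow> xmul x I \<subseteq> xmul x J" by (auto simp: xmul_def)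

lemma ideal_eq_UNIV: "is_ideal I \<Longrightarrow> 1 \<in> I \<Longrightarrow> I = UNIV"
  unfolding is_ideal_def by (metis UNIV_eq_I mult.right_neutral)

lemma ideal_gen_insert: "ideal_gen (insert x B) = isum (ideal_gen B) (xmul x UNIV)"
proof
  have x: "x \<in> xmul x UNIV" unfolding xmul_def by (intro CollectI exI[of _ 1]) simp
  note i = is_ideal_gen[of B] is_ideal_xmul[OF is_ideal_UNIV, of x]
  show "ideal_gen (insert x B) \<subseteq> isum (ideal_gen B) (xmul x UNIV)"
    using x isum_superset[OF i] ideal_gen_superset[of B] by (intro ideal_gen_least is_ideal_isum i) auto
  have "x \<in> ideal_gen (insert x B)" using ideal_gen_superset by blast
  then have "xmul x UNIV \<subseteq> ideal_gen (insert x B)"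
    using is_idealD[OF is_ideal_gen[of "insert x B"]] by (auto simp: xmul_def)
  moreover have "ideal_gen B \<subseteq> ideal_gen (insert x B)"
    using ideal_gen_superset[of "insert x B"] by (intro ideal_gen_least is_ideal_gen) auto
  ultimately show "isum (ideal_gen B) (xmul x UNIV) \<subseteq> ideal_gen (insert x B)"
    by (intro isum_least is_ideal_gen)
qed

lemma ideal_gen_empty: "ideal_gen {} = {0}"
  using ideal_gen_least[OF is_ideal_zero, of "{}"] is_idealD(1)[OF is_ideal_gen[of "{}"]] by auto

lemma noeth_UNIV:
  assumes "noetherian_ring TYPE('a::comm_ring_1)"
  shows "noeth_subring (UNIV :: 'a set)"
proof (rule noeth_subringI[OF subring_UNIV])
  fix T :: "nat \<Rightarrow> 'a set"
  assume T: "\<And>n. sideal UNIV (T n)" and mono: "\<And>n. T n \<subseteq> T (Suc n)"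
  note Ti = T[unfolded sideal_UNIV]
  have mono': "i \<le> j \<Longrightarrow> T i \<subseteq> T j" for i j using lift_Suc_mono_le[of T, OF mono] .
  have "is_ideal (\<Union>n. T n)" unfolding is_ideal_def
  proof (intro conjI ballI allI impI)
    show "0 \<in> (\<Union>n. T n)" using is_idealD(1)[OF Ti] by auto
    fix x y assume "x \<in> (\<Union>n. T n)" "y \<in> (\<Union>n. T n)"
    then obtain i j where "x \<in> T i" "y \<in> T j" by auto
    then have "x \<in> T (max i j)" "y \<in> T (max i j)" using mono'[of i "max i j"] mono'[of j "max i j"] by auto
    then show "x + y \<in> (\<Union>n. T n)" using is_idealD(2)[OF Ti] by blast
  next
    fix a x assume "x \<in> (\<Union>n. T n)"
    then show "a * x \<in> (\<Union>n. T n)" using is_idealD(4)[OF Ti] by blast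
  qed
  then obtain B where B: "finite B" "(\<Union>n. T n) = ideal_gen B" using assms by (auto simp: noetherian_ring_def)
  have "B \<subseteq> (\<Union>n. T n)" using B ideal_gen_superset by auto
  with B(1) have "\<exists>n. B \<subseteq> T n"
  proof (induction B rule: finite_induct)
    case (insert x B)
    then obtain i j where "x \<in> T i" "B \<subseteq> T j" by auto
    then have "insert x B \<subseteq> T (max i j)" using mono'[of i "max i j"] mono'[of j "max i j"] by auto
    then show ?case by blast
  qed auto
  then obtain n where "B \<subseteq> T n" by blast
  then have "(\<Union>n. T n) \<subseteq> T n" using B ideal_gen_least[OF Ti] by auto
  then show "\<exists>n. T (Suc n) = T n" using mono by blast
qed

section \<open>Length\<close>

lemma chain_refl: "is_ideal I \<Longrightarrow> has_ideal_chain I I 0"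
  unfolding has_ideal_chain_def by (intro exI[of _ "\<lambda>_. I"]) auto

lemma chain_snoc:
  assumes "has_ideal_chain I J k" "is_ideal K" "J \<subset> K"
  shows "has_ideal_chain I K (Suc k)"
proof -
  obtain C where C: "C 0 = I" "C k = J" "\<forall>i\<le>k. is_ideal (C i)" "\<forall>i<k. C i \<subset> C (Suc i)"
    using assms(1) by (auto simp: has_ideal_chain_def)
  show ?thesis unfolding has_ideal_chain_def
    using C assms by (intro exI[of _ "\<lambda>i. if i \<le> k then C i else K"]) (auto simp: le_Suc_eq less_Suc_eq)
qed

lemma chain_SucE:
  assumes "has_ideal_chain I K (Suc k)"
  obtains J where "has_ideal_chain I J k" "is_ideal J" "J \<subset> K" "is_ideal K"
proof -
  obtain C where C: "C 0 = I" "C (Suc k) = K" "\<forall>i\<le>Suc k. is_ideal (C i)" "\<forall>i<Suc k. C i \<subset> C (Suc i)"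
    using assms by (auto simp: has_ideal_chain_def)
  have "has_ideal_chain I (C k) k" unfolding has_ideal_chain_def using C by (intro exI[of _ C]) auto
  then show ?thesis using that C by auto
qed

lemma chain_0: "has_ideal_chain I J 0 \<Longrightarrow> I = J \<and> is_ideal I"
  by (auto simp: has_ideal_chain_def)

lemma chain_subset: "has_ideal_chain I J k \<Longrightarrow> I \<subseteq> J \<and> is_ideal I \<and> is_ideal J"
proof (induction k arbitrary: J)
  case 0
  then show ?case using chain_0 by blast
next
  case (Suc k)
  then show ?case by (elim chain_SucE) blast
qed

lemma chain_append:
  "has_ideal_chain J K b \<Longrightarrow> has_ideal_chain I J a \<Longrightarrow> has_ideal_chain I K (a + b)"
proof (induction b arbitrary: K)
  case 0
  then show ?case using chain_0 by fastforce
next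
  case (Suc b)
  then show ?case by (elim chain_SucE) (auto intro: chain_snoc)
qed

lemma chain_map:
  assumes "has_ideal_chain I J k" "J \<subseteq> J'"
    and "\<And>L. is_ideal L \<Longrightarrow> I \<subseteq> L \<Longrightarrow> L \<subseteq> J' \<Longrightarrow> is_ideal (f L)"
    and "\<And>L L'. is_ideal L \<Longrightarrow> is_ideal L' \<Longrightarrow> I \<subseteq> L \<Longrightarrow> L \<subset> L' \<Longrightarrow> L' \<subseteq> J' \<Longrightarrow> f L \<subset> f L'"
  shows "has_ideal_chain (f I) (f J) k"
  using assms(1,2)
proof (induction k arbitrary: J)
  case 0
  then show ?case using chain_0 chain_refl assms(3) by blast
next
  case (Suc k)
  from Suc.prems(1) show ?case
  proof (rule chain_SucE)
    fix L assume L: "has_ideal_chain I L k" "is_ideal L" "L \<subset> J" "is_ideal J"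
    have "I \<subseteq> L" using chain_subset[OF L(1)] by blast
    then show ?thesis using Suc.IH[OF L(1)] L Suc.prems assms(3)[of J] assms(4)[of L J] by (intro chain_snoc) auto
  qed
qed

lemma chain_weak_snoc:
  assumes "has_ideal_chain I J k" "is_ideal K" "J \<subseteq> K"
  shows "has_ideal_chain I K (if J = K then k else Suc k)"
  using assms chain_snoc[of I J k K] by auto

text \<open>The modular law: (J + L) \<inter> L' = L + (J \<inter> L') = L.\<close>

lemma isum_strict:
  assumes J: "is_ideal J" and L: "is_ideal L" "is_ideal L'" "L \<subset> L'" "J \<inter> L' \<subseteq> L"
  shows "isum J L \<subset> isum J L'"
proof -
  obtain x where x: "x \<in> L'" "x \<notin> L" using L by auto
  have "x \<notin> isum J L"
  proof
    assume "x \<in> isum J L"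
    then obtain a b where ab: "a \<in> J" "b \<in> L" "x = a + b" by (rule isumE)
    then have "a = x - b" by simp
    then have "a \<in> L'" using x ab L is_idealD(3)[OF L(2)] by blast
    then have "a \<in> L" using L ab by blast
    then show False using x ab is_idealD(2)[OF L(1)] by blast
  qed
  moreover have "x \<in> isum J L'" using x isum_superset[OF J L(2)] by blast
  ultimately show ?thesis using isum_mono[of J J L L'] L by blast
qed

text \<open>Trace the chain on J by intersection and above J by sums, as in the Schreier refinement.
  The induction removes the last link K' < K, splits the rest at J \<inter> K', and moves its upper
  half to the interval from J to J + K'. This gives additivity of length.\<close>

lemma chain_split:
  assumes "has_ideal_chain I K k" "is_ideal J" "I \<subseteq> J" "J \<subseteq> K"
  shows "\<exists>a b. has_ideal_chain I J a \<and> has_ideal_chain J K b \<and> k \<le> a + b"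
  using assms
proof (induction k arbitrary: K J)
  case 0
  then show ?case using chain_0 chain_refl by (metis le0 subset_antisym)
next
  case (Suc k)
  obtain K' where K': "has_ideal_chain I K' k" "is_ideal K'" "K' \<subset> K" "is_ideal K"
    using Suc.prems(1) by (rule chain_SucE)
  have "I \<subseteq> K'" using chain_subset[OF K'(1)] by blast
  then obtain a b where ab: "has_ideal_chain I (J \<inter> K') a" "has_ideal_chain (J \<inter> K') K' b" "k \<le> a + b"
    using Suc.IH[OF K'(1), of "J \<inter> K'"] Suc.prems K' is_ideal_Int by blast
  have 1: "has_ideal_chain I J (if J \<inter> K' = J then a else Suc a)"
    using chain_weak_snoc[OF ab(1) Suc.prems(2)] by auto
  have "has_ideal_chain (isum J (J \<inter> K')) (isum J K') b"
  proof (rule chain_map[OF ab(2), of K'])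
    fix L L' assume L: "is_ideal L" "is_ideal L'" "J \<inter> K' \<subseteq> L" "L \<subset> L'" "L' \<subseteq> K'"
    show "isum J L \<subset> isum J L'" by (rule isum_strict[OF Suc.prems(2) L(1,2,4)]) (use L in auto)
  qed (auto intro: is_ideal_isum[OF Suc.prems(2)])
  moreover have "isum J (J \<inter> K') = J"
    using isum_superset[OF Suc.prems(2) is_ideal_Int[OF Suc.prems(2) K'(2)]] isum_least[OF Suc.prems(2), of J "J \<inter> K'"] by auto
  ultimately have "has_ideal_chain J (isum J K') b" by simp
  from chain_weak_snoc[OF this K'(4)]
  have 2: "has_ideal_chain J K (if isum J K' = K then b else Suc b)"
    using isum_least[OF K'(4), of J K'] Suc.prems K' by auto
  \<comment> \<open>If neither half grew, J would lie in K' and K = J + K' = K', against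
    strictness.\<close>
  have "Suc k \<le> (if J \<inter> K' = J then a else Suc a) + (if isum J K' = K then b else Suc b)"
  proof (cases "J \<inter> K' = J \<and> isum J K' = K")
    case True
    then have "isum J K' \<subseteq> K'" by (intro isum_least K') auto
    then show ?thesis using True K' by auto
  qed (use ab in auto)
  then show ?case using 1 2 by blast
qed

text \<open>\<open>GREATEST\<close> says nothing when chain lengths are unbounded, so length
  computations carry this guard.\<close>

definition finlen :: "'a::comm_ring_1 set \<Rightarrow> 'a set \<Rightarrow> bool" where
  "finlen I J \<longleftrightarrow> is_ideal I \<and> is_ideal J \<and> I \<subseteq> J \<and> (\<exists>b. \<forall>k. has_ideal_chain I J k \<longrightarrow> k \<le> b)"

lemma chain_exists:
  assumes "is_ideal I" "is_ideal J" "I \<subseteq> J"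
  shows "\<exists>k. has_ideal_chain I J k"
  using chain_weak_snoc[OF chain_refl[OF assms(1)] assms(2,3)] by blast

lemma finlen_ell:
  assumes "finlen I J"
  shows "has_ideal_chain I J (ell I J)" "\<And>k. has_ideal_chain I J k \<Longrightarrow> k \<le> ell I J"
proof -
  obtain b where b: "\<And>k. has_ideal_chain I J k \<Longrightarrow> k \<le> b" using assms by (auto simp: finlen_def)
  obtain k where k: "has_ideal_chain I J k" using chain_exists[of I J] assms unfolding finlen_def by blast
  show "has_ideal_chain I J (ell I J)" unfolding ell_def by (rule GreatestI_nat[of _ k b]) (use k b in auto)
  show "\<And>k. has_ideal_chain I J k \<Longrightarrow> k \<le> ell I J" unfolding ell_def by (rule Greatest_le_nat[of _ _ b]) (use b in auto)
qed

lemma ell_add: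
  assumes "finlen I J" "finlen J K"
  shows "finlen I K" "ell I K = ell I J + ell J K"
proof -
  have le: "k \<le> ell I J + ell J K" if h: "has_ideal_chain I K k" for k
  proof -
    obtain a b where "has_ideal_chain I J a" "has_ideal_chain J K b" "k \<le> a + b"
      using chain_split[OF h, of J] assms unfolding finlen_def by blast
    then show ?thesis using finlen_ell(2)[OF assms(1), of a] finlen_ell(2)[OF assms(2), of b] by linarith
  qed
  then show f: "finlen I K" using assms unfolding finlen_def by blast
  have "ell I J + ell J K \<le> ell I K"
    using chain_append[OF finlen_ell(1)[OF assms(2)] finlen_ell(1)[OF assms(1)]] finlen_ell(2)[OF f] by blast
  then show "ell I K = ell I J + ell J K" using le finlen_ell(1)[OF f] by force
qed

lemma finlen_sub:
  assumes "finlen I K" "is_ideal J" "I \<subseteq> J" "J \<subseteq> K"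
  shows "finlen I J" "finlen J K"
proof -
  have id: "is_ideal I" "is_ideal K" using assms by (auto simp: finlen_def)
  obtain a where a: "has_ideal_chain I J a" using chain_exists assms id by blast
  obtain c where c: "has_ideal_chain J K c" using chain_exists assms id by blast
  have "k \<le> ell I K" if "has_ideal_chain I J k" for k
    using finlen_ell(2)[OF assms(1) chain_append[OF c that]] by auto
  then show "finlen I J" using assms id unfolding finlen_def by blast
  have "k \<le> ell I K" if "has_ideal_chain J K k" for k
    using finlen_ell(2)[OF assms(1) chain_append[OF that a]] by auto
  then show "finlen J K" using assms id unfolding finlen_def by blast
qed

lemma ell_split:
  assumes "finlen I K" "is_ideal J" "I \<subseteq> J" "J \<subseteq> K"
  shows "ell I K = ell I J + ell J K"
  using ell_add(2)[OF finlen_sub[OF assms]] .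

lemma ell_0:
  assumes "finlen I J"
  shows "ell I J = 0 \<longleftrightarrow> I = J"
proof
  show "ell I J = 0 \<Longrightarrow> I = J" using finlen_ell(1)[OF assms] chain_0 by metis
  assume eq: "I = J"
  have "ell I I = ell I I + ell I I" using ell_split[of I I I] assms eq by (auto simp: finlen_def)
  then show "ell I J = 0" using eq by simp
qed

text \<open>Only strict chains between the end points have to be carried over in each direction, so
  f and g need not be mutually inverse.\<close>

lemma chain_cong_iso:
  assumes "\<And>L. is_ideal L \<Longrightarrow> I \<subseteq> L \<Longrightarrow> L \<subseteq> J \<Longrightarrow> is_ideal (f L)"
    and "\<And>L L'. is_ideal L \<Longrightarrow> is_ideal L' \<Longrightarrow> I \<subseteq> L \<Longrightarrow> L \<subset> L' \<Longrightarrow> L' \<subseteq> J \<Longrightarrow> f L \<subset> f L'"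
    and "\<And>L. is_ideal L \<Longrightarrow> I' \<subseteq> L \<Longrightarrow> L \<subseteq> J' \<Longrightarrow> is_ideal (g L)"
    and "\<And>L L'. is_ideal L \<Longrightarrow> is_ideal L' \<Longrightarrow> I' \<subseteq> L \<Longrightarrow> L \<subset> L' \<Longrightarrow> L' \<subseteq> J' \<Longrightarrow> g L \<subset> g L'"
    and "f I = I'" "f J = J'" "g I' = I" "g J' = J"
  shows "has_ideal_chain I J = has_ideal_chain I' J'"
proof
  fix k
  show "has_ideal_chain I J k = has_ideal_chain I' J' k"
    using chain_map[of I J k J f] chain_map[of I' J' k J' g] assms by auto
qed

lemma chain_second_iso:
  assumes I: "is_ideal I" and J: "is_ideal J"
  shows "has_ideal_chain (I \<inter> J) J = has_ideal_chain I (isum I J)"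
proof (rule chain_cong_iso[where f = "isum I" and g = "\<lambda>L. L \<inter> J"])
  show "is_ideal (isum I L)" if "is_ideal L" for L by (rule is_ideal_isum[OF I that])
  show "is_ideal (L \<inter> J)" if "is_ideal L" for L by (rule is_ideal_Int[OF that J])
  show "isum I L \<subset> isum I L'" if "is_ideal L" "is_ideal L'" "I \<inter> J \<subseteq> L" "L \<subset> L'" "L' \<subseteq> J" for L L'
    by (rule isum_strict[OF I that(1,2,4)]) (use that in auto)
  show "L \<inter> J \<subset> L' \<inter> J" if L: "is_ideal L" "is_ideal L'" "I \<subseteq> L" "L \<subset> L'" "L' \<subseteq> isum I J" for L L'
  proof -
    obtain x where x: "x \<in> L'" "x \<notin> L" using L by auto
    then have "x \<in> isum I J" using L by auto
    then obtain a b where ab: "a \<in> I" "b \<in> J" "x = a + b" by (rule isumE)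
    then have "b = x - a" by simp
    then have "b \<in> L'" using x ab L is_idealD(3)[OF L(2)] by blast
    moreover have "b \<notin> L" using x ab L is_idealD(2)[OF L(1)] by blast
    ultimately show ?thesis using L ab by blast
  qed
  show "isum I (I \<inter> J) = I"
    using isum_superset[OF I is_ideal_Int[OF I J]] isum_least[OF I, of I "I \<inter> J"] by auto
  show "isum I J \<inter> J = J" using isum_superset[OF I J] by auto
qed auto

text \<open>Multiplication by x maps J onto (I' + xJ)/I', with kernel the elements that x sends into
  I'. The length formulas for socle elements and superficial elements all come from this.\<close>

lemma chain_mult_iso:
  assumes J: "is_ideal J" and I': "is_ideal I'"
  shows "has_ideal_chain {a \<in> J. x * a \<in> I'} J = has_ideal_chain I' (isum I' (xmul x J))"
proof (rule chain_cong_iso[where f = "\<lambda>L. isum I' (xmul x L)" and g = "\<lambda>L. {a \<in> J. x * a \<in> L}"])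
  have K: "is_ideal {a \<in> J. x * a \<in> L}" if "is_ideal L" for L
    using is_idealD[OF J] is_idealD[OF that] by (auto simp: is_ideal_def distrib_left mult.left_commute)
  show "is_ideal (isum I' (xmul x L))" if "is_ideal L" for L by (intro is_ideal_isum is_ideal_xmul I' that)
  show "is_ideal {a \<in> J. x * a \<in> L}" if "is_ideal L" for L by (rule K[OF that])
  show "isum I' (xmul x L) \<subset> isum I' (xmul x L')"
    if L: "is_ideal L" "is_ideal L'" "{a \<in> J. x * a \<in> I'} \<subseteq> L" "L \<subset> L'" "L' \<subseteq> J" for L L'
  proof -
    obtain y where y: "y \<in> L'" "y \<notin> L" using L by auto
    have "x * y \<notin> isum I' (xmul x L)"
    proof
      assume "x * y \<in> isum I' (xmul x L)"
      then obtain a b where ab: "a \<in> I'" "b \<in> L" "x * y = a + x * b" by (auto simp: isum_def xmul_def)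
      then have "x * (y - b) \<in> I'" by (simp add: algebra_simps)
      moreover have "y - b \<in> J" using y ab L is_idealD(3)[OF J] by blast
      ultimately have "y - b \<in> L" using L by blast
      then have "y - b + b \<in> L" using ab is_idealD(2)[OF L(1)] by blast
      then show False using y by simp
    qed
    moreover have "x * y \<in> isum I' (xmul x L')"
      using y isum_superset(2)[OF I' is_ideal_xmul[OF L(2), of x]] by (auto simp: xmul_def)
    ultimately show ?thesis using isum_mono[of I' I' "xmul x L" "xmul x L'"] xmul_mono[of L L' x] L by blast
  qed
  show "{a \<in> J. x * a \<in> L} \<subset> {a \<in> J. x * a \<in> L'}"
    if L: "is_ideal L" "is_ideal L'" "I' \<subseteq> L" "L \<subset> L'" "L' \<subseteq> isum I' (xmul x J)" for L L'
  proof -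
    obtain y where y: "y \<in> L'" "y \<notin> L" using L by auto
    then have "y \<in> isum I' (xmul x J)" using L by auto
    then obtain a b where ab: "a \<in> I'" "b \<in> J" "y = a + x * b" by (auto simp: isum_def xmul_def)
    then have "x * b = y - a" by simp
    then have "x * b \<in> L'" using y ab L is_idealD(3)[OF L(2)] by (metis subsetD psubsetE)
    moreover have "x * b \<notin> L" using y ab L is_idealD(2)[OF L(1)] by blast
    ultimately show ?thesis using L ab by blast
  qed
  show "isum I' (xmul x {a \<in> J. x * a \<in> I'}) = I'"
    using isum_superset(1)[OF I' is_ideal_xmul[OF K[OF I'], of x]] isum_least[OF I', of I' "xmul x {a \<in> J. x * a \<in> I'}"]
    by (auto simp: xmul_def)
  show "{a \<in> J. x * a \<in> isum I' (xmul x J)} = J"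
    using isum_superset(2)[OF I' is_ideal_xmul[OF J, of x]] by (auto simp: xmul_def)
qed auto

lemma ell_cong: "has_ideal_chain I J = has_ideal_chain I' J' \<Longrightarrow> ell I J = ell I' J'"
  by (simp add: ell_def)

lemma finlen_cong:
  assumes "has_ideal_chain I J = has_ideal_chain I' J'" "finlen I' J'"
  shows "finlen I J"
proof -
  have "has_ideal_chain I J (ell I' J')" using finlen_ell(1)[OF assms(2)] assms(1) by simp
  then show ?thesis using chain_subset assms unfolding finlen_def by metis
qed

section \<open>Hilbert coefficients\<close>

text \<open>The coefficients of 1/(1-t)^(d+1).\<close>

definition binom_fps :: "nat \<Rightarrow> int fps" where
  "binom_fps d = Abs_fps (\<lambda>n. int ((n + d) choose d))"

lemma fps_one_minus_X_mult_nth: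
  fixes f :: "'c::comm_ring_1 fps"
  shows "((1 - fps_X) * f) $ n = (if n = 0 then f $ 0 else f $ n - f $ (n - 1))"
  by (auto simp: left_diff_distrib)

lemma one_minus_X_mult_binom_fps:
  "(1 - fps_X) * binom_fps (Suc d) = binom_fps d" "(1 - fps_X) * binom_fps 0 = 1"
proof -
  show "(1 - fps_X) * binom_fps (Suc d) = binom_fps d"
  proof (rule fps_ext)
    fix n show "((1 - fps_X) * binom_fps (Suc d)) $ n = binom_fps d $ n"
      by (cases n) (simp_all add: fps_one_minus_X_mult_nth binom_fps_def)
  qed
  show "(1 - fps_X) * binom_fps 0 = 1"
    by (rule fps_ext) (simp add: fps_one_minus_X_mult_nth binom_fps_def)
qed

lemma one_minus_X_power_mult_binom_fps:
  "(1 - fps_X) ^ d * binom_fps d = binom_fps 0"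
  by (induction d) (simp_all add: mult.assoc power_Suc2 one_minus_X_mult_binom_fps del: power_Suc)

lemma one_minus_X_neq_0: "(1 - fps_X :: 'c::comm_ring_1 fps) \<noteq> 0"
proof
  assume "(1 - fps_X :: 'c fps) = 0"
  then have "(1 - fps_X :: 'c fps) $ 0 = 0" by simp
  then show False by simp
qed

text \<open>Here L = V/(1-t)^(d+1) with V a polynomial. Subtracting V(1)/(1-t)^(d+1) leaves a
  numerator that vanishes at 1, hence is divisible by 1-t, and d drops. The leading coefficient is
  therefore V(1).\<close>

lemma hilbert_expansion:
  fixes L V :: "int fps"
  assumes "(1 - fps_X) ^ Suc d * L = V" "\<And>n. n \<ge> N \<Longrightarrow> V $ n = 0"
  shows "\<exists>e. e 0 = (\<Sum>n<N. V $ n) \<and>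
     (\<exists>N'. \<forall>n\<ge>N'. L $ n = (\<Sum>i\<le>d. (-1) ^ i * e i * int ((n + d - i) choose (d - i))))"
  using assms
proof (induction d arbitrary: L V)
  case 0
  have V0: "V = (1 - fps_X) * L" using 0(1) by simp
  note V1 = 0(2)
  have L: "L $ n = (\<Sum>k\<le>n. V $ k)" for n
  proof (induction n)
    case 0
    then show ?case by (simp add: V0 fps_one_minus_X_mult_nth del: fps_mult_nth_0)
  next
    case (Suc n)
    then show ?case by (simp add: V0 fps_one_minus_X_mult_nth del: fps_mult_nth_0)
  qed
  have "L $ n = (\<Sum>n<N. V $ n)" if "n \<ge> N" for n
    unfolding L using that V1 by (intro sum.mono_neutral_right) auto
  then show ?case by (intro exI[of _ "\<lambda>_. \<Sum>n<N. V $ n"] conjI exI[of _ N]) auto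
next
  case (Suc d)
  define c where "c = (\<Sum>n<N. V $ n)"
  \<comment> \<open>The quotient (V - c)/(1-t): its coefficients are partial sums of V minus c,
    which vanish once all of V has been summed.\<close>
  define V1 where "V1 = Abs_fps (\<lambda>n. (\<Sum>k\<le>n. V $ k) - c)"
  have V1: "(1 - fps_X) * V1 = V - fps_const c"
  proof (rule fps_ext)
    fix n show "((1 - fps_X) * V1) $ n = (V - fps_const c) $ n"
      by (cases n) (simp_all add: fps_one_minus_X_mult_nth V1_def)
  qed
  have V1z: "V1 $ n = 0" if "n \<ge> N" for n
  proof -
    have "(\<Sum>k\<le>n. V $ k) = c" unfolding c_def using that Suc.prems(2) by (intro sum.mono_neutral_right) auto
    then show ?thesis by (simp add: V1_def)
  qed
  define L' where "L' = L - fps_const c * binom_fps (Suc d)"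
  have "(1 - fps_X) * ((1 - fps_X) ^ Suc d * L') = (1 - fps_X) ^ Suc (Suc d) * L
      - fps_const c * ((1 - fps_X) * ((1 - fps_X) ^ Suc d * binom_fps (Suc d)))"
    by (simp add: L'_def algebra_simps)
  also have "\<dots> = V - fps_const c"
    unfolding Suc.prems(1) one_minus_X_power_mult_binom_fps one_minus_X_mult_binom_fps by simp
  also have "\<dots> = (1 - fps_X) * V1" using V1 by simp
  finally have "(1 - fps_X) ^ Suc d * L' = V1" using one_minus_X_neq_0 mult_left_cancel by blast
  from Suc.IH[OF this V1z] obtain e' N' where e': "\<And>n. n \<ge> N' \<Longrightarrow>
     L' $ n = (\<Sum>i\<le>d. (-1) ^ i * e' i * int ((n + d - i) choose (d - i)))" by auto
  have "L $ n = (\<Sum>i\<le>Suc d. (-1) ^ i * (case i of 0 \<Rightarrow> c | Suc j \<Rightarrow> - e' j) * int ((n + Suc d - i) choose (Suc d - i)))"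
    if "n \<ge> N'" for n
  proof -
    have "L $ n = c * binom_fps (Suc d) $ n + L' $ n" by (simp add: L'_def)
    then show ?thesis unfolding sum.atMost_Suc_shift e'[OF that] by (simp add: binom_fps_def)
  qed
  then show ?case by (intro exI[of _ "\<lambda>i. case i of 0 \<Rightarrow> c | Suc j \<Rightarrow> - e' j"]) (auto simp: c_def)
qed

text \<open>By Pascal's rule, the difference of consecutive values is the same expression for d-1,
  with the last coefficient gone. That coefficient is recovered from a single value at the
  end.\<close>

lemma hilbert_expansion_unique:
  fixes a :: "nat \<Rightarrow> int"
  assumes "\<And>n. n \<ge> N \<Longrightarrow> (\<Sum>i\<le>d. (-1) ^ i * a i * int ((n + d - i) choose (d - i))) = 0" "i \<le> d"
  shows "a i = 0"
  using assms
proof (induction d arbitrary: i N)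
  case 0
  then show ?case by fastforce
next
  case (Suc d)
  have "(\<Sum>i\<le>d. (-1) ^ i * a i * int ((n + d - i) choose (d - i))) = 0" if n: "n \<ge> Suc N" for n
  proof -
    have "(\<Sum>i\<le>d. (-1) ^ i * a i * int ((n + d - i) choose (d - i)))
       = (\<Sum>i\<le>d. (-1) ^ i * a i * int ((n + Suc d - i) choose (Suc d - i))
             - (-1) ^ i * a i * int ((n - 1 + Suc d - i) choose (Suc d - i)))"
    proof (rule sum.cong)
      fix i assume i: "i \<in> {..d}"
      have "n + Suc d - i = Suc (n + d - i)" "Suc d - i = Suc (d - i)" "n - 1 + Suc d - i = n + d - i"
        using i n by auto
      then have "int ((n + Suc d - i) choose (Suc d - i)) - int ((n - 1 + Suc d - i) choose (Suc d - i))
        = int ((n + d - i) choose (d - i))" by simp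
      then show "(-1) ^ i * a i * int ((n + d - i) choose (d - i))
        = (-1) ^ i * a i * int ((n + Suc d - i) choose (Suc d - i))
             - (-1) ^ i * a i * int ((n - 1 + Suc d - i) choose (Suc d - i))"
        by (metis right_diff_distrib)
    qed simp
    also have "\<dots> = 0"
      using Suc.prems(1)[of n] Suc.prems(1)[of "n - 1"] n unfolding sum.atMost_Suc sum_subtractf by simp
    finally show ?thesis .
  qed
  then have 1: "a i = 0" if "i \<le> d" for i using Suc.IH[of "Suc N" i] that by blast
  have "(\<Sum>i\<le>d. (-1) ^ i * a i * int ((N + Suc d - i) choose (Suc d - i))) = 0"
    using 1 by (intro sum.neutral) auto
  then have "a (Suc d) = 0" using Suc.prems(1)[of N] unfolding sum.atMost_Suc by simp
  then show ?case using 1 Suc.prems(2) le_Suc_eq by auto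
qed

lemma hilb_poly_coeffs_unique:
  assumes "hilb_poly_coeffs F d e" "hilb_poly_coeffs F d e'"
  shows "e = e'"
proof
  fix i
  obtain N where N: "\<And>n. n \<ge> N \<Longrightarrow> n \<ge> 1 \<Longrightarrow>
     int (ell (F n) UNIV) = (\<Sum>i\<le>d. (-1) ^ i * e i * int ((n + d - 1 - i) choose (d - i)))"
    using assms(1) by (auto simp: hilb_poly_coeffs_def)
  obtain N' where N': "\<And>n. n \<ge> N' \<Longrightarrow> n \<ge> 1 \<Longrightarrow>
     int (ell (F n) UNIV) = (\<Sum>i\<le>d. (-1) ^ i * e' i * int ((n + d - 1 - i) choose (d - i)))"
    using assms(2) by (auto simp: hilb_poly_coeffs_def)
  have "(\<Sum>i\<le>d. (-1) ^ i * (e i - e' i) * int ((n + d - i) choose (d - i))) = 0" if "n \<ge> N + N'" for n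
    using N[of "Suc n"] N'[of "Suc n"] that by (simp add: algebra_simps sum_subtractf)
  then have "e i - e' i = 0" if "i \<le> d"
    using hilbert_expansion_unique[of "N + N'" "\<lambda>i. e i - e' i" d i] that by blast
  then show "e i = e' i" using assms by (cases "i \<le> d") (auto simp: hilb_poly_coeffs_def)
qed

text \<open>The numerator is c/(1-t) - v(t), so c/(1-t)^(d+2) minus the length series is
  v(t)/(1-t)^(d+1), whose leading coefficient is v(1). The alternating signs of the Hilbert
  polynomial absorb the minus sign.\<close>

lemma hilb_coeff_01:
  fixes v :: "nat \<Rightarrow> int"
  assumes eq: "(1 - fps_X) ^ Suc d * Abs_fps (\<lambda>n. int (ell (F (Suc n)) UNIV)) = Abs_fps (\<lambda>n. c - v n)"
    and v: "\<And>n. n \<ge> N \<Longrightarrow> v n = 0"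
  shows "hilb_coeff F (Suc d) 0 = c" "hilb_coeff F (Suc d) 1 = (\<Sum>n<N. v n)"
proof -
  define L where "L = Abs_fps (\<lambda>n. int (ell (F (Suc n)) UNIV))"
  define L' where "L' = fps_const c * binom_fps (Suc d) - L"
  have "(1 - fps_X) ^ Suc d * L' = fps_const c * ((1 - fps_X) ^ Suc d * binom_fps (Suc d)) - (1 - fps_X) ^ Suc d * L"
    by (simp add: L'_def algebra_simps)
  also have "\<dots> = fps_const c * binom_fps 0 - Abs_fps (\<lambda>n. c - v n)"
    unfolding one_minus_X_power_mult_binom_fps L_def eq ..
  also have "\<dots> = Abs_fps v" by (rule fps_ext) (simp add: binom_fps_def)
  finally have "(1 - fps_X) ^ Suc d * L' = Abs_fps v" .
  from hilbert_expansion[OF this, of N] v obtain e' N' where e': "e' 0 = (\<Sum>n<N. v n)" "\<And>n. n \<ge> N' \<Longrightarrow>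
     L' $ n = (\<Sum>i\<le>d. (-1) ^ i * e' i * int ((n + d - i) choose (d - i)))" by auto
  \<comment> \<open>The value 0 beyond \<open>Suc d\<close> is the convention of
    \<open>hilb_poly_coeffs\<close> that makes the \<open>THE\<close> in \<open>hilb_coeff\<close>
    unique.\<close>
  define e where "e i = (if i > Suc d then 0 else case i of 0 \<Rightarrow> c | Suc j \<Rightarrow> e' j)" for i
  have "int (ell (F n) UNIV) = (\<Sum>i\<le>Suc d. (-1) ^ i * e i * int ((n + Suc d - 1 - i) choose (Suc d - i)))"
    if n: "n \<ge> Suc N'" for n
  proof -
    obtain k where k: "n = Suc k" "k \<ge> N'" using n by (cases n) auto
    have "int (ell (F n) UNIV) = L $ k" using k by (simp add: L_def)
    also have "\<dots> = c * binom_fps (Suc d) $ k - L' $ k" by (simp add: L'_def)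
    also have "\<dots> = (\<Sum>i\<le>Suc d. (-1) ^ i * e i * int ((k + Suc d - i) choose (Suc d - i)))"
      unfolding sum.atMost_Suc_shift e'(2)[OF k(2)] by (simp add: binom_fps_def e_def sum_negf[symmetric])
    finally show ?thesis using k by simp
  qed
  then have h: "hilb_poly_coeffs F (Suc d) e" unfolding hilb_poly_coeffs_def
    by (auto simp: e_def)
  then have "(THE e. hilb_poly_coeffs F (Suc d) e) = e" using hilb_poly_coeffs_unique by blast
  then show "hilb_coeff F (Suc d) 0 = c" "hilb_coeff F (Suc d) 1 = (\<Sum>n<N. v n)"
    using e' by (simp_all add: hilb_coeff_def e_def)
qed

section \<open>Local algebra\<close>

locale hilbert_setup =
  fixes m :: "'a::comm_ring_1 set" and F :: "nat \<Rightarrow> 'a set"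
  assumes loc: "noetherian_local_ring m"
    and inf_res: "infinite {{y. y - x \<in> m} | x. True}"
    and filt: "hilbert_filtration m F"
begin

lemma noeth_A: "noeth_subring (UNIV :: 'a set)"
  using loc noeth_UNIV by (auto simp: noetherian_local_ring_def)

lemma maximal_m: "maximal_ideal m" using loc by (auto simp: noetherian_local_ring_def)

lemma ideal_m: "is_ideal m" "m \<noteq> UNIV" "1 \<notin> m"
  using maximal_m ideal_eq_UNIV by (auto simp: maximal_ideal_def)

lemma noeth_max:
  assumes "P (I :: 'a set)" "\<And>I. P I \<Longrightarrow> is_ideal I"
  obtains J where "P J" "is_ideal J" "\<And>K. P K \<Longrightarrow> J \<subseteq> K \<Longrightarrow> K = J"
proof -
  have "\<exists>I\<in>{I. P I}. \<forall>J\<in>{I. P I}. I \<subseteq> J \<longrightarrow> J = I"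
    by (rule noeth_subring.noeth[OF noeth_A]) (use assms in \<open>auto simp: sideal_UNIV\<close>)
  then show ?thesis using that assms(2) by blast
qed

lemma proper_sub_m:
  assumes "is_ideal I" "I \<noteq> UNIV"
  shows "I \<subseteq> m"
proof -
  obtain J where J: "is_ideal J \<and> I \<subseteq> J \<and> J \<noteq> UNIV" "is_ideal J" "\<And>K. is_ideal K \<and> I \<subseteq> K \<and> K \<noteq> UNIV \<Longrightarrow> J \<subseteq> K \<Longrightarrow> K = J"
    by (rule noeth_max[of "\<lambda>J. is_ideal J \<and> I \<subseteq> J \<and> J \<noteq> UNIV" I]) (use assms in blast)+
  then have "maximal_ideal J" unfolding maximal_ideal_def by blast
  then have "J = m" using loc by (auto simp: noetherian_local_ring_def)
  then show ?thesis using J by auto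
qed

lemma unit_outside_m:
  assumes "a \<notin> m"
  shows "\<exists>u. u * a = 1"
proof -
  have i: "is_ideal (xmul a UNIV)" by (rule is_ideal_xmul[OF is_ideal_UNIV])
  have "a \<in> xmul a UNIV" unfolding xmul_def by (intro CollectI exI[of _ 1]) simp
  then have "xmul a UNIV = UNIV" using proper_sub_m[OF i] assms by blast
  then have "1 \<in> xmul a UNIV" by simp
  then show ?thesis by (auto simp: xmul_def mult.commute)
qed

lemma prime_m: "a * b \<in> m \<Longrightarrow> a \<in> m \<or> b \<in> m"
proof (rule ccontr)
  assume h: "a * b \<in> m" "\<not> (a \<in> m \<or> b \<in> m)"
  then obtain u v where "u * a = 1" "v * b = 1" using unit_outside_m by meson
  then have "1 = (u * v) * (a * b)" by (metis mult.assoc mult.commute mult.right_neutral)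
  then have "1 \<in> m" using h is_idealD(4)[OF ideal_m(1)] by metis
  then show False using ideal_m by simp
qed

lemma prime_ideal_m: "prime_ideal m"
  using prime_m ideal_m by (auto simp: prime_ideal_def)

lemma ex_units: "\<exists>G. infinite (G :: 'a set) \<and> (\<forall>a\<in>G. \<forall>b\<in>G. a \<noteq> b \<longrightarrow> a - b \<notin> m)"
proof -
  let ?C = "{{y. y - x \<in> m} | x. True}"
  define rep where "rep c = (SOME y. y \<in> c)" for c :: "'a set"
  have mem: "{y. y - rep c \<in> m} = c" if c: "c \<in> ?C" for c
  proof -
    obtain x where x: "c = {y. y - x \<in> m}" using c by auto
    have "x \<in> c" using x is_idealD[OF ideal_m(1)] by simp
    then have "rep c \<in> c" unfolding rep_def by (rule someI)
    then have r: "rep c - x \<in> m" using x by simp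
    have "y - rep c \<in> m \<longleftrightarrow> y - x \<in> m" for y
      using is_idealD(2)[OF ideal_m(1), of "y - rep c" "rep c - x"] is_idealD(3)[OF ideal_m(1), of "y - x" "rep c - x"] r
      by auto
    then show ?thesis using x by auto
  qed
  have inj: "inj_on rep ?C" by (intro inj_onI) (metis mem)
  have "a - b \<notin> m" if ab: "a \<in> rep ` ?C" "b \<in> rep ` ?C" "a \<noteq> b" for a b
  proof
    assume h: "a - b \<in> m"
    obtain c d where cd: "c \<in> ?C" "d \<in> ?C" "a = rep c" "b = rep d" using ab by blast
    have "y - a \<in> m \<longleftrightarrow> y - b \<in> m" for y
      using is_idealD(2)[OF ideal_m(1), of "y - a" "a - b"] is_idealD(3)[OF ideal_m(1), of "y - b" "a - b"] h
      by auto
    then have "{y. y - a \<in> m} = {y. y - b \<in> m}" by blast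
    then have "c = d" using mem[OF cd(1)] mem[OF cd(2)] cd(3,4) by metis
    then show False using ab cd by simp
  qed
  moreover have "infinite (rep ` ?C)" using inf_res finite_imageD[OF _ inj] by blast
  ultimately show ?thesis by blast
qed

definition Gam :: "'a set" where
  "Gam = (SOME G. infinite G \<and> (\<forall>a\<in>G. \<forall>b\<in>G. a \<noteq> b \<longrightarrow> a - b \<notin> m))"

lemma Gam: "infinite Gam" "a \<in> Gam \<Longrightarrow> b \<in> Gam \<Longrightarrow> a \<noteq> b \<Longrightarrow> a - b \<notin> m"
  using someI_ex[OF ex_units] unfolding Gam_def by blast+

lemma depth_subring_A: "depth_subring UNIV m Gam"
proof (intro depth_subring.intro noeth_A depth_subring_axioms.intro)
  show "sideal UNIV m" using ideal_m by (simp add: sideal_UNIV)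
  show "\<exists>u\<in>UNIV. u * (a - b) = 1" if "a \<in> Gam" "b \<in> Gam" "a \<noteq> b" for a b
    using unit_outside_m[OF Gam(2)[OF that]] by blast
qed (use Gam in auto)

sublocale A: depth_subring UNIV m Gam by (rule depth_subring_A)

lemma A_ext: "A.ext I z = isum I (xmul z UNIV)"
  by (auto simp: A.ext_def isum_def xmul_def)

lemma is_ideal_add: "is_ideal I \<Longrightarrow> is_ideal (isum I (xmul z UNIV))"
  by (intro is_ideal_isum is_ideal_xmul is_ideal_UNIV)

lemma prime_power: "prime_ideal P \<Longrightarrow> x ^ n \<in> P \<Longrightarrow> x \<in> P"
proof (induction n)
  case 0
  then show ?case using ideal_eq_UNIV by (auto simp: prime_ideal_def)
qed (auto simp: prime_ideal_def)

lemma ass_prime: "is_ideal I \<Longrightarrow> P \<in> A.ass I \<Longrightarrow> prime_ideal P"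
  by (erule A.assE[OF iffD2[OF sideal_UNIV]]) (auto simp: prime_ideal_def sideal_UNIV)

lemma prime_m_sub: "prime_ideal P \<Longrightarrow> m \<subseteq> P \<Longrightarrow> P = m"
  using maximal_m by (auto simp: prime_ideal_def maximal_ideal_def)

text \<open>The hypothesis on T encodes that D lies in W + mD without forming that ideal. Take T
  maximal between W and W + D among those not containing D. If c*a were outside T, then T + (c*a)
  would contain a, giving a = t + c*a*b; since 1 - c*b is a unit, a is in T after all. So mD lies in
  T, and \<open>h\<close> gives a contradiction.\<close>

lemma nakayama:
  assumes D: "is_ideal D" and W: "is_ideal W"
    and h: "\<And>T. is_ideal T \<Longrightarrow> W \<subseteq> T \<Longrightarrow> (\<And>c a. c \<in> m \<Longrightarrow> a \<in> D \<Longrightarrow> c * a \<in> T) \<Longrightarrow> D \<subseteq> T"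
  shows "D \<subseteq> W"
proof (rule ccontr)
  assume nW: "\<not> D \<subseteq> W"
  define P where "P T \<longleftrightarrow> is_ideal T \<and> W \<subseteq> T \<and> \<not> D \<subseteq> T \<and> T \<subseteq> isum W D" for T
  have "P W" using W nW isum_superset[OF W D] by (auto simp: P_def)
  then obtain T where T: "P T" "is_ideal T" "\<And>K. P K \<Longrightarrow> T \<subseteq> K \<Longrightarrow> K = T"
    by (rule noeth_max) (auto simp: P_def)
  have "c * a \<in> T" if c: "c \<in> m" and a: "a \<in> D" for c a
  proof (rule ccontr)
    assume ca: "c * a \<notin> T"
    define T' where "T' = isum T (xmul (c * a) UNIV)"
    have T': "is_ideal T'" "T \<subseteq> T'" unfolding T'_def
      using T is_ideal_add isum_superset[OF T(2) is_ideal_xmul[OF is_ideal_UNIV]] by auto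
    have "c * a \<in> xmul (c * a) UNIV" unfolding xmul_def by (intro CollectI exI[of _ 1]) simp
    then have "c * a \<in> T'" using isum_superset(2)[OF T(2) is_ideal_xmul[OF is_ideal_UNIV]] unfolding T'_def by blast
    then have ne: "T' \<noteq> T" using ca by blast
    have "c * a \<in> D" using a is_idealD[OF D] by blast
    then have "xmul (c * a) UNIV \<subseteq> D" using is_idealD(5)[OF D] by (auto simp: xmul_def)
    then have "T' \<subseteq> isum W D" using T(1) isum_superset[OF W D] is_ideal_isum[OF W D]
      unfolding T'_def P_def by (intro isum_least) auto
    then have "D \<subseteq> T'" using T(3)[of T'] ne T' T(1) by (auto simp: P_def)
    then obtain t b where t: "t \<in> T" "a = t + c * a * b" using a by (auto simp: T'_def isum_def xmul_def)
    have "1 - c * b \<notin> m"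
    proof
      assume h: "1 - c * b \<in> m"
      have "1 - c * b + c * b \<in> m" by (rule is_idealD(2)[OF ideal_m(1) h is_idealD(5)[OF ideal_m(1) c]])
      then show False using ideal_m by simp
    qed
    then obtain u where u: "u * (1 - c * b) = 1" using unit_outside_m by blast
    have "(1 - c * b) * a = t" using t(2) by (simp add: algebra_simps)
    then have "a = u * t" using u by (metis mult.assoc mult_1)
    then have "a \<in> T" using t is_idealD[OF T(2)] by blast
    then show False using ca is_idealD[OF T(2)] by blast
  qed
  then have "D \<subseteq> T" using h[OF T(2)] T(1) by (auto simp: P_def)
  then show False using T(1) by (auto simp: P_def)
qed

lemma F_ideal: "is_ideal (F n)" and F_0: "F 0 = UNIV" and F_Suc: "F (Suc n) \<subseteq> F n"
  and F_mult: "a \<in> F i \<Longrightarrow> b \<in> F j \<Longrightarrow> a * b \<in> F (i + j)"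
  and F_primary: "m_primary m (F 1)"
  using filt ideal_prodI unfolding hilbert_filtration_def by blast+

lemma F_mono: "i \<le> j \<Longrightarrow> F j \<subseteq> F i"
  using lift_Suc_antimono_le[of F, OF F_Suc] .

lemma F1_sub_m: "F 1 \<subseteq> m"
  using F_primary unfolding m_primary_def by (metis power_one_right subsetI)

lemma m_power: "c \<in> m \<Longrightarrow> \<exists>n. c ^ n \<in> F 1"
  using F_primary unfolding m_primary_def by blast

definition N0 :: nat where "N0 = (SOME N. \<forall>n\<ge>N. F (Suc n) = ideal_prod (F 1) (F n))"

lemma F_stable: "n \<ge> N0 \<Longrightarrow> F (Suc n) = ideal_prod (F 1) (F n)"
proof -
  have "\<exists>N. \<forall>n\<ge>N. F (Suc n) = ideal_prod (F 1) (F n)" using filt by (simp add: hilbert_filtration_def)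
  from someI_ex[OF this] show "n \<ge> N0 \<Longrightarrow> F (Suc n) = ideal_prod (F 1) (F n)" unfolding N0_def by blast
qed

lemma F_power: "a \<in> F 1 \<Longrightarrow> a ^ n \<in> F n"
proof (induction n)
  case (Suc n)
  then show ?case using F_mult[of a 1 "a ^ n" n] by simp
qed (simp add: F_0)

text \<open>A/I has dimension at most 0. The unit ideal qualifies vacuously, so the property passes
  to every larger ideal.\<close>

definition zero_dim :: "'a set \<Rightarrow> bool" where
  "zero_dim I \<longleftrightarrow> (\<forall>P. prime_ideal P \<longrightarrow> I \<subseteq> P \<longrightarrow> P = m)"

lemma zero_dim_mono: "zero_dim I \<Longrightarrow> I \<subseteq> J \<Longrightarrow> zero_dim J"
  by (auto simp: zero_dim_def)

lemma zero_dimI: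
  assumes "\<And>c. c \<in> m \<Longrightarrow> \<exists>k. c ^ k \<in> I"
  shows "zero_dim I"
  unfolding zero_dim_def
proof (intro allI impI)
  fix P assume P: "prime_ideal P" "I \<subseteq> P"
  then have "m \<subseteq> P" using assms prime_power by blast
  then show "P = m" using prime_m_sub P by blast
qed

lemma zero_dim_F: "zero_dim (F n)"
proof (rule zero_dimI)
  fix c assume "c \<in> m"
  then obtain k where "c ^ k \<in> F 1" using m_power by blast
  then have "(c ^ k) ^ n \<in> F n" by (rule F_power)
  then show "\<exists>k. c ^ k \<in> F n" by (metis power_mult)
qed

text \<open>0 is a zero-divisor on the nonzero module A/I, so \<open>ass I\<close> is nonempty, and
  its primes contain I, hence equal m.\<close>

lemma zero_dim_socle:
  assumes I: "is_ideal I" "I \<noteq> UNIV" "zero_dim I"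
  shows "\<exists>a. a \<notin> I \<and> {b. a * b \<in> I} = m"
proof -
  have "1 \<notin> I" using ideal_eq_UNIV I by blast
  then have "\<exists>P\<in>A.ass I. 0 \<in> P"
    using I is_idealD(1)[OF I(1)] by (intro A.zero_divisor_in_ass[of I 1 0]) (auto simp: sideal_UNIV)
  then obtain P where P: "P \<in> A.ass I" by blast
  then have "prime_ideal P" using ass_prime I by blast
  moreover obtain a where a: "a \<notin> I" "P = colon UNIV I a" "I \<subseteq> P"
    using A.assE[OF _ P] I(1) by (metis sideal_UNIV)
  ultimately have "P = m" using I by (auto simp: zero_dim_def)
  then show ?thesis using a by (auto simp: colon_def mult.commute)
qed

lemma finlen_m: "finlen m UNIV"
  unfolding finlen_def
proof (intro conjI exI[of _ 1] allI impI)
  fix k assume k: "has_ideal_chain m UNIV k"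
  show "k \<le> 1"
  proof (rule ccontr)
    assume "\<not> k \<le> 1"
    then obtain j where "k = Suc (Suc j)" by (metis One_nat_def Suc_le_mono le0 not_less_eq_eq old.nat.exhaust)
    then obtain J where J: "has_ideal_chain m J (Suc j)" "is_ideal J" "J \<subset> UNIV" using k chain_SucE by metis
    then have "J = m" using chain_subset[OF J(1)] proper_sub_m by auto
    moreover obtain L where "has_ideal_chain m L j" "L \<subset> J" using J chain_SucE by metis
    ultimately show False using chain_subset by blast
  qed
qed (use ideal_m is_ideal_UNIV in auto)

text \<open>Noetherian induction: adding a socle element a to a maximal counterexample J contributes
  (J + aA)/J, isomorphic to A/m, of length one.\<close>

lemma zero_dim_finlen:
  assumes "is_ideal I" "zero_dim I"
  shows "finlen I UNIV"
proof (rule ccontr)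
  assume n: "\<not> finlen I UNIV"
  obtain J where J: "is_ideal J \<and> zero_dim J \<and> \<not> finlen J UNIV" "is_ideal J"
    "\<And>K. is_ideal K \<and> zero_dim K \<and> \<not> finlen K UNIV \<Longrightarrow> J \<subseteq> K \<Longrightarrow> K = J"
    by (rule noeth_max[of "\<lambda>J. is_ideal J \<and> zero_dim J \<and> \<not> finlen J UNIV" I]) (use assms n in blast)+
  have "J \<noteq> UNIV"
  proof
    assume "J = UNIV"
    then show False using J(1) finlen_sub(2)[OF finlen_m is_ideal_UNIV] by auto
  qed
  then obtain a where a: "a \<notin> J" "{b. a * b \<in> J} = m" using zero_dim_socle J by blast
  define K where "K = isum J (xmul a UNIV)"
  have K: "is_ideal K" "J \<subseteq> K" unfolding K_def
    using J is_ideal_add isum_superset[OF J(2) is_ideal_xmul[OF is_ideal_UNIV]] by auto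
  have "a \<in> xmul a UNIV" unfolding xmul_def by (intro CollectI exI[of _ 1]) simp
  then have "a \<in> K" using isum_superset(2)[OF J(2) is_ideal_xmul[OF is_ideal_UNIV]] unfolding K_def by blast
  then have "finlen K UNIV" using J(1) J(3)[of K] K a zero_dim_mono by blast
  moreover have "has_ideal_chain J K = has_ideal_chain m UNIV"
    using chain_mult_iso[OF is_ideal_UNIV J(2), of a] a unfolding K_def by simp
  then have "finlen J K" using finlen_cong finlen_m by blast
  ultimately show False using ell_add(1) J by blast
qed

text \<open>Noetherian induction again: if F_n lies in J + aA with a in the socle modulo J, then
  F_{n+1} = F_1 F_n lies in J for large n, because F_1 is inside m.\<close>

lemma F_sub_zero_dim:
  assumes "is_ideal W" "zero_dim W"
  shows "\<exists>n. F n \<subseteq> W"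
proof (rule ccontr)
  assume n: "\<not> (\<exists>n. F n \<subseteq> W)"
  obtain J where J: "is_ideal J \<and> zero_dim J \<and> \<not> (\<exists>n. F n \<subseteq> J)" "is_ideal J"
    "\<And>K. is_ideal K \<and> zero_dim K \<and> \<not> (\<exists>n. F n \<subseteq> K) \<Longrightarrow> J \<subseteq> K \<Longrightarrow> K = J"
    by (rule noeth_max[of "\<lambda>J. is_ideal J \<and> zero_dim J \<and> \<not> (\<exists>n. F n \<subseteq> J)" W]) (use assms n in blast)+
  have "J \<noteq> UNIV" using J(1) by auto
  then obtain a where a: "a \<notin> J" "{b. a * b \<in> J} = m" using zero_dim_socle J by blast
  define K where "K = isum J (xmul a UNIV)"
  have K: "is_ideal K" "J \<subseteq> K" unfolding K_def
    using J is_ideal_add isum_superset[OF J(2) is_ideal_xmul[OF is_ideal_UNIV]] by auto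
  have "a \<in> xmul a UNIV" unfolding xmul_def by (intro CollectI exI[of _ 1]) simp
  then have "a \<in> K" using isum_superset(2)[OF J(2) is_ideal_xmul[OF is_ideal_UNIV]] unfolding K_def by blast
  then obtain n where n: "F n \<subseteq> K" using J(1) J(3)[of K] K a zero_dim_mono by blast
  define k where "k = max n N0"
  have Fk: "F (Suc k) = ideal_prod (F 1) (F k)" by (rule F_stable) (simp add: k_def)
  have "F (Suc k) \<subseteq> J" unfolding Fk
  proof (rule ideal_prod_least[OF J(2)])
    fix x y assume x: "x \<in> F 1" and y: "y \<in> F k"
    have "y \<in> K" using y n F_mono[of n k] by (auto simp: k_def)
    then obtain j b where jb: "j \<in> J" "y = j + a * b" by (auto simp: K_def isum_def xmul_def)
    have "x \<in> m" using x F1_sub_m by blast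
    then have "a * x \<in> J" using a by blast
    then have "b * (a * x) + x * j \<in> J" using jb is_idealD[OF J(2)] by blast
    then show "x * y \<in> J" using jb by (simp add: algebra_simps)
  qed
  then show False using J by blast
qed

text \<open>Krull's theorem without Artin-Rees. For T containing J + mD, take W over T maximal with
  W \<inter> D inside T. Stabilisation of (W : c^k) shows that W + (c^k) has the same property, so W
  contains a power of each c in m. Hence W contains some F_n + J, so all of D.\<close>

lemma krull_intersection:
  assumes J: "is_ideal J" and D: "is_ideal D" "\<And>n. D \<subseteq> isum (F n) J"
  shows "D \<subseteq> J"
proof (rule nakayama[OF D(1) J])
  fix T assume T: "is_ideal T" "J \<subseteq> T" "\<And>c a. c \<in> m \<Longrightarrow> a \<in> D \<Longrightarrow> c * a \<in> T"
  obtain W where W: "is_ideal W \<and> T \<subseteq> W \<and> W \<inter> D \<subseteq> T" "is_ideal W"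
    "\<And>K. is_ideal K \<and> T \<subseteq> K \<and> K \<inter> D \<subseteq> T \<Longrightarrow> W \<subseteq> K \<Longrightarrow> K = W"
    by (rule noeth_max[of "\<lambda>W. is_ideal W \<and> T \<subseteq> W \<and> W \<inter> D \<subseteq> T" T]) (use T in blast)+
  have "\<exists>k. c ^ k \<in> W" if c: "c \<in> m" for c
  proof -
    define Q where "Q k = colon UNIV W (c ^ k)" for k
    have "\<exists>n. \<forall>k\<ge>n. Q k = Q n"
    proof (rule A.chain_stable)
      show "sideal UNIV (Q n)" for n unfolding Q_def using W by (intro sideal_colon subring_UNIV) (auto simp: sideal_UNIV)
      show "Q n \<subseteq> Q (Suc n)" for n using is_idealD(4)[OF W(2), of _ c] by (auto simp: Q_def colon_def mult.left_commute[of _ c])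
    qed
    then obtain k where k: "Q (Suc k) = Q k" by (meson le_SucI le_refl)
    define W' where "W' = isum W (xmul (c ^ k) UNIV)"
    have W': "is_ideal W'" "W \<subseteq> W'" unfolding W'_def
      using W is_ideal_add isum_superset[OF W(2) is_ideal_xmul[OF is_ideal_UNIV]] by auto
    have "W' \<inter> D \<subseteq> T"
    proof
      fix d assume d: "d \<in> W' \<inter> D"
      then obtain w a where w: "w \<in> W" "d = w + c ^ k * a" by (auto simp: W'_def isum_def xmul_def)
      have "c * d \<in> W" using T(3)[OF c, of d] d W(1) by blast
      then have "c * d - c * w \<in> W" using w is_idealD[OF W(2)] by blast
      also have "c * d - c * w = a * c ^ Suc k" using w by (simp add: algebra_simps)
      finally have "a \<in> Q (Suc k)" by (simp add: Q_def colon_def)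
      then have "a \<in> Q k" using k by simp
      then have "a * c ^ k \<in> W" by (simp add: Q_def colon_def)
      then have "d \<in> W" using w is_idealD(2)[OF W(2)] by (simp add: mult.commute)
      then show "d \<in> T" using d W(1) by blast
    qed
    then have "W' = W" using W(3)[of W'] W' W(1) by blast
    moreover have "c ^ k \<in> xmul (c ^ k) UNIV" unfolding xmul_def by (intro CollectI exI[of _ 1]) simp
    then have "c ^ k \<in> W'" using isum_superset(2)[OF W(2) is_ideal_xmul[OF is_ideal_UNIV]] unfolding W'_def by blast
    ultimately show ?thesis by blast
  qed
  then have "zero_dim W" by (rule zero_dimI)
  then obtain n where "F n \<subseteq> W" using F_sub_zero_dim W by blast
  then have "isum (F n) J \<subseteq> W" using W T by (intro isum_least) auto
  then have "D \<subseteq> W" using D(2)[of n] by blast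
  then show "D \<subseteq> T" using W(1) by blast
qed

text \<open>The multiplicative set of all s*x^n with s outside P misses J, because x can be
  cancelled. An ideal maximal over J among those missing this set is prime, lies in P, and omits x.
  This replaces height theory in counting dimensions.\<close>

lemma smaller_prime:
  assumes J: "is_ideal (J :: 'a set)" and P: "prime_ideal P" "J \<subseteq> P" and x: "x \<in> P" "nzd UNIV x J"
  shows "\<exists>P'. prime_ideal P' \<and> J \<subseteq> P' \<and> P' \<subset> P"
proof -
  define S where "S = {s * x ^ n | s n. s \<notin> P}"
  have xJ: "s \<in> J" if "s * x ^ n \<in> J" for s n
    using that by (induction n) (use x in \<open>auto simp: nzd_def mult.left_commute\<close>)
  have dis: "J \<inter> S = {}" using xJ P by (auto simp: S_def)
  obtain I where I: "is_ideal I \<and> J \<subseteq> I \<and> I \<inter> S = {}" "is_ideal I"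
    "\<And>K. is_ideal K \<and> J \<subseteq> K \<and> K \<inter> S = {} \<Longrightarrow> I \<subseteq> K \<Longrightarrow> K = I"
    by (rule noeth_max[of "\<lambda>I. is_ideal I \<and> J \<subseteq> I \<and> I \<inter> S = {}" J]) (use J dis in blast)+
  have Pi: "is_ideal P" "1 \<notin> P" using P ideal_eq_UNIV by (auto simp: prime_ideal_def)
  have notP: "s \<in> S" if "s \<notin> P" for s unfolding S_def using that by (intro CollectI exI[of _ s] exI[of _ 0]) simp
  have IP: "I \<subseteq> P" using notP I(1) by blast
  have xS: "x \<in> S" unfolding S_def using Pi by (intro CollectI exI[of _ 1] exI[of _ 1]) simp
  have Smult: "s * t \<in> S" if "s \<in> S" "t \<in> S" for s t
  proof -
    obtain a b i j where "s = a * x ^ i" "t = b * x ^ j" "a \<notin> P" "b \<notin> P" using \<open>s \<in> S\<close> \<open>t \<in> S\<close> by (auto simp: S_def)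
    then show ?thesis unfolding S_def using P
      by (intro CollectI exI[of _ "a * b"] exI[of _ "i + j"]) (auto simp: prime_ideal_def power_add algebra_simps)
  qed
  have ex: "\<exists>i\<in>I. \<exists>r. i + a * r \<in> S" if a: "a \<notin> I" for a
  proof -
    define K where "K = isum I (xmul a UNIV)"
    have K: "is_ideal K" "I \<subseteq> K" unfolding K_def
      using I is_ideal_add isum_superset[OF I(2) is_ideal_xmul[OF is_ideal_UNIV]] by auto
    have "a \<in> xmul a UNIV" unfolding xmul_def by (intro CollectI exI[of _ 1]) simp
    then have "a \<in> K" using isum_superset(2)[OF I(2) is_ideal_xmul[OF is_ideal_UNIV]] unfolding K_def by blast
    then have "K \<inter> S \<noteq> {}" using I(1) I(3)[of K] K a by blast
    then show ?thesis by (auto simp: K_def isum_def xmul_def)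
  qed
  have "a \<in> I \<or> b \<in> I" if ab: "a * b \<in> I" for a b
  proof (rule ccontr)
    assume "\<not> ?thesis"
    then obtain i r j s where ij: "i \<in> I" "i + a * r \<in> S" "j \<in> I" "j + b * s \<in> S" using ex by meson
    have "(i + a * r) * (j + b * s) = i * (j + b * s) + (a * r) * j + (r * s) * (a * b)" by (simp add: algebra_simps)
    then have "(i + a * r) * (j + b * s) \<in> I" using ij ab is_idealD[OF I(2)] by metis
    then show False using Smult[OF ij(2,4)] I(1) by blast
  qed
  moreover have "I \<noteq> UNIV" using xS I(1) by blast
  ultimately have "prime_ideal I" using I by (simp add: prime_ideal_def)
  then show ?thesis using I(1) IP xS x by blast
qed

end

section \<open>The Rees ring\<close>

context hilbert_setup
begin

text \<open>The Rees ring \<open>\<Oplus>F\<^sub>n t\<^sup>n\<close> inside the polynomial ring \<open>A[t]\<close>; the associated graded ring is its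
  quotient by the ideal \<open>Gr {0}\<close>, and that of the filtration induced on \<open>A/J\<close> its quotient by \<open>Gr J\<close>.\<close>
definition Rees :: "'a poly set" where "Rees = {p. \<forall>n. coeff p n \<in> F n}"

lemma ReesD: "p \<in> Rees \<Longrightarrow> coeff p n \<in> F n" by (simp add: Rees_def)

lemma ideal_sum_mem: "is_ideal I \<Longrightarrow> (\<And>i. i \<in> B \<Longrightarrow> f i \<in> I) \<Longrightarrow> sum f B \<in> I"
  using sideal_sum[of UNIV I B f] by (simp add: sideal_UNIV)

lemma Rees_subring: "subring Rees"
  unfolding subring_def
proof (intro conjI ballI)
  show "1 \<in> Rees" by (auto simp: Rees_def F_0 is_idealD[OF F_ideal])
  fix p q assume p: "p \<in> Rees" and q: "q \<in> Rees"
  show "p - q \<in> Rees" using p q is_idealD[OF F_ideal] by (auto simp: Rees_def)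
  have "coeff p i * coeff q (n - i) \<in> F n" if "i \<le> n" for i n
    using F_mult[OF ReesD[OF p, of i] ReesD[OF q, of "n - i"]] that by simp
  then show "p * q \<in> Rees" unfolding Rees_def
    by (auto simp: coeff_mult intro!: ideal_sum_mem[OF F_ideal])
qed

lemma monom_Rees: "a \<in> F n \<Longrightarrow> monom a n \<in> Rees"
  using is_idealD(1)[OF F_ideal] by (auto simp: Rees_def)

lemma const_Rees: "[:a:] \<in> Rees"
  using monom_Rees[of a 0] by (simp add: F_0 monom_0)

lemma noeth_const: "noeth_subring (range (\<lambda>a::'a. [:a:]))"
proof (rule noeth_subringI)
  show "subring (range (\<lambda>a::'a. [:a:]))" unfolding subring_def
  proof (intro conjI ballI)
    show "1 \<in> range (\<lambda>a::'a. [:a:])" by (intro image_eqI[of _ _ 1]) (auto simp: one_pCons)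
    fix x y assume "x \<in> range (\<lambda>a::'a. [:a:])" "y \<in> range (\<lambda>a::'a. [:a:])"
    then obtain a b where "x = [:a:]" "y = [:b:]" by auto
    then show "x - y \<in> range (\<lambda>a::'a. [:a:])" "x * y \<in> range (\<lambda>a::'a. [:a:])" by auto
  qed
  fix T :: "nat \<Rightarrow> 'a poly set"
  assume T: "\<And>n. sideal (range (\<lambda>a::'a. [:a:])) (T n)" and mono: "\<And>n. T n \<subseteq> T (Suc n)"
  define U where "U n = {a. [:a:] \<in> T n}" for n
  have "is_ideal (U n)" for n unfolding is_ideal_def
  proof (intro conjI ballI allI impI)
    show "0 \<in> U n" using sideal_props(2)[OF T[of n]] by (simp add: U_def)
    show "x + y \<in> U n" if "x \<in> U n" "y \<in> U n" for x y
      using sideal_props(3)[OF T[of n], of "[:x:]" "[:y:]"] that by (simp add: U_def)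
    show "a * x \<in> U n" if "x \<in> U n" for a x
      using sideal_props(4)[OF T[of n], of "[:a:]" "[:x:]"] that by (simp add: U_def mult.commute)
  qed
  then have "\<exists>n. \<forall>k\<ge>n. U k = U n" using mono by (intro A.chain_stable) (auto simp: sideal_UNIV U_def)
  then obtain n where n: "U (Suc n) = U n" by (meson le_SucI le_refl)
  have "T (Suc n) \<subseteq> T n"
  proof
    fix x assume x: "x \<in> T (Suc n)"
    then obtain a where "x = [:a:]" using sideal_props(1)[OF T] by blast
    then show "x \<in> T n" using x n by (auto simp: U_def)
  qed
  then show "\<exists>n. T (Suc n) = T n" using mono by blast
qed

lemma monom_ideal:
  assumes S: "subring S" "range (\<lambda>a::'a. [:a:]) \<subseteq> S" and I: "sideal S I"
  shows "is_ideal {a. monom a n \<in> I}"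
  unfolding is_ideal_def
proof (intro conjI ballI allI impI)
  show "0 \<in> {a. monom a n \<in> I}" using sideal_props(2)[OF I] by simp
  show "x + y \<in> {a. monom a n \<in> I}" if "x \<in> {a. monom a n \<in> I}" "y \<in> {a. monom a n \<in> I}" for x y
    using sideal_props(3)[OF I, of "monom x n" "monom y n"] that by (simp add: add_monom)
  show "a * x \<in> {a. monom a n \<in> I}" if "x \<in> {a. monom a n \<in> I}" for a x
    using sideal_props(4)[OF I, of "[:a:]" "monom x n"] that S by (auto simp: smult_monom)
qed

text \<open>As an A-algebra the Rees ring is generated by finitely many monomials: generators of F_n
  in degree n for small n, all higher degrees being F_1 times the previous one.\<close>

lemma noeth_Rees: "noeth_subring Rees"
proof -
  have "\<forall>n. \<exists>B. finite B \<and> F n = ideal_gen B"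
    using loc F_ideal by (auto simp: noetherian_local_ring_def noetherian_ring_def)
  then obtain B where B: "\<And>n. finite (B n)" "\<And>n. F n = ideal_gen (B n)" by metis
  \<comment> \<open>\<open>Suc N0\<close> is at least 1, so degree one, needed for the factor F_1,
    is always included.\<close>
  define BB where "BB = (\<Union>n\<le>Suc N0. (\<lambda>b. monom b n) ` B n)"
  have "finite BB" using B by (auto simp: BB_def)
  moreover have "BB \<subseteq> Rees" using B ideal_gen_superset monom_Rees unfolding BB_def by blast
  moreover have cR: "range (\<lambda>a. [:a:]) \<subseteq> Rees" using const_Rees by blast
  ultimately obtain S where S: "noeth_subring S" "range (\<lambda>a. [:a:]) \<subseteq> S" "BB \<subseteq> S" "S \<subseteq> Rees"
    using noeth_finite_adjoin[OF noeth_const Rees_subring cR] by metis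
  note sr = noeth_subring.subring[OF S(1)]
  have SS: "sideal S S" using subring_props[OF sr] by (auto simp: sideal_def)
  have low: "monom a n \<in> S" if "n \<le> Suc N0" "a \<in> F n" for a n
  proof -
    have "B n \<subseteq> {a. monom a n \<in> S}" using S that by (auto simp: BB_def)
    then show ?thesis using ideal_gen_least[OF monom_ideal[OF sr S(2) SS]] B(2)[of n] that by blast
  qed
  have all: "\<forall>a\<in>F n. monom a n \<in> S" for n
  proof (induction n)
    case 0
    then show ?case using low by simp
  next
    case (Suc n)
    show ?case
    proof (cases "n \<le> N0")
      case True
      then show ?thesis using low by simp
    next
      case False
      have "ideal_prod (F 1) (F n) \<subseteq> {a. monom a (Suc n) \<in> S}"
      proof (rule ideal_prod_least[OF monom_ideal[OF sr S(2) SS]])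
        fix x y assume "x \<in> F 1" "y \<in> F n"
        then have "monom x 1 * monom y n \<in> S" using Suc low[of 1 x] subring_props(4)[OF sr] by auto
        then show "x * y \<in> {a. monom a (Suc n) \<in> S}" by (simp add: mult_monom)
      qed
      then show ?thesis using F_stable[of n] False by auto
    qed
  qed
  have "Rees \<subseteq> S"
  proof
    fix p assume p: "p \<in> Rees"
    have "(\<Sum>i\<le>degree p. monom (coeff p i) i) \<in> S"
      using all ReesD[OF p] by (intro subring_sum[OF sr]) auto
    then show "p \<in> S" by (simp add: poly_as_sum_of_monoms)
  qed
  then show ?thesis using S by (metis subset_antisym)
qed

text \<open>The preimage of the homogeneous maximal ideal of G(F) that \<open>depth_G\<close> refers
  to.\<close>

definition MR :: "'a poly set" where "MR = {p \<in> Rees. coeff p 0 \<in> m}"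

lemma depth_subring_Rees: "depth_subring Rees MR ((\<lambda>a. [:a:]) ` Gam)"
proof (intro depth_subring.intro noeth_Rees depth_subring_axioms.intro)
  show "sideal Rees MR"
    using subring_props[OF Rees_subring] is_idealD[OF ideal_m(1)] by (auto simp: sideal_def MR_def coeff_mult_0)
  have "inj_on (\<lambda>a. [:a:]) Gam" by (auto simp: inj_on_def)
  then show "infinite ((\<lambda>a. [:a:]) ` Gam)" using Gam(1) finite_imageD by blast
  show "(\<lambda>a. [:a:]) ` Gam \<subseteq> Rees" using const_Rees by blast
  fix a b assume ab: "a \<in> (\<lambda>a. [:a:]) ` Gam" "b \<in> (\<lambda>a. [:a:]) ` Gam" "a \<noteq> b"
  then obtain c d where cd: "a = [:c:]" "b = [:d:]" "c \<in> Gam" "d \<in> Gam" "c \<noteq> d" by auto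
  obtain u where "u * (c - d) = 1" using unit_outside_m[OF Gam(2)[OF cd(3-5)]] by blast
  then have "[:u:] * (a - b) = 1" using cd by (simp add: one_pCons mult.commute)
  then show "\<exists>u\<in>Rees. u * (a - b) = 1" using const_Rees by blast
qed

sublocale R: depth_subring Rees MR "(\<lambda>a. [:a:]) ` Gam" by (rule depth_subring_Rees)

definition E :: "'a set \<Rightarrow> nat \<Rightarrow> 'a set" where "E J n = isum (F n) J"

lemma E_ideal: "is_ideal J \<Longrightarrow> is_ideal (E J n)"
  unfolding E_def by (rule is_ideal_isum[OF F_ideal])

lemma E_superset: "is_ideal J \<Longrightarrow> F n \<subseteq> E J n" "is_ideal J \<Longrightarrow> J \<subseteq> E J n"
  unfolding E_def using isum_superset[OF F_ideal] by blast+

lemma E_mono: "i \<le> j \<Longrightarrow> E J j \<subseteq> E J i"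
  unfolding E_def by (intro isum_mono F_mono) auto

lemma E_0: "is_ideal J \<Longrightarrow> E J 0 = UNIV"
  using E_superset(1)[of J 0] by (auto simp: F_0)

lemma E_mult:
  assumes J: "is_ideal J" and a: "a \<in> F i" and b: "b \<in> E J j"
  shows "a * b \<in> E J (i + j)"
proof -
  obtain f c where "f \<in> F j" "c \<in> J" "b = f + c" using b by (auto simp: E_def isum_def)
  then show ?thesis unfolding E_def using F_mult[OF a] is_idealD(4)[OF J]
    by (auto simp: distrib_left intro: isumI)
qed

definition Gr :: "'a set \<Rightarrow> 'a poly set" where
  "Gr J = {p \<in> Rees. \<forall>n. coeff p n \<in> E J (Suc n)}"

lemma Gr_sideal:
  assumes J: "is_ideal J"
  shows "sideal Rees (Gr J)"
  unfolding sideal_def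
proof (intro conjI ballI)
  note Ei = is_idealD[OF E_ideal[OF J]]
  show "Gr J \<subseteq> Rees" by (auto simp: Gr_def)
  show "0 \<in> Gr J" using R.S_props Ei by (simp add: Gr_def)
  show "x + y \<in> Gr J" if "x \<in> Gr J" "y \<in> Gr J" for x y
    using that R.S_props Ei by (simp add: Gr_def)
  show "a * x \<in> Gr J" if a: "a \<in> Rees" and x: "x \<in> Gr J" for a x
  proof -
    have "coeff a i * coeff x (n - i) \<in> E J (Suc n)" if "i \<le> n" for i n
    proof -
      have "coeff x (n - i) \<in> E J (Suc (n - i))" using x by (simp add: Gr_def)
      from E_mult[OF J ReesD[OF a, of i] this] show ?thesis using that by simp
    qed
    then have "\<forall>n. coeff (a * x) n \<in> E J (Suc n)"
      by (auto simp: coeff_mult intro!: ideal_sum_mem[OF E_ideal[OF J]])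
    then show ?thesis using a x R.S_props by (simp add: Gr_def)
  qed
qed

lemma monom_Gr:
  assumes J: "is_ideal J" and a: "a \<in> F n"
  shows "monom a n \<in> Gr J \<longleftrightarrow> a \<in> E J (Suc n)"
  using monom_Rees[OF a] is_idealD(1)[OF E_ideal[OF J]] by (auto simp: Gr_def)

text \<open>The c with c*t in a given P form an ideal of A not containing F_1. Avoidance is carried
  out in A rather than in the Rees ring, which keeps the chosen element homogeneous of degree one;
  \<open>NN\<close> collects further ideals to avoid at the same time.\<close>

lemma choose_superficial:
  assumes I: "sideal Rees I" and P: "\<And>P. P \<in> R.ass I \<Longrightarrow> \<exists>c\<in>F 1. monom c 1 \<notin> P"
    and NN: "finite NN" "\<And>N. N \<in> NN \<Longrightarrow> is_ideal N" "\<And>N. N \<in> NN \<Longrightarrow> \<not> F 1 \<subseteq> N"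
  shows "\<exists>x\<in>F 1. (\<forall>N\<in>NN. x \<notin> N) \<and> nzd Rees (monom x 1) I"
proof -
  define f where "f P = {c. monom c 1 \<in> P}" for P :: "'a poly set"
  have fi: "is_ideal (f P)" if "P \<in> R.ass I" for P
  proof -
    have "sideal Rees P" using R.assE[OF I that] by metis
    then show ?thesis unfolding f_def using const_Rees by (intro monom_ideal[OF Rees_subring]) auto
  qed
  have "\<exists>x\<in>F 1. \<forall>N\<in>NN \<union> f ` R.ass I. x \<notin> N"
  proof (rule exists_avoiding_finite_union[OF subring_UNIV A.G A.unit])
    show "sideal UNIV (F 1)" by (simp add: sideal_UNIV F_ideal)
    show "finite (NN \<union> f ` R.ass I)" using NN R.finite_ass[OF I] by simp
    fix N assume N: "N \<in> NN \<union> f ` R.ass I"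
    show "sideal UNIV N" using N NN fi by (auto simp: sideal_UNIV)
    show "\<not> F 1 \<subseteq> N" using N NN P by (auto simp: f_def)
  qed auto
  then obtain x where x: "x \<in> F 1" "\<forall>N\<in>NN \<union> f ` R.ass I. x \<notin> N" by blast
  have xP: "monom x 1 \<notin> P" if "P \<in> R.ass I" for P using x(2) that by (auto simp: f_def)
  have "nzd Rees (monom x 1) I" unfolding nzd_def
    using R.zero_divisor_in_ass[OF I, of _ "monom x 1"] xP monom_Rees[OF x(1)] by blast
  then show ?thesis using x by blast
qed

text \<open>Degree 0: a power of an element of m lies in F_1, which is zero in degree 0 of the
  graded ring. Positive degree: a high power lands where F_{n+1} = F_1 F_n, and so is a combination
  of multiples of elements c*t.\<close>

lemma MR_sub_prime:
  assumes P: "sideal Rees P" "\<And>b c. b \<in> Rees \<Longrightarrow> c \<in> Rees \<Longrightarrow> b * c \<in> P \<Longrightarrow> b \<in> P \<or> c \<in> P" "1 \<notin> P"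
    and J: "is_ideal J" "Gr J \<subseteq> P" and F1: "\<And>c. c \<in> F 1 \<Longrightarrow> monom c 1 \<in> P"
  shows "MR \<subseteq> P"
proof
  have pow: "b \<in> P" if "b \<in> Rees" "b ^ n \<in> P" for b n
    using that
  proof (induction n)
    case (Suc n)
    then show ?case using P(2)[of b "b ^ n"] subring_power[OF Rees_subring] by auto
  qed (use P in auto)
  have big: "monom b n \<in> P" if n: "n > N0" "b \<in> F n" for b n
  proof -
    obtain k where k: "n = Suc k" "k \<ge> N0" using n by (cases n) auto
    have "ideal_prod (F 1) (F k) \<subseteq> {a. monom a n \<in> P}"
    proof (rule ideal_prod_least)
      show "is_ideal {a. monom a n \<in> P}" using const_Rees by (intro monom_ideal[OF Rees_subring _ P(1)]) auto
      fix x y assume "x \<in> F 1" "y \<in> F k"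
      then have "monom x 1 * monom y k \<in> P" using F1 monom_Rees sideal_props(5)[OF P(1)] by blast
      then show "x * y \<in> {a. monom a n \<in> P}" using k by (simp add: mult_monom)
    qed
    then show ?thesis using F_stable[OF k(2)] k n by auto
  qed
  fix p assume p: "p \<in> MR"
  have pR: "p \<in> Rees" using p by (simp add: MR_def)
  have "monom (coeff p i) i \<in> P" for i
  proof (cases "i = 0")
    case True
    have "coeff p 0 \<in> m" using p by (simp add: MR_def)
    then obtain k where k: "coeff p 0 ^ k \<in> F 1" using m_power by blast
    have "coeff p 0 ^ k \<in> E J (Suc 0)" using k E_superset(1)[OF J(1), of 1] by auto
    then have "monom (coeff p 0 ^ k) 0 \<in> P" using monom_Gr[OF J(1), of _ 0] J(2) by (auto simp: F_0)
    then have "monom (coeff p 0) 0 ^ k \<in> P" by (simp add: monom_power)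
    then show ?thesis using pow[of "monom (coeff p 0) 0" k] monom_Rees[of _ 0] True by (auto simp: F_0)
  next
    case False
    have mR: "monom (coeff p i) i \<in> Rees" using monom_Rees ReesD[OF pR] by blast
    define n where "n = i * Suc N0"
    have "monom (coeff p i ^ Suc N0) n \<in> Rees"
      using subring_power[OF Rees_subring mR, of "Suc N0"] by (simp add: monom_power n_def del: power_Suc)
    then have "coeff p i ^ Suc N0 \<in> F n" using ReesD[of _ n] by fastforce
    moreover have "n > N0" using False by (cases i) (auto simp: n_def)
    ultimately have "monom (coeff p i ^ Suc N0) n \<in> P" using big by blast
    then have "monom (coeff p i) i ^ Suc N0 \<in> P" by (simp add: monom_power n_def del: power_Suc)
    then show ?thesis using pow mR by blast
  qed
  then have "(\<Sum>i\<le>degree p. monom (coeff p i) i) \<in> P" by (intro sideal_sum[OF P(1)])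
  then show "p \<in> P" by (simp add: poly_as_sum_of_monoms)
qed

text \<open>A possibly inhomogeneous regular z yields one of degree one: an associated prime
  containing every c*t would contain \<open>MR\<close>, hence z.\<close>

lemma dep_choose:
  assumes J: "is_ideal J" and d: "R.dep (Suc k) (Gr J)"
  shows "\<exists>x\<in>F 1. nzd Rees (monom x 1) (Gr J)"
proof -
  obtain z where z: "z \<in> MR" "nzd Rees z (Gr J)" using d by auto
  have "\<exists>c\<in>F 1. monom c 1 \<notin> P" if P: "P \<in> R.ass (Gr J)" for P
  proof (rule ccontr)
    assume n: "\<not> ?thesis"
    obtain a where a: "a \<in> Rees" "a \<notin> Gr J" "P = colon Rees (Gr J) a" "1 \<notin> P" "sideal Rees P"
      "\<And>b c. b \<in> Rees \<Longrightarrow> c \<in> Rees \<Longrightarrow> b * c \<in> P \<Longrightarrow> b \<in> P \<or> c \<in> P" "Gr J \<subseteq> P"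
      by (rule R.assE[OF Gr_sideal[OF J] P]) metis
    have "MR \<subseteq> P" using MR_sub_prime[OF a(5,6,4) J a(7)] n by blast
    then have "z * a \<in> Gr J" using z a by (auto simp: colon_def)
    then show False using z a by (auto simp: nzd_def)
  qed
  then show ?thesis using choose_superficial[OF Gr_sideal[OF J], of "{}"] by auto
qed

end

section \<open>Depth\<close>

text \<open>If P is unbounded, \<open>GREATEST\<close> is unspecified but large witnesses exist
  anyway, so depth never has to be shown finite.\<close>

lemma le_Greatest_ex:
  fixes P :: "nat \<Rightarrow> bool"
  assumes "d \<le> (GREATEST k. P k)" "P 0"
  shows "\<exists>k\<ge>d. P k"
proof (cases "\<exists>b. \<forall>k. P k \<longrightarrow> k \<le> b")
  case True
  then have "P (GREATEST k. P k)" using assms(2) GreatestI_nat[of P 0] by blast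
  then show ?thesis using assms by blast
next
  case False
  then show ?thesis by (meson nat_le_linear)
qed

context hilbert_setup
begin

lemma A_regular_seq_dep:
  assumes "A_regular_seq m xs"
  shows "A.dep (length xs) {0}"
proof -
  have "A.dep k (ideal_gen (set (take i xs)))" if "i + k = length xs" for k i
    using that
  proof (induction k arbitrary: i)
    case (Suc k)
    then have i: "i < length xs" by simp
    have "set (take (Suc i) xs) = insert (xs ! i) (set (take i xs))"
      using i by (simp add: take_Suc_conv_app_nth)
    then have "A.ext (ideal_gen (set (take i xs))) (xs ! i) = ideal_gen (set (take (Suc i) xs))"
      using A_ext ideal_gen_insert by metis
    moreover have "A.dep k (ideal_gen (set (take (Suc i) xs)))" using Suc by simp
    moreover have "xs ! i \<in> m" using assms i nth_mem unfolding A_regular_seq_def by blast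
    moreover have "nzd UNIV (xs ! i) (ideal_gen (set (take i xs)))"
      using assms i unfolding A_regular_seq_def nzd_def by blast
    ultimately show ?case by auto
  qed simp
  from this[of 0 "length xs"] show ?thesis by (simp add: ideal_gen_empty)
qed

lemma depth_A_dep:
  assumes "d \<le> depth_A m"
  shows "A.dep d {0}"
proof -
  have "A_regular_seq m []"
    using ideal_m(3) is_idealD(1)[OF ideal_m(1)] by (auto simp: A_regular_seq_def ideal_gen_empty) (metis UNIV_I singletonD)
  then obtain k where "k \<ge> d" "\<exists>xs. length xs = k \<and> A_regular_seq m xs"
    using le_Greatest_ex[of d "\<lambda>k. \<exists>xs. length xs = k \<and> A_regular_seq m xs"] assms by (auto simp: depth_A_def)
  then show ?thesis using A_regular_seq_dep A.dep_mono by blast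
qed

lemma E_zero: "E {0} n = F n"
  by (auto simp: E_def isum_def)

lemma Gr_zero: "Gr {0} = {p \<in> Rees. \<forall>n. coeff p n \<in> F (Suc n)}"
  by (simp add: Gr_def E_zero)

text \<open>The counterpart of \<open>gr_in_ideal\<close>: the preimage in the Rees ring of the
  ideal of G(F) generated by the classes of ps.\<close>

definition lin_ideal :: "'a poly list \<Rightarrow> 'a poly set" where
  "lin_ideal ps = {p \<in> Rees. \<exists>cs. length cs = length ps \<and> set cs \<subseteq> Rees \<and>
      p - sum_list (map2 (*) cs ps) \<in> Gr {0}}"

lemma coeff_lin_comb:
  "foldr gr_add (map2 gr_mult (map coeff cs) (map coeff ps)) (\<lambda>_. 0) = coeff (sum_list (map2 (*) cs ps))"
proof (induction cs arbitrary: ps)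
  case (Cons c cs)
  show ?case
  proof (cases ps)
    case (Cons p qs)
    have "gr_mult (coeff c) (coeff p) = coeff (c * p)" by (auto simp: gr_mult_def coeff_mult)
    then show ?thesis using Cons.IH[of qs] Cons by (simp add: gr_add_def fun_eq_iff)
  qed (simp add: fun_eq_iff)
qed (simp add: fun_eq_iff)

lemma gr_elem_Rees: "p \<in> Rees \<Longrightarrow> gr_elem F (coeff p)"
  unfolding gr_elem_def Rees_def by (auto intro!: exI[of _ "Suc (degree p)"] coeff_eq_0)

lemma gr_elem_poly:
  assumes "gr_elem F c"
  shows "\<exists>p\<in>Rees. coeff p = c"
proof -
  obtain N where "\<And>n. n \<ge> N \<Longrightarrow> c n = 0" using assms by (auto simp: gr_elem_def)
  then have "\<forall>\<^sub>\<infinity>n. c n = 0" unfolding MOST_nat_le by blast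
  then have "coeff (Abs_poly c) = c" by (intro Abs_poly_inverse) simp
  then show ?thesis using assms by (intro bexI[of _ "Abs_poly c"]) (auto simp: Rees_def gr_elem_def)
qed

lemma gr_elem_list:
  assumes "\<forall>c\<in>set cs. gr_elem F c"
  shows "\<exists>ps. set ps \<subseteq> Rees \<and> map coeff ps = cs"
  using assms
proof (induction cs)
  case (Cons c cs)
  obtain ps where "set ps \<subseteq> Rees" "map coeff ps = cs" using Cons by auto
  moreover obtain p where "p \<in> Rees" "coeff p = c" using gr_elem_poly[of c] Cons.prems by auto
  ultimately show ?case by (intro exI[of _ "p # ps"]) simp
qed simp

lemma lin_comb_Rees:
  assumes "set cs \<subseteq> Rees" "set ps \<subseteq> Rees"
  shows "sum_list (map2 (*) cs ps) \<in> Rees"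
  using assms
proof (induction cs arbitrary: ps)
  case (Cons c cs)
  then show ?case using subring_props(4,6)[OF Rees_subring] subring_props(2)[OF Rees_subring] by (cases ps) auto
qed (simp add: subring_props(2)[OF Rees_subring])

lemma gr_in_ideal_iff:
  assumes p: "p \<in> Rees" and ps: "set ps \<subseteq> Rees"
  shows "gr_in_ideal F (map coeff ps) (coeff p) \<longleftrightarrow> p \<in> lin_ideal ps"
proof
  assume "gr_in_ideal F (map coeff ps) (coeff p)"
  then obtain cs where cs: "length cs = length ps" "\<forall>c\<in>set cs. gr_elem F c"
    "gr_eq F (coeff p) (foldr gr_add (map2 gr_mult cs (map coeff ps)) (\<lambda>_. 0))"
    by (auto simp: gr_in_ideal_def)
  obtain qs where qs: "set qs \<subseteq> Rees" "map coeff qs = cs" using gr_elem_list[OF cs(2)] by blast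
  have "p - sum_list (map2 (*) qs ps) \<in> Rees"
    using lin_comb_Rees[OF qs(1) ps] p subring_props(3)[OF Rees_subring] by blast
  moreover have "coeff (p - sum_list (map2 (*) qs ps)) n \<in> F (Suc n)" for n
    using cs(3) unfolding qs(2)[symmetric] coeff_lin_comb by (simp add: gr_eq_def)
  ultimately have "p - sum_list (map2 (*) qs ps) \<in> Gr {0}" by (simp add: Gr_zero)
  then show "p \<in> lin_ideal ps" using qs cs p unfolding lin_ideal_def by auto
next
  assume "p \<in> lin_ideal ps"
  then obtain cs where cs: "length cs = length ps" "set cs \<subseteq> Rees" "p - sum_list (map2 (*) cs ps) \<in> Gr {0}"
    by (auto simp: lin_ideal_def)
  have "gr_eq F (coeff p) (foldr gr_add (map2 gr_mult (map coeff cs) (map coeff ps)) (\<lambda>_. 0))"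
    unfolding coeff_lin_comb using cs(3) by (simp add: gr_eq_def Gr_zero)
  then show "gr_in_ideal F (map coeff ps) (coeff p)" unfolding gr_in_ideal_def
    using cs gr_elem_Rees by (intro exI[of _ "map coeff cs"]) auto
qed

lemma lin_ideal_Nil: "lin_ideal [] = Gr {0}"
  using sideal_props(1)[OF Gr_sideal[OF is_ideal_zero]] by (auto simp: lin_ideal_def)

lemma lin_ideal_snoc:
  assumes "set ps \<subseteq> Rees" "q \<in> Rees"
  shows "lin_ideal (ps @ [q]) = {h + q * b | h b. h \<in> lin_ideal ps \<and> b \<in> Rees}"
proof (intro set_eqI iffI)
  fix p assume "p \<in> lin_ideal (ps @ [q])"
  then obtain cs where cs: "p \<in> Rees" "length cs = Suc (length ps)" "set cs \<subseteq> Rees"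
     "p - sum_list (map2 (*) cs (ps @ [q])) \<in> Gr {0}" by (auto simp: lin_ideal_def)
  obtain ds b where ds: "cs = ds @ [b]" "length ds = length ps" using cs(2) by (metis length_append_singleton length_Suc_conv_rev nat.inject)
  have "p - q * b - sum_list (map2 (*) ds ps) \<in> Gr {0}"
    using cs(4) ds by (simp add: algebra_simps)
  moreover have "p - q * b \<in> Rees" using cs ds assms subring_props(3,4)[OF Rees_subring] by auto
  ultimately have "p - q * b \<in> lin_ideal ps" using ds cs by (auto simp: lin_ideal_def)
  then show "p \<in> {h + q * b | h b. h \<in> lin_ideal ps \<and> b \<in> Rees}" using cs ds
    by (intro CollectI exI[of _ "p - q * b"] exI[of _ b]) auto
next
  fix p assume "p \<in> {h + q * b | h b. h \<in> lin_ideal ps \<and> b \<in> Rees}"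
  then obtain h b where hb: "p = h + q * b" "h \<in> lin_ideal ps" "b \<in> Rees" by auto
  then obtain ds where ds: "h \<in> Rees" "length ds = length ps" "set ds \<subseteq> Rees" "h - sum_list (map2 (*) ds ps) \<in> Gr {0}"
    by (auto simp: lin_ideal_def)
  have "p \<in> Rees" using hb ds assms subring_props(4,6)[OF Rees_subring] by auto
  then show "p \<in> lin_ideal (ps @ [q])" unfolding lin_ideal_def using ds hb
    by (intro CollectI conjI exI[of _ "ds @ [b]"]) (auto simp: algebra_simps)
qed

lemma gr_regular_seq_dep:
  assumes ys: "gr_regular_seq m F ys"
  shows "R.dep (length ys) (Gr {0})"
proof -
  have "\<forall>y\<in>set ys. gr_elem F y" using ys by (simp add: gr_regular_seq_def)
  then obtain ps where ps: "set ps \<subseteq> Rees" "map coeff ps = ys" using gr_elem_list by blast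
  have psR: "ps ! i \<in> Rees" "set (take i ps) \<subseteq> Rees" if "i < length ps" for i
    using ps(1) that set_take_subset by fastforce+
  have "R.dep k (lin_ideal (take i ps))" if "i + k = length ps" for k i
    using that
  proof (induction k arbitrary: i)
    case (Suc k)
    then have i: "i < length ps" by simp
    have "ps ! i \<in> MR"
    proof -
      have "coeff (ps ! i) \<in> set ys" using ps(2) i by (metis length_map nth_map nth_mem)
      then have "coeff (ps ! i) 0 \<in> m" using ys by (simp add: gr_regular_seq_def)
      then show ?thesis using psR[OF i] by (simp add: MR_def)
    qed
    moreover have "nzd Rees (ps ! i) (lin_ideal (take i ps))"
      unfolding nzd_def
    proof (intro ballI impI)
      fix g assume g: "g \<in> Rees" "ps ! i * g \<in> lin_ideal (take i ps)"
      have pg: "ps ! i * g \<in> Rees" using psR(1)[OF i] g subring_props(4)[OF Rees_subring] by blast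
      have c: "coeff (ps ! i * g) = gr_mult (ys ! i) (coeff g)" unfolding ps(2)[symmetric]
        using i by (auto simp: gr_mult_def coeff_mult)
      have t: "map coeff (take i ps) = take i ys" using ps(2) by (metis take_map)
      have "gr_in_ideal F (take i ys) (gr_mult (ys ! i) (coeff g))"
        using gr_in_ideal_iff[OF pg psR(2)[OF i]] g(2) c t by simp
      then have "gr_in_ideal F (take i ys) (coeff g)"
        using ys gr_elem_Rees[OF g(1)] i ps(2) by (auto simp: gr_regular_seq_def)
      then show "g \<in> lin_ideal (take i ps)" using gr_in_ideal_iff[OF g(1) psR(2)[OF i]] t by simp
    qed
    moreover have "R.dep k (lin_ideal (take (Suc i) ps))" using Suc by simp
    then have "R.dep k (R.ext (lin_ideal (take i ps)) (ps ! i))"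
      using lin_ideal_snoc[OF psR(2)[OF i] psR(1)[OF i]] take_Suc_conv_app_nth[OF i] by (simp add: R.ext_def)
    ultimately show ?case by auto
  qed simp
  from this[of 0 "length ps"] have "R.dep (length ps) (Gr {0})" by (simp add: lin_ideal_Nil)
  moreover have "length ps = length ys" using ps(2) by auto
  ultimately show ?thesis by simp
qed

lemma depth_G_dep:
  assumes "d \<le> depth_G m F"
  shows "R.dep d (Gr {0})"
proof -
  have "1 \<notin> F 1" using F1_sub_m ideal_m by blast
  then have "gr_regular_seq m F []"
    by (auto simp: gr_regular_seq_def gr_in_ideal_def gr_eq_def gr_one_def intro!: exI[of _ 0])
  then obtain k where "k \<ge> d" "\<exists>ys. length ys = k \<and> gr_regular_seq m F ys"
    using le_Greatest_ex[of d "\<lambda>k. \<exists>ys. length ys = k \<and> gr_regular_seq m F ys"] assms by (auto simp: depth_G_def)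
  then show ?thesis using gr_regular_seq_dep R.dep_mono by blast
qed

end

section \<open>Cutting down by a superficial element\<close>

context hilbert_setup
begin

definition hE :: "'a set \<Rightarrow> nat \<Rightarrow> nat" where "hE J n = ell (E J (Suc n)) (E J n)"

text \<open>The coefficient ring stays open: integers for the Hilbert coefficients, rationals for
  \<open>hilbert_series\<close>.\<close>

definition HSE :: "'a set \<Rightarrow> 'c::comm_ring_1 fps" where "HSE J = Abs_fps (\<lambda>n. of_nat (hE J n))"

text \<open>The Valabrega-Valla condition.\<close>
definition VV :: "'a set \<Rightarrow> bool" where
  "VV J \<longleftrightarrow> (\<forall>n. J \<inter> F (Suc n) \<subseteq> ideal_prod J (F n))"

abbreviation add1 :: "'a set \<Rightarrow> 'a \<Rightarrow> 'a set" where
  "add1 J x \<equiv> isum J (xmul x UNIV)"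

lemma add1_superset:
  assumes "is_ideal J"
  shows "J \<subseteq> add1 J x" "x \<in> add1 J x"
proof -
  note s = isum_superset[OF assms is_ideal_xmul[OF is_ideal_UNIV, of x]]
  show "J \<subseteq> add1 J x" by (rule s(1))
  have "x \<in> xmul x UNIV" unfolding xmul_def by (intro CollectI exI[of _ 1]) simp
  then show "x \<in> add1 J x" using s(2) by blast
qed

lemma add1_least: "is_ideal K \<Longrightarrow> J \<subseteq> K \<Longrightarrow> x \<in> K \<Longrightarrow> add1 J x \<subseteq> K"
  by (rule isum_least) (auto simp: xmul_def intro: is_idealD(5))

lemma add1E: "c \<in> add1 J x \<Longrightarrow> (\<And>j g. j \<in> J \<Longrightarrow> c = j + x * g \<Longrightarrow> thesis) \<Longrightarrow> thesis"
  by (auto simp: isum_def xmul_def)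

lemma finlen_E: "is_ideal J \<Longrightarrow> finlen (E J n) UNIV"
  by (rule zero_dim_finlen[OF E_ideal zero_dim_mono[OF zero_dim_F E_superset(1)]])

lemma E_add1:
  assumes J: "is_ideal J"
  shows "E (add1 J x) n = add1 (E J n) x"
proof
  note J' = is_ideal_add[OF J, of x]
  note E' = is_ideal_add[OF E_ideal[OF J, of n], of x]
  show "E (add1 J x) n \<subseteq> add1 (E J n) x" unfolding E_def[of "add1 J x"]
    using E_superset[OF J, of n] add1_superset[OF E_ideal[OF J, of n], of x]
    by (intro isum_least[OF E'] add1_least[OF E']) blast+
  have "E J n \<subseteq> E (add1 J x) n" unfolding E_def using add1_superset[OF J] by (intro isum_mono) auto
  then show "add1 (E J n) x \<subseteq> E (add1 J x) n"
    using E_superset(2)[OF J', of n] add1_superset(2)[OF J, of x] by (intro add1_least E_ideal[OF J']) auto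
qed

context
  fixes J x
  assumes J: "is_ideal J" and x: "x \<in> F 1" and nz: "nzd Rees (monom x 1) (Gr J)"
begin

lemma x_mult_E: "g \<in> E J n \<Longrightarrow> x * g \<in> E J (Suc n)"
  using E_mult[OF J x, of g n] by simp

lemma gr_inj:
  assumes g: "g \<in> E J n" "x * g \<in> E J (Suc (Suc n))"
  shows "g \<in> E J (Suc n)"
proof -
  obtain f j where fj: "f \<in> F n" "j \<in> J" "g = f + j" using g(1) by (auto simp: E_def isum_def)
  have jE: "j \<in> E J k" for k using fj E_superset(2)[OF J] by blast
  have "x * f = x * g - x * j" using fj by (simp add: algebra_simps)
  then have xf: "x * f \<in> E J (Suc (Suc n))"
    using g(2) jE is_idealD(3,4)[OF E_ideal[OF J]] by simp
  have "x * f \<in> F (Suc n)" using F_mult[OF x fj(1)] by simp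
  then have "monom (x * f) (Suc n) \<in> Gr J" using monom_Gr[OF J] xf by blast
  then have "monom x 1 * monom f n \<in> Gr J" by (simp add: mult_monom)
  then have "monom f n \<in> Gr J" using nz monom_Rees[OF fj(1)] by (auto simp: nzd_def)
  then have "f \<in> E J (Suc n)" using monom_Gr[OF J fj(1)] by blast
  then show ?thesis using fj jE is_idealD(2)[OF E_ideal[OF J]] by blast
qed

text \<open>Climb from E_0 = A with \<open>gr_inj\<close>. This is the identity (E_{n+1} : x) = E_n
  on which the cutting down rests.\<close>

lemma gr_descend:
  assumes "x * g \<in> E J (Suc n)"
  shows "g \<in> E J n"
proof -
  have "g \<in> E J k" if "k \<le> n" for k
    using that
  proof (induction k)
    case (Suc k)
    have "x * g \<in> E J (Suc (Suc k))" using assms E_mono[of "Suc (Suc k)" "Suc n" J] Suc.prems by auto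
    then show ?case using gr_inj Suc by simp
  qed (simp add: E_0[OF J])
  then show ?thesis by simp
qed

text \<open>By \<open>gr_descend\<close> the annihilator of x modulo J lies in every E_n, so the
  intersection theorem puts it into J.\<close>

lemma nzd_A: "nzd UNIV x J"
proof -
  have "is_ideal {g. x * g \<in> J}" using is_idealD[OF J]
    by (auto simp: is_ideal_def distrib_left mult.left_commute)
  moreover have "{g. x * g \<in> J} \<subseteq> isum (F n) J" for n
    using gr_descend[of _ n] E_superset(2)[OF J, of "Suc n"] by (auto simp: E_def)
  ultimately have "{g. x * g \<in> J} \<subseteq> J" using krull_intersection[OF J] by blast
  then show ?thesis by (auto simp: nzd_def)
qed

lemma coeff_decompose:
  assumes c: "c \<in> F (Suc n)" "c \<in> E (add1 J x) (Suc (Suc n))"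
  shows "\<exists>f\<in>F n. c - x * f \<in> E J (Suc (Suc n))"
proof -
  note Ei = is_idealD[OF E_ideal[OF J]]
  obtain e g where eg: "e \<in> E J (Suc (Suc n))" "c = e + x * g"
    using c(2) unfolding E_add1[OF J] by (rule add1E)
  have "c \<in> E J (Suc n)" "e \<in> E J (Suc n)" using c(1) eg(1) E_superset(1)[OF J] E_mono[of "Suc n" "Suc (Suc n)" J] by auto
  then have "c - e \<in> E J (Suc n)" by (rule Ei(3))
  then have "g \<in> E J n" using eg(2) gr_descend[of g n] by simp
  then obtain f j where fj: "f \<in> F n" "j \<in> J" "g = f + j" by (auto simp: E_def isum_def)
  have "c - x * f = e + x * j" using eg fj by (simp add: algebra_simps)
  moreover have "e + x * j \<in> E J (Suc (Suc n))" using eg(1) fj(2) E_superset(2)[OF J] Ei(2,4) by blast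
  ultimately have "c - x * f \<in> E J (Suc (Suc n))" by simp
  then show ?thesis using fj(1) by blast
qed

lemma E1_add1: "E (add1 J x) 1 = E J 1"
proof
  have "x \<in> E J 1" using x E_superset(1)[OF J] by blast
  then show "E (add1 J x) 1 \<subseteq> E J 1" unfolding E_add1[OF J] by (intro add1_least E_ideal[OF J]) auto
  show "E J 1 \<subseteq> E (add1 J x) 1" unfolding E_add1[OF J] by (rule add1_superset(1)[OF E_ideal[OF J]])
qed

text \<open>Dividing the graded ring by a regular initial form gives the graded ring of A/(J,x) with
  no correction term, so exchange in the Rees ring can continue with a new J.\<close>

lemma ext_Gr: "R.ext (Gr J) (monom x 1) = Gr (add1 J x)"
proof
  note J' = is_ideal_add[OF J, of x]
  note Ei = is_idealD[OF E_ideal[OF J]]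
  have sub: "E J n \<subseteq> E (add1 J x) n" for n unfolding E_add1[OF J] by (rule add1_superset(1)[OF E_ideal[OF J]])
  have "x \<in> E (add1 J x) (Suc 1)" using add1_superset(2)[OF J] E_superset(2)[OF J'] by blast
  then have "monom x 1 \<in> Gr (add1 J x)" using monom_Gr[OF J' x] by blast
  moreover have "Gr J \<subseteq> Gr (add1 J x)" using sub by (auto simp: Gr_def)
  ultimately show "R.ext (Gr J) (monom x 1) \<subseteq> Gr (add1 J x)"
    using sideal_props(3,5)[OF Gr_sideal[OF J']] by (auto simp: R.ext_def)
  show "Gr (add1 J x) \<subseteq> R.ext (Gr J) (monom x 1)"
  proof
    fix p assume p: "p \<in> Gr (add1 J x)"
    have pR: "p \<in> Rees" using p by (simp add: Gr_def)
    have "\<exists>f\<in>F n. coeff p (Suc n) - x * f \<in> E J (Suc (Suc n))" for n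
      using p by (intro coeff_decompose ReesD[OF pR]) (auto simp: Gr_def)
    then obtain f where f: "\<And>n. f n \<in> F n" "\<And>n. coeff p (Suc n) - x * f n \<in> E J (Suc (Suc n))" by metis
    \<comment> \<open>The chosen f need not have finite support. Cutting at degree p is harmless,
      since p has no coefficients beyond.\<close>
    define q where "q = Abs_poly (\<lambda>i. if i \<le> degree p then f i else 0)"
    have q: "coeff q i = (if i \<le> degree p then f i else 0)" for i
      unfolding q_def coeff_Abs_poly_If_le ..
    have qR: "q \<in> Rees" using f(1) is_idealD(1)[OF F_ideal] by (auto simp: Rees_def q)
    have c: "coeff (p - monom x 1 * q) n \<in> E J (Suc n)" for n
    proof (cases n)
      case 0
      have "coeff p 0 \<in> E J 1" using p E1_add1 by (auto simp: Gr_def)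
      then show ?thesis using 0 by (simp add: coeff_monom_mult)
    next
      case (Suc k)
      show ?thesis
      proof (cases "k \<le> degree p")
        case True
        then show ?thesis using Suc f(2)[of k] by (simp add: coeff_monom_mult q)
      next
        case False
        then have "coeff p (Suc k) = 0" by (intro coeff_eq_0) simp
        then show ?thesis using False Suc Ei by (simp add: coeff_monom_mult q)
      qed
    qed
    have "monom x 1 * q \<in> Rees" using qR monom_Rees[OF x] subring_props(4)[OF Rees_subring] by blast
    then have "p - monom x 1 * q \<in> Gr J" using c pR subring_props(3)[OF Rees_subring] by (auto simp: Gr_def)
    then show "p \<in> R.ext (Gr J) (monom x 1)"
      using qR by (intro R.extI[of q])
  qed
qed

text \<open>For u = v + x*g in F_{n+1}, \<open>gr_descend\<close> gives g = f + j with f in F_n and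
  j in J. Then u - x*f lies in J \<inter> F_{n+1}, where the condition for J applies.\<close>

lemma VV_add1:
  assumes V: "VV J"
  shows "VV (add1 J x)"
  unfolding VV_def
proof (intro allI subsetI)
  note J' = is_ideal_add[OF J, of x]
  fix n u assume u: "u \<in> add1 J x \<inter> F (Suc n)"
  then obtain v g where vg: "v \<in> J" "u = v + x * g" by (blast elim: add1E)
  have "u - v \<in> E J (Suc n)" using u vg E_superset[OF J] is_idealD(3)[OF E_ideal[OF J]] by blast
  then have "g \<in> E J n" using vg(2) gr_descend[of g n] by simp
  then obtain f j where fj: "f \<in> F n" "j \<in> J" "g = f + j" by (auto simp: E_def isum_def)
  have "x * f \<in> F (Suc n)" using F_mult[OF x fj(1)] by simp
  then have "u - x * f \<in> F (Suc n)" using u is_idealD(3)[OF F_ideal] by blast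
  moreover have "u - x * f = v + x * j" using vg fj by (simp add: algebra_simps)
  then have "u - x * f \<in> J" using is_idealD(2)[OF J vg(1) is_idealD(4)[OF J fj(2)]] by simp
  ultimately have "u - x * f \<in> ideal_prod J (F n)" using V by (auto simp: VV_def)
  moreover have "ideal_prod J (F n) \<subseteq> ideal_prod (add1 J x) (F n)"
    using add1_superset(1)[OF J] by (intro ideal_prod_least is_ideal_prod) (auto intro: ideal_prodI)
  moreover have "x * f \<in> ideal_prod (add1 J x) (F n)" using add1_superset(2)[OF J] fj by (auto intro: ideal_prodI)
  ultimately have "(u - x * f) + x * f \<in> ideal_prod (add1 J x) (F n)" using is_idealD(2)[OF is_ideal_prod] by blast
  then show "u \<in> ideal_prod (add1 J x) (F n)" by simp
qed

lemma hE_add1_0: "hE (add1 J x) 0 = hE J 0"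
  using E1_add1 E_0[OF J] E_0[OF is_ideal_add[OF J]] by (simp add: hE_def)

text \<open>The exact sequence of the regular initial form of x from degree n to degree n+1.
  \<open>Mid\<close> is its image: below it \<open>chain_mult_iso\<close> applies, above it the
  second isomorphism theorem.\<close>

lemma hE_add1_Suc: "hE (add1 J x) (Suc n) + hE J n = hE J (Suc n)"
proof -
  note Ei = E_ideal[OF J]
  note Em = is_idealD[OF Ei]
  define Mid where "Mid = isum (E J (Suc (Suc n))) (xmul x (E J n))"
  have Mi: "is_ideal Mid" unfolding Mid_def by (intro is_ideal_isum is_ideal_xmul Ei)
  have sub1: "E J (Suc (Suc n)) \<subseteq> Mid" unfolding Mid_def by (intro isum_superset is_ideal_xmul Ei)
  have sub2: "Mid \<subseteq> E J (Suc n)" unfolding Mid_def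
    using x_mult_E E_mono[of "Suc n" "Suc (Suc n)" J] by (intro isum_least Ei) (auto simp: xmul_def)
  have fin: "finlen (E J (Suc (Suc n))) (E J (Suc n))"
    using finlen_sub(1)[OF finlen_E[OF J] Ei] E_mono[of "Suc n" "Suc (Suc n)" J] by auto
  have "{a \<in> E J n. x * a \<in> E J (Suc (Suc n))} = E J (Suc n)"
    using gr_inj x_mult_E E_mono[of n "Suc n" J] by auto
  then have e1: "ell (E J (Suc n)) (E J n) = ell (E J (Suc (Suc n))) Mid"
    using chain_mult_iso[OF Ei Ei, of n x "Suc (Suc n)"] unfolding Mid_def by (intro ell_cong) simp
  define I where "I = add1 (E J (Suc (Suc n))) x"
  have Ii: "is_ideal I" unfolding I_def by (rule is_ideal_add[OF Ei])
  have "I \<inter> E J (Suc n) = Mid"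
  proof
    show "I \<inter> E J (Suc n) \<subseteq> Mid"
    proof
      fix c assume c: "c \<in> I \<inter> E J (Suc n)"
      then obtain e g where eg: "e \<in> E J (Suc (Suc n))" "c = e + x * g" unfolding I_def by (blast elim: add1E)
      have "e \<in> E J (Suc n)" using eg(1) E_mono[of "Suc n" "Suc (Suc n)" J] by auto
      then have "c - e \<in> E J (Suc n)" using c Em(3)[of c "Suc n" e] by blast
      then have "g \<in> E J n" using eg(2) gr_descend[of g n] by simp
      then show "c \<in> Mid" unfolding Mid_def eg(2) using eg(1) by (intro isumI) (auto simp: xmul_def)
    qed
    have "Mid \<subseteq> I" unfolding Mid_def I_def by (intro isum_mono xmul_mono) auto
    then show "Mid \<subseteq> I \<inter> E J (Suc n)" using sub2 by blast
  qed
  moreover have "isum I (E J (Suc n)) = add1 (E J (Suc n)) x"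
  proof
    note Ai = is_ideal_add[OF Ei[of "Suc n"], of x]
    have "I \<subseteq> add1 (E J (Suc n)) x" unfolding I_def using E_mono[of "Suc n" "Suc (Suc n)" J] by (intro isum_mono) auto
    then show "isum I (E J (Suc n)) \<subseteq> add1 (E J (Suc n)) x"
      using add1_superset(1)[OF Ei] by (intro isum_least Ai) auto
    have "x \<in> I" unfolding I_def by (rule add1_superset(2)[OF Ei])
    then show "add1 (E J (Suc n)) x \<subseteq> isum I (E J (Suc n))"
      using isum_superset[OF Ii Ei] by (intro add1_least is_ideal_isum Ii Ei) auto
  qed
  ultimately have "has_ideal_chain Mid (E J (Suc n)) = has_ideal_chain I (add1 (E J (Suc n)) x)"
    using chain_second_iso[OF Ii Ei, of "Suc n"] by simp
  then have e2: "ell Mid (E J (Suc n)) = hE (add1 J x) (Suc n)"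
    unfolding hE_def E_add1[OF J] I_def by (rule ell_cong)
  show ?thesis using ell_split[OF fin Mi sub1 sub2] e1 e2 by (simp add: hE_def)
qed

lemma HSE_add1: "HSE (add1 J x) = (1 - fps_X) * (HSE J :: 'c::comm_ring_1 fps)"
proof (rule fps_ext)
  fix n
  show "(HSE (add1 J x) :: 'c fps) $ n = ((1 - fps_X) * HSE J) $ n"
  proof (cases n)
    case 0
    then show ?thesis by (simp add: fps_one_minus_X_mult_nth HSE_def hE_add1_0)
  next
    case (Suc k)
    have "(of_nat (hE J (Suc k)) :: 'c) = of_nat (hE (add1 J x) (Suc k)) + of_nat (hE J k)"
      by (simp flip: hE_add1_Suc)
    then show ?thesis using Suc by (simp add: fps_one_minus_X_mult_nth HSE_def)
  qed
qed

end

text \<open>P has height at least k.\<close>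

definition prime_chain_to :: "nat \<Rightarrow> 'a set \<Rightarrow> bool" where
  "prime_chain_to k P \<longleftrightarrow> (\<exists>C. (\<forall>i\<le>k. prime_ideal (C i)) \<and> (\<forall>i<k. C i \<subset> C (Suc i)) \<and> C k = P)"

lemma prime_chain_to_Suc:
  assumes "prime_chain_to k P'" "prime_ideal P" "P' \<subset> P"
  shows "prime_chain_to (Suc k) P"
proof -
  obtain C where C: "\<forall>i\<le>k. prime_ideal (C i)" "\<forall>i<k. C i \<subset> C (Suc i)" "C k = P'"
    using assms by (auto simp: prime_chain_to_def)
  show ?thesis unfolding prime_chain_to_def using C assms
    by (intro exI[of _ "\<lambda>i. if i \<le> k then C i else P"]) (auto simp: le_Suc_eq less_Suc_eq)
qed

text \<open>By \<open>smaller_prime\<close>, P is not minimal over J, so the height bound valid over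
  J grows by one.\<close>

lemma prime_chain_to_nzd:
  assumes J: "is_ideal J" and x: "nzd UNIV x J"
    and pc: "\<And>P. prime_ideal P \<Longrightarrow> J \<subseteq> P \<Longrightarrow> prime_chain_to k P"
    and P: "prime_ideal P" "add1 J x \<subseteq> P"
  shows "prime_chain_to (Suc k) P"
proof -
  have "J \<subseteq> P" "x \<in> P" using P add1_superset[OF J, of x] by auto
  then obtain P' where "prime_ideal P'" "J \<subseteq> P'" "P' \<subset> P" using smaller_prime[OF J P(1) _ _ x] by blast
  then show ?thesis using prime_chain_to_Suc pc P by blast
qed

text \<open>Each invariant has its own use: \<open>R.dep\<close> supplies the next element,
  \<open>A.dep\<close> leaves depth one for the last choice, \<open>VV\<close> lifts equalities from
  A/J to A, the prime chains control the dimension, and the two series identities recover the length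
  data of F.\<close>

lemma superficial_sequence:
  assumes G: "R.dep k (Gr {0})" and A: "A.dep (Suc k) {0}" and j: "j \<le> k"
  shows "\<exists>xs J. length xs = j \<and> set xs \<subseteq> F 1 \<and> J = ideal_gen (set xs) \<and> R.dep (k - j) (Gr J) \<and>
    A.dep (Suc k - j) J \<and> VV J \<and> (\<forall>P. prime_ideal P \<longrightarrow> J \<subseteq> P \<longrightarrow> prime_chain_to j P) \<and>
    HSE J = (1 - fps_X) ^ j * (HSE {0} :: int fps) \<and> HSE J = (1 - fps_X) ^ j * (HSE {0} :: rat fps)"
  using j
proof (induction j)
  case 0
  have "VV {0}" using is_idealD(1)[OF is_ideal_prod] by (auto simp: VV_def)
  moreover have "prime_chain_to 0 P" if "prime_ideal P" for P
    unfolding prime_chain_to_def using that by (intro exI[of _ "\<lambda>_. P"]) auto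
  ultimately show ?case using G A by (intro exI[of _ "[]"] exI[of _ "{0}"]) (auto simp: ideal_gen_empty)
next
  case (Suc j)
  from Suc.IH[OF Suc_leD[OF Suc.prems]] obtain xs J where IH: "length xs = j" "set xs \<subseteq> F 1" "J = ideal_gen (set xs)" "R.dep (k - j) (Gr J)"
    "A.dep (Suc k - j) J" "VV J" "\<And>P. prime_ideal P \<Longrightarrow> J \<subseteq> P \<Longrightarrow> prime_chain_to j P"
    "HSE J = (1 - fps_X) ^ j * (HSE {0} :: int fps)" "HSE J = (1 - fps_X) ^ j * (HSE {0} :: rat fps)"
    by blast
  have J: "is_ideal J" using IH is_ideal_gen by simp
  obtain l where l: "k - j = Suc l" "k - Suc j = l" "Suc k - j = Suc (Suc l)" "Suc k - Suc j = Suc l"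
    using Suc.prems by (metis Suc_diff_Suc Suc_diff_le Suc_le_lessD Suc_leD diff_Suc_Suc)
  obtain x where x: "x \<in> F 1" "nzd Rees (monom x 1) (Gr J)" using dep_choose[OF J] IH(4) l by metis
  note nA = nzd_A[OF J x]
  have mx: "monom x 1 \<in> MR" using x(1) monom_Rees[OF x(1)] is_idealD(1)[OF ideal_m(1)] by (simp add: MR_def)
  have 1: "R.dep l (Gr (add1 J x))"
    using R.dep_exchange[OF Gr_sideal[OF J] _ mx x(2), of l] IH(4) l ext_Gr[OF J x] by simp
  have "sideal UNIV J" using J by (simp add: sideal_UNIV)
  then have 2: "A.dep (Suc l) (add1 J x)"
    using A.dep_exchange[OF _ _ _ nA, of "Suc l"] IH(5) l x F1_sub_m by (auto simp: A_ext)
  have 3: "add1 J x = ideal_gen (set (x # xs))" unfolding IH(3) by (simp add: ideal_gen_insert)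
  have 4: "prime_chain_to (Suc j) P" if "prime_ideal P" "add1 J x \<subseteq> P" for P
    using prime_chain_to_nzd[OF J nA IH(7) that] by blast
  have "HSE (add1 J x) = (1 - fps_X) ^ Suc j * (HSE {0} :: int fps)"
    "HSE (add1 J x) = (1 - fps_X) ^ Suc j * (HSE {0} :: rat fps)"
    unfolding HSE_add1[OF J x] IH(8,9) by (simp_all add: mult.assoc)
  then show ?case using 1 2 3 4 VV_add1[OF J x IH(6)] IH(1,2) x(1) l
    by (intro exI[of _ "x # xs"] exI[of _ "add1 J x"]) auto
qed

end

section \<open>The one-dimensional case\<close>

context hilbert_setup
begin

text \<open>The preimage of the elements of the graded ring of A/J killed by all high degrees (local
  cohomology in degree zero). Modulo these, a regular element of degree one exists even if the
  graded ring has depth 0.\<close>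

definition Gr_sat :: "'a set \<Rightarrow> 'a poly set" where
  "Gr_sat J = {p \<in> Rees. \<exists>L. \<forall>n\<ge>L. \<forall>c\<in>F n. monom c n * p \<in> Gr J}"

lemma Gr_sat_sideal:
  assumes J: "is_ideal J"
  shows "sideal Rees (Gr_sat J)"
  unfolding sideal_def
proof (intro conjI ballI)
  note Gp = sideal_props[OF Gr_sideal[OF J]] and Rp = subring_props[OF Rees_subring]
  show "Gr_sat J \<subseteq> Rees" by (auto simp: Gr_sat_def)
  show "0 \<in> Gr_sat J" using Gp(2) Rp(2) by (simp add: Gr_sat_def)
  fix p q
  show "p + q \<in> Gr_sat J" if pq: "p \<in> Gr_sat J" "q \<in> Gr_sat J"
  proof -
    obtain L where L: "p \<in> Rees" "\<And>n c. n \<ge> L \<Longrightarrow> c \<in> F n \<Longrightarrow> monom c n * p \<in> Gr J" using pq(1) by (auto simp: Gr_sat_def)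
    obtain K where K: "q \<in> Rees" "\<And>n c. n \<ge> K \<Longrightarrow> c \<in> F n \<Longrightarrow> monom c n * q \<in> Gr J" using pq(2) by (auto simp: Gr_sat_def)
    have "monom c n * (p + q) \<in> Gr J" if "n \<ge> max L K" "c \<in> F n" for n c
      using L(2)[of n c] K(2)[of n c] that Gp(3) by (simp add: distrib_left)
    then show ?thesis using L(1) K(1) Rp(6) unfolding Gr_sat_def by blast
  qed
  show "p * q \<in> Gr_sat J" if pq: "p \<in> Rees" "q \<in> Gr_sat J"
  proof -
    obtain K where K: "q \<in> Rees" "\<And>n c. n \<ge> K \<Longrightarrow> c \<in> F n \<Longrightarrow> monom c n * q \<in> Gr J" using pq(2) by (auto simp: Gr_sat_def)
    have "monom c n * (p * q) \<in> Gr J" if "n \<ge> K" "c \<in> F n" for n c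
      using Gp(4)[OF pq(1) K(2)[OF that]] by (simp add: mult.left_commute)
    then show ?thesis using pq(1) K(1) Rp(4) unfolding Gr_sat_def by blast
  qed
qed

lemma Gr_sub_sat: "is_ideal J \<Longrightarrow> Gr J \<subseteq> Gr_sat J"
  using sideal_props(1,4)[OF Gr_sideal] monom_Rees unfolding Gr_sat_def by blast

lemma monom_colon_ideal:
  assumes I: "sideal Rees I"
  shows "is_ideal {c. monom c n * a \<in> I}"
  unfolding is_ideal_def
proof (intro conjI ballI allI impI)
  show "0 \<in> {c. monom c n * a \<in> I}" using sideal_props(2)[OF I] by simp
  show "x + y \<in> {c. monom c n * a \<in> I}" if "x \<in> {c. monom c n * a \<in> I}" "y \<in> {c. monom c n * a \<in> I}" for x y
    using sideal_props(3)[OF I, of "monom x n * a" "monom y n * a"] that by (simp add: distrib_right flip: add_monom)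
  show "b * x \<in> {c. monom c n * a \<in> I}" if "x \<in> {c. monom c n * a \<in> I}" for b x
    using sideal_props(4)[OF I const_Rees[of b], of "monom x n * a"] that by (simp flip: smult_monom)
qed

text \<open>Each b in F_1 comes with its own bound L. The ascending ideals W L stabilise, which
  makes the bound uniform, and F_{k+1} = F_1 F_k then absorbs b.\<close>

lemma Gr_sat_colon:
  assumes J: "is_ideal J" and a: "a \<in> Rees" and h: "\<And>b. b \<in> F 1 \<Longrightarrow> monom b 1 * a \<in> Gr_sat J"
  shows "a \<in> Gr_sat J"
proof -
  define W where "W L = {b. \<forall>n\<ge>L. \<forall>c\<in>F n. monom b 1 * (monom c n * a) \<in> Gr J}" for L
  have "sideal UNIV (W L)" for L
  proof -
    have "W L = (\<Inter>n\<in>{L..}. \<Inter>c\<in>F n. {b. monom b 1 * (monom c n * a) \<in> Gr J})" by (auto simp: W_def)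
    moreover have "is_ideal (\<Inter>n\<in>{L..}. \<Inter>c\<in>F n. {b. monom b 1 * (monom c n * a) \<in> Gr J})"
      using is_idealD(1,2,4)[OF monom_colon_ideal[OF Gr_sideal[OF J]]] by (auto simp: is_ideal_def)
    ultimately show ?thesis by (simp add: sideal_UNIV)
  qed
  moreover have "W L \<subseteq> W (Suc L)" for L by (auto simp: W_def)
  ultimately obtain L where L: "\<And>k. k \<ge> L \<Longrightarrow> W k = W L" using A.chain_stable[of W] by blast
  have FW: "b \<in> W L" if b: "b \<in> F 1" for b
  proof -
    obtain K where K: "\<And>n c. n \<ge> K \<Longrightarrow> c \<in> F n \<Longrightarrow> monom c n * (monom b 1 * a) \<in> Gr J"
      using h[OF b] by (auto simp: Gr_sat_def)
    then have "b \<in> W (max K L)" by (auto simp: W_def mult.left_commute)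
    then show ?thesis using L[of "max K L"] by simp
  qed
  have "monom c n * a \<in> Gr J" if n: "n \<ge> Suc (max L N0)" and c: "c \<in> F n" for n c
  proof -
    obtain k where k: "n = Suc k" "k \<ge> L" "k \<ge> N0" using n by (cases n) auto
    have "ideal_prod (F 1) (F k) \<subseteq> {c. monom c n * a \<in> Gr J}"
    proof (rule ideal_prod_least[OF monom_colon_ideal[OF Gr_sideal[OF J]]])
      fix b c assume "b \<in> F 1" "c \<in> F k"
      then have "monom b 1 * (monom c k * a) \<in> Gr J" using FW[of b] k by (auto simp: W_def)
      then show "b * c \<in> {c. monom c n * a \<in> Gr J}" using k by (simp add: mult_monom flip: mult.assoc)
    qed
    then show ?thesis using F_stable[OF k(3)] k(1) c by auto
  qed
  then show ?thesis using a unfolding Gr_sat_def by blast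
qed

text \<open>\<open>Gr_sat_colon\<close> handles the primes of \<open>Gr_sat J\<close>; a prime of
  \<open>ass J\<close> containing F_1 would contain the regular element z. Regularity modulo J is
  imposed separately, as \<open>nzd_A\<close> would need regularity modulo
  \<open>Gr J\<close>.\<close>

lemma choose_last:
  assumes J: "is_ideal J" and d: "A.dep (Suc 0) J"
  shows "\<exists>x\<in>F 1. nzd UNIV x J \<and> nzd Rees (monom x 1) (Gr_sat J)"
proof -
  obtain z where z: "z \<in> m" "nzd UNIV z J" using d by auto
  have J': "sideal UNIV J" using J by (simp add: sideal_UNIV)
  have "\<exists>x\<in>F 1. (\<forall>N\<in>A.ass J. x \<notin> N) \<and> nzd Rees (monom x 1) (Gr_sat J)"
  proof (rule choose_superficial[OF Gr_sat_sideal[OF J]])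
    show "\<exists>c\<in>F 1. monom c 1 \<notin> P" if P: "P \<in> R.ass (Gr_sat J)" for P
    proof (rule ccontr)
      assume n: "\<not> ?thesis"
      obtain a where a: "a \<in> Rees" "a \<notin> Gr_sat J" "P = colon Rees (Gr_sat J) a"
        by (rule R.assE[OF Gr_sat_sideal[OF J] P]) metis
      then have "monom b 1 * a \<in> Gr_sat J" if "b \<in> F 1" for b using n that by (auto simp: colon_def)
      then show False using Gr_sat_colon[OF J a(1)] a(2) by blast
    qed
    show "finite (A.ass J)" by (rule A.finite_ass[OF J'])
    fix P assume P: "P \<in> A.ass J"
    have pr: "prime_ideal P" by (rule ass_prime[OF J P])
    then show "is_ideal P" by (simp add: prime_ideal_def)
    obtain a where a: "a \<notin> J" "P = colon UNIV J a" by (rule A.assE[OF J' P]) metis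
    show "\<not> F 1 \<subseteq> P"
    proof
      assume "F 1 \<subseteq> P"
      then have "z \<in> P" using m_power[OF z(1)] prime_power[OF pr] by blast
      then show False using a z(2) by (auto simp: colon_def nzd_def)
    qed
  qed
  then obtain x where x: "x \<in> F 1" "\<And>N. N \<in> A.ass J \<Longrightarrow> x \<notin> N" "nzd Rees (monom x 1) (Gr_sat J)" by blast
  have "nzd UNIV x J" unfolding nzd_def using A.zero_divisor_in_ass[OF J', of _ x] x(2) by blast
  then show ?thesis using x by blast
qed

lemma F_prod: "n \<ge> N0 \<Longrightarrow> F (l + n) \<subseteq> ideal_prod (F l) (F n)"
proof (induction l)
  case 0
  then show ?case using ideal_prodI[of 1 "F 0" _ "F n"] by (auto simp: F_0)
next
  case (Suc l)
  have "ideal_prod (F 1) (F (l + n)) \<subseteq> ideal_prod (F (Suc l)) (F n)"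
  proof (rule ideal_prod_least[OF is_ideal_prod])
    fix b y assume b: "b \<in> F 1" and y: "y \<in> F (l + n)"
    note Pd = is_idealD[OF is_ideal_prod[of "F (Suc l)" "F n"]]
    have "ideal_prod (F l) (F n) \<subseteq> {y. b * y \<in> ideal_prod (F (Suc l)) (F n)}"
    proof (rule ideal_prod_least)
      show "is_ideal {y. b * y \<in> ideal_prod (F (Suc l)) (F n)}"
        using Pd(1,2,4) by (auto simp: is_ideal_def distrib_left mult.left_commute)
      fix u v assume "u \<in> F l" "v \<in> F n"
      then have "(b * u) * v \<in> ideal_prod (F (Suc l)) (F n)" using F_mult[OF b, of u l] by (intro ideal_prodI) auto
      then show "u * v \<in> {y. b * y \<in> ideal_prod (F (Suc l)) (F n)}" by (simp add: mult.assoc)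
    qed
    then show "b * y \<in> ideal_prod (F (Suc l)) (F n)" using y Suc by blast
  qed
  then show ?case using F_stable[of "l + n"] Suc.prems by simp
qed

context
  fixes J x
  assumes J: "is_ideal J" and x: "x \<in> F 1" and nA: "nzd UNIV x J" and nG: "nzd Rees (monom x 1) (Gr_sat J)"
    and zd: "zero_dim (add1 J x)"
begin

definition xE :: "nat \<Rightarrow> 'a set" where "xE n = isum J (xmul x (E J n))"

text \<open>The length of B/xB, identified with e_0 at the end.\<close>

definition mult_e :: nat where "mult_e = ell (add1 J x) UNIV"

definition vv :: "nat \<Rightarrow> nat" where "vv n = ell (xE n) (E J (Suc n))"

lemma xE_ideal: "is_ideal (xE n)"
  unfolding xE_def by (intro is_ideal_isum is_ideal_xmul J E_ideal[OF J])

lemma x_mult_E': "g \<in> E J n \<Longrightarrow> x * g \<in> E J (Suc n)"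
  using E_mult[OF J x, of g n] by simp

lemma xE_sub: "xE n \<subseteq> E J (Suc n)"
  unfolding xE_def using x_mult_E' E_superset(2)[OF J] by (intro isum_least E_ideal[OF J]) (auto simp: xmul_def)

lemma xE_E: "xE n \<subseteq> E J n"
  using xE_sub[of n] E_mono[of n "Suc n" J] by auto

text \<open>Compare the two routes from xE_n to B, through xB and through E_n. As x is regular,
  xB/xE_n is isomorphic to B/E_n, and these lengths cancel.\<close>

lemma xE_ell: "finlen (xE n) UNIV" "ell (xE n) (E J n) = mult_e"
proof -
  have eq: "{a \<in> UNIV. x * a \<in> xE n} = E J n"
  proof
    show "{a \<in> UNIV. x * a \<in> xE n} \<subseteq> E J n"
    proof
      fix a assume "a \<in> {a \<in> UNIV. x * a \<in> xE n}"
      then obtain j b where jb: "j \<in> J" "b \<in> E J n" "x * a = j + x * b" by (auto simp: xE_def isum_def xmul_def)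
      then have "x * (a - b) \<in> J" by (simp add: algebra_simps)
      then have "a - b \<in> J" using nA by (auto simp: nzd_def)
      then have "a - b \<in> E J n" using E_superset(2)[OF J] by blast
      then have "a - b + b \<in> E J n" using jb(2) is_idealD(2)[OF E_ideal[OF J]] by blast
      then show "a \<in> E J n" by simp
    qed
    show "E J n \<subseteq> {a \<in> UNIV. x * a \<in> xE n}"
      using isum_superset(2)[OF J is_ideal_xmul[OF E_ideal[OF J, of n], of x]] by (auto simp: xE_def xmul_def)
  qed
  have "isum (xE n) (xmul x UNIV) = add1 J x"
  proof
    note A1 = is_ideal_add[OF J, of x]
    have "xE n \<subseteq> add1 J x" unfolding xE_def by (intro isum_mono xmul_mono) auto
    then show "isum (xE n) (xmul x UNIV) \<subseteq> add1 J x" using add1_superset(2)[OF J] by (intro add1_least A1) auto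
    have "J \<subseteq> xE n" unfolding xE_def by (intro isum_superset J is_ideal_xmul E_ideal)
    then show "add1 J x \<subseteq> isum (xE n) (xmul x UNIV)" by (intro isum_mono) auto
  qed
  then have ch: "has_ideal_chain (E J n) UNIV = has_ideal_chain (xE n) (add1 J x)"
    using chain_mult_iso[OF is_ideal_UNIV xE_ideal, of x n] eq by simp
  have f1: "finlen (xE n) (add1 J x)" using finlen_cong[OF ch[symmetric] finlen_E[OF J]] .
  have f2: "finlen (add1 J x) UNIV" by (rule zero_dim_finlen[OF is_ideal_add[OF J] zd])
  show fin: "finlen (xE n) UNIV" by (rule ell_add(1)[OF f1 f2])
  have "ell (xE n) UNIV = ell (E J n) UNIV + mult_e" using ell_add(2)[OF f1 f2] ell_cong[OF ch] by (simp add: mult_e_def)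
  moreover have "ell (xE n) UNIV = ell (xE n) (E J n) + ell (E J n) UNIV"
    by (rule ell_split[OF fin E_ideal[OF J] xE_E]) auto
  ultimately show "ell (xE n) (E J n) = mult_e" by simp
qed

lemma finlen_vv: "finlen (xE n) (E J (Suc n))"
  by (rule finlen_sub(1)[OF xE_ell(1) E_ideal[OF J] xE_sub]) auto

lemma hE_vv: "vv n + hE J n = mult_e"
proof -
  have "finlen (xE n) (E J n)" by (rule finlen_sub(1)[OF xE_ell(1) E_ideal[OF J] xE_E]) auto
  from ell_split[OF this E_ideal[OF J] xE_sub] show ?thesis
    using xE_ell(2)[of n] E_mono[of n "Suc n" J] by (simp add: vv_def hE_def)
qed

text \<open>F_n/\<open>Zn n\<close> is the degree n part of the graded ring of B modulo its
  torsion.\<close>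

definition Zn :: "nat \<Rightarrow> 'a set" where "Zn n = {a \<in> F n. monom a n \<in> Gr_sat J}"

lemma Zn_ideal: "is_ideal (Zn n)"
proof -
  have "is_ideal {a. monom a n \<in> Gr_sat J}"
    using const_Rees by (intro monom_ideal[OF Rees_subring _ Gr_sat_sideal[OF J]]) auto
  from is_ideal_Int[OF F_ideal this] show ?thesis by (simp add: Zn_def Int_def)
qed

lemma Zn_superset: "E J (Suc n) \<inter> F n \<subseteq> Zn n"
  using monom_Gr[OF J] Gr_sub_sat[OF J] by (auto simp: Zn_def)

lemma Zn_sub: "Zn n \<subseteq> F n" by (auto simp: Zn_def)

lemma finlen_Zn: "finlen (Zn n) (F n)"
proof -
  have "F (Suc n) \<subseteq> Zn n" using Zn_superset E_superset(1)[OF J, of "Suc n"] F_Suc[of n] by blast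
  then have "finlen (Zn n) UNIV" using finlen_sub(2)[OF zero_dim_finlen[OF F_ideal zero_dim_F[of "Suc n"]] Zn_ideal] by auto
  then show ?thesis using finlen_sub(1)[OF _ F_ideal Zn_sub] by auto
qed

text \<open>Multiplication by x is injective from F_n/\<open>Zn n\<close> into the next degree;
  equal lengths make it onto as well.\<close>

lemma Zn_step:
  "ell (Zn n) (F n) \<le> ell (Zn (Suc n)) (F (Suc n))"
  "ell (Zn n) (F n) = ell (Zn (Suc n)) (F (Suc n)) \<Longrightarrow> F (Suc n) = isum (Zn (Suc n)) (xmul x (F n))"
proof -
  define Mid where "Mid = isum (Zn (Suc n)) (xmul x (F n))"
  have xF: "x * a \<in> F (Suc n)" if "a \<in> F n" for a using F_mult[OF x that] by simp
  have xm: "monom (x * a) (Suc n) = monom x 1 * monom a n" for a by (simp add: mult_monom)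
  have "{a \<in> F n. x * a \<in> Zn (Suc n)} = Zn n"
  proof
    show "{a \<in> F n. x * a \<in> Zn (Suc n)} \<subseteq> Zn n"
      using nG monom_Rees by (auto simp: Zn_def xm nzd_def)
    show "Zn n \<subseteq> {a \<in> F n. x * a \<in> Zn (Suc n)}"
      using sideal_props(4)[OF Gr_sat_sideal[OF J] monom_Rees[OF x]] xF by (auto simp: Zn_def xm)
  qed
  then have e: "ell (Zn n) (F n) = ell (Zn (Suc n)) Mid"
    using chain_mult_iso[OF F_ideal[of n] Zn_ideal[of "Suc n"], of x] unfolding Mid_def by (intro ell_cong) simp
  have M: "is_ideal Mid" "Zn (Suc n) \<subseteq> Mid" unfolding Mid_def
    by (intro is_ideal_isum isum_superset is_ideal_xmul Zn_ideal F_ideal)+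
  have MF: "Mid \<subseteq> F (Suc n)" unfolding Mid_def using Zn_sub xF by (intro isum_least F_ideal) (auto simp: xmul_def)
  note s = ell_split[OF finlen_Zn M MF]
  then show "ell (Zn n) (F n) \<le> ell (Zn (Suc n)) (F (Suc n))" using e by simp
  assume "ell (Zn n) (F n) = ell (Zn (Suc n)) (F (Suc n))"
  then have "ell Mid (F (Suc n)) = 0" using s e by simp
  then show "F (Suc n) = isum (Zn (Suc n)) (xmul x (F n))"
    using ell_0[OF finlen_sub(2)[OF finlen_Zn M MF]] unfolding Mid_def by simp
qed

text \<open>F_n/\<open>Zn n\<close> is a quotient of E_n/E_{n+1}, whose length is at most
  \<open>mult_e\<close> by \<open>hE_vv\<close>.\<close>

lemma Zn_bound: "ell (Zn n) (F n) \<le> mult_e"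
proof -
  have "isum (E J (Suc n)) (F n) = E J n"
  proof
    show "isum (E J (Suc n)) (F n) \<subseteq> E J n"
      using E_mono[of n "Suc n" J] E_superset(1)[OF J] by (intro isum_least E_ideal[OF J]) auto
    have "F n \<subseteq> isum (E J (Suc n)) (F n)" by (intro isum_superset E_ideal[OF J] F_ideal)
    moreover have "J \<subseteq> isum (E J (Suc n)) (F n)"
      using isum_superset(1)[OF E_ideal[OF J] F_ideal] E_superset(2)[OF J] by blast
    ultimately show "E J n \<subseteq> isum (E J (Suc n)) (F n)" unfolding E_def[of J n]
      by (intro isum_least is_ideal_isum E_ideal[OF J] F_ideal)
  qed
  then have ch: "has_ideal_chain (E J (Suc n) \<inter> F n) (F n) = has_ideal_chain (E J (Suc n)) (E J n)"
    using chain_second_iso[OF E_ideal[OF J] F_ideal, of "Suc n" n] by simp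
  have "finlen (E J (Suc n)) (E J n)"
    using finlen_sub(1)[OF finlen_E[OF J] E_ideal[OF J]] E_mono[of n "Suc n" J] by auto
  from ell_split[OF finlen_cong[OF ch this] Zn_ideal Zn_superset Zn_sub]
  have "ell (Zn n) (F n) \<le> hE J n" using ell_cong[OF ch] by (simp add: hE_def)
  then show ?thesis using hE_vv[of n] by simp
qed

text \<open>Otherwise the lengths would grow strictly from N0 on and pass the bound of
  \<open>Zn_bound\<close>.\<close>

lemma Zn_stationary: "\<exists>n\<ge>N0. F (Suc n) = isum (Zn (Suc n)) (xmul x (F n))"
proof (rule ccontr)
  assume n: "\<not> ?thesis"
  have "k \<le> ell (Zn (N0 + k)) (F (N0 + k))" for k
  proof (induction k)
    case (Suc k)
    have "ell (Zn (N0 + k)) (F (N0 + k)) \<noteq> ell (Zn (Suc (N0 + k))) (F (Suc (N0 + k)))"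
      using n Zn_step(2)[of "N0 + k"] by auto
    then show ?case using Suc Zn_step(1)[of "N0 + k"] by simp
  qed simp
  from this[of "Suc mult_e"] Zn_bound[of "N0 + Suc mult_e"] show False by simp
qed

text \<open>As in \<open>Gr_sat_colon\<close>, an ascending chain turns the individual bounds into
  one L for the whole of \<open>Zn n\<close>.\<close>

lemma Zn_killed: "\<exists>L. \<forall>a\<in>Zn n. \<forall>c\<in>F L. c * a \<in> E J (Suc (L + n))"
proof -
  define W where "W L = {a. \<forall>k\<ge>L. \<forall>c\<in>F k. c * a \<in> E J (Suc (k + n))}" for L
  have "sideal UNIV (W L)" for L
    using is_idealD(1,2,4)[OF E_ideal[OF J]] by (auto simp: sideal_UNIV is_ideal_def W_def distrib_left mult.left_commute)
  moreover have "W L \<subseteq> W (Suc L)" for L by (auto simp: W_def)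
  ultimately obtain L where L: "\<And>k. k \<ge> L \<Longrightarrow> W k = W L" using A.chain_stable[of W] by blast
  have "a \<in> W L" if a: "a \<in> Zn n" for a
  proof -
    obtain K where K: "\<And>k c. k \<ge> K \<Longrightarrow> c \<in> F k \<Longrightarrow> monom c k * monom a n \<in> Gr J"
      using a by (auto simp: Zn_def Gr_sat_def)
    have "c * a \<in> E J (Suc (k + n))" if kc: "k \<ge> K" "c \<in> F k" for k c
    proof -
      have "c * a \<in> F (k + n)" using F_mult[OF kc(2)] a by (auto simp: Zn_def)
      then show ?thesis using K[OF kc] monom_Gr[OF J] by (auto simp: mult_monom)
    qed
    then have "a \<in> W (max K L)" by (auto simp: W_def)
    then show ?thesis using L[of "max K L"] by simp
  qed
  then show ?thesis by (intro exI[of _ L]) (auto simp: W_def)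
qed

text \<open>Multiplying F_{n+1} = Zn + x F_n by F_L kills the torsion part modulo E_{K+2}, so
  F_{K+1} lies in E_{K+2} + x E_K + J. Nakayama removes the first summand.\<close>

lemma F_sub_xE: "\<exists>K. \<forall>k\<ge>K. F (Suc k) \<subseteq> xE k"
proof -
  note Ei = is_idealD[OF E_ideal[OF J]]
  obtain n where n: "n \<ge> N0" "F (Suc n) = isum (Zn (Suc n)) (xmul x (F n))" using Zn_stationary by blast
  obtain L where L: "\<And>a c. a \<in> Zn (Suc n) \<Longrightarrow> c \<in> F L \<Longrightarrow> c * a \<in> E J (Suc (L + Suc n))" using Zn_killed[of "Suc n"] by blast
  \<comment> \<open>The product of F_L and F_{n+1} sits in degree K + 1.\<close>
  define K where "K = L + n"
  have xEx: "x * g \<in> xE k" if "g \<in> E J k" for g k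
    using isum_superset(2)[OF J is_ideal_xmul[OF E_ideal[OF J, of k], of x]] that by (auto simp: xE_def xmul_def)
  have JxE: "J \<subseteq> xE k" for k unfolding xE_def by (intro isum_superset J is_ideal_xmul E_ideal)
  define S where "S = isum (E J (Suc (Suc K))) (xE K)"
  have S: "is_ideal S" "E J (Suc (Suc K)) \<subseteq> S" "xE K \<subseteq> S" unfolding S_def
    by (intro is_ideal_isum isum_superset E_ideal[OF J] xE_ideal)+
  have "F (Suc K) \<subseteq> ideal_prod (F L) (F (Suc n))" using F_prod[of "Suc n" L] n(1) by (simp add: K_def)
  also have "\<dots> \<subseteq> S"
  proof (rule ideal_prod_least[OF S(1)])
    fix c u assume c: "c \<in> F L" and "u \<in> F (Suc n)"
    then obtain z g where zg: "z \<in> Zn (Suc n)" "g \<in> F n" "u = z + x * g" using n(2) by (auto simp: isum_def xmul_def)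
    have "c * z \<in> S" using L[OF zg(1) c] S(2) by (auto simp: K_def)
    moreover have "c * g \<in> E J K" using F_mult[OF c zg(2)] E_superset(1)[OF J] by (auto simp: K_def)
    then have "x * (c * g) \<in> S" using xEx S(3) by blast
    ultimately have "c * z + x * (c * g) \<in> S" using is_idealD(2)[OF S(1)] by blast
    then show "c * u \<in> S" using zg(3) by (simp add: algebra_simps)
  qed
  finally have FS: "F (Suc K) \<subseteq> S" .
  have base: "F (Suc K) \<subseteq> xE K"
  proof (rule nakayama[OF F_ideal xE_ideal])
    fix T assume T: "is_ideal T" "xE K \<subseteq> T" "\<And>c a. c \<in> m \<Longrightarrow> a \<in> F (Suc K) \<Longrightarrow> c * a \<in> T"
    have "ideal_prod (F 1) (F (Suc K)) \<subseteq> T" using T(3) F1_sub_m by (intro ideal_prod_least T(1)) blast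
    then have "F (Suc (Suc K)) \<subseteq> T" using F_stable[of "Suc K"] n(1) by (simp add: K_def)
    then have "E J (Suc (Suc K)) \<subseteq> T" unfolding E_def using JxE[of K] T(2) by (intro isum_least T(1)) auto
    then have "S \<subseteq> T" unfolding S_def by (intro isum_least T)
    then show "F (Suc K) \<subseteq> T" using FS by blast
  qed
  \<comment> \<open>Multiplying by F_1 carries the inclusion from one degree to the next.\<close>
  have "F (Suc (K + i)) \<subseteq> xE (K + i)" for i
  proof (induction i)
    case (Suc i)
    have "ideal_prod (F 1) (F (Suc (K + i))) \<subseteq> xE (Suc (K + i))"
    proof (rule ideal_prod_least[OF xE_ideal])
      fix b u assume b: "b \<in> F 1" and "u \<in> F (Suc (K + i))"
      then obtain j g where jg: "j \<in> J" "g \<in> E J (K + i)" "u = j + x * g" using Suc by (auto simp: xE_def isum_def xmul_def)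
      have "b * g \<in> E J (Suc (K + i))" using E_mult[OF J b jg(2)] by simp
      then have "b * j + x * (b * g) \<in> xE (Suc (K + i))"
        using xEx JxE is_idealD(4)[OF J jg(1)] is_idealD(2)[OF xE_ideal] by blast
      then show "b * u \<in> xE (Suc (K + i))" using jg(3) by (simp add: algebra_simps)
    qed
    then show ?case using F_stable[of "Suc (K + i)"] n(1) by (simp add: K_def)
  qed (simp add: base)
  then have "F (Suc k) \<subseteq> xE k" if "k \<ge> K" for k using that by (metis le_Suc_ex)
  then show ?thesis by blast
qed

lemma vv_eventually_0: "\<exists>K. \<forall>k\<ge>K. vv k = 0"
proof -
  obtain K where K: "\<And>k. k \<ge> K \<Longrightarrow> F (Suc k) \<subseteq> xE k" using F_sub_xE by blast
  have "vv k = 0" if "k \<ge> K" for k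
  proof -
    have "J \<subseteq> xE k" unfolding xE_def by (intro isum_superset J is_ideal_xmul E_ideal)
    then have "E J (Suc k) \<subseteq> xE k" unfolding E_def[of J "Suc k"] using K[OF that] by (intro isum_least xE_ideal)
    then have "xE k = E J (Suc k)" using xE_sub by blast
    then show ?thesis unfolding vv_def using ell_0[OF finlen_vv] by blast
  qed
  then show ?thesis by blast
qed

text \<open>v_n = 0 gives E_{n+1} = x E_n only modulo J. Lifting it to A leaves an error in J
  \<inter> F_{n+1}, which the Valabrega-Valla condition places in J F_n.\<close>

lemma vv_0_reduction:
  assumes V: "VV J" and JF: "J \<subseteq> F 1" and v: "vv n = 0"
  shows "F (Suc n) = ideal_prod (add1 J x) (F n)"
proof
  have xE: "xE n = E J (Suc n)" using v ell_0[OF finlen_vv] by (simp add: vv_def)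
  show "F (Suc n) \<subseteq> ideal_prod (add1 J x) (F n)"
  proof
    fix u assume u: "u \<in> F (Suc n)"
    then have "u \<in> xE n" using xE E_superset(1)[OF J] by blast
    then obtain j g where jg: "j \<in> J" "g \<in> E J n" "u = j + x * g" by (auto simp: xE_def isum_def xmul_def)
    then obtain f i where fi: "f \<in> F n" "i \<in> J" "g = f + i" by (auto simp: E_def isum_def)
    have "x * f \<in> F (Suc n)" using F_mult[OF x fi(1)] by simp
    then have "u - x * f \<in> F (Suc n)" using u is_idealD(3)[OF F_ideal] by blast
    moreover have "u - x * f = j + x * i" using jg fi by (simp add: algebra_simps)
    then have "u - x * f \<in> J" using is_idealD(2)[OF J jg(1) is_idealD(4)[OF J fi(2)]] by simp
    ultimately have "u - x * f \<in> ideal_prod J (F n)" using V by (auto simp: VV_def)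
    moreover have "ideal_prod J (F n) \<subseteq> ideal_prod (add1 J x) (F n)"
      using add1_superset(1)[OF J] by (intro ideal_prod_least is_ideal_prod) (auto intro: ideal_prodI)
    moreover have "x * f \<in> ideal_prod (add1 J x) (F n)" using add1_superset(2)[OF J] fi by (auto intro: ideal_prodI)
    ultimately have "(u - x * f) + x * f \<in> ideal_prod (add1 J x) (F n)" using is_idealD(2)[OF is_ideal_prod] by blast
    then show "u \<in> ideal_prod (add1 J x) (F n)" by simp
  qed
  have "add1 J x \<subseteq> F 1" using JF x by (intro add1_least F_ideal)
  then show "ideal_prod (add1 J x) (F n) \<subseteq> F (Suc n)"
    using F_mult[of _ 1 _ n] by (intro ideal_prod_least F_ideal) auto
qed

lemma vv_reduction:
  assumes V: "VV J" and JF: "J \<subseteq> F 1"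
  shows "is_reduction F (add1 J x)"
  unfolding is_reduction_def
proof (intro conjI)
  show "is_ideal (add1 J x)" by (rule is_ideal_add[OF J])
  show "add1 J x \<subseteq> F 1" by (rule add1_least[OF F_ideal JF x])
  show "\<exists>N. \<forall>n\<ge>N. F (Suc n) = ideal_prod (add1 J x) (F n)"
    using vv_eventually_0 vv_0_reduction[OF assms] by blast
qed

end

end

section \<open>Minimality of the reduction\<close>

context hilbert_setup
begin

text \<open>If powers of all elements of m did lie there, the ideal V of the generators would lie in
  no prime of \<open>ass I\<close>, hence contain an A/I-regular w able to replace y. Modulo w,
  depth and number of generators both drop by one.\<close>

lemma dep_lt_generators:
  assumes "A.dep k I" "is_ideal I" "I \<noteq> UNIV" "length ys < k" "set ys \<subseteq> m"
  shows "\<exists>z\<in>m. \<forall>n. z ^ n \<notin> isum I (ideal_gen (set ys))"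
  using assms
proof (induction ys arbitrary: k I)
  case Nil
  then obtain k' where "k = Suc k'" by (cases k) auto
  then obtain z where z: "z \<in> m" "nzd UNIV z I" using Nil.prems(1) by auto
  have "z ^ n \<notin> I" for n
  proof (induction n)
    case 0
    then show ?case using Nil.prems ideal_eq_UNIV by auto
  next
    case (Suc n)
    then show ?case using z by (auto simp: nzd_def)
  qed
  moreover have "isum I (ideal_gen (set [])) = I" by (auto simp: ideal_gen_empty isum_def)
  ultimately show ?case using z by auto
next
  case (Cons y ys)
  note I = \<open>is_ideal I\<close>
  obtain k' where k: "k = Suc k'" using Cons.prems(4) by (cases k) auto
  obtain z0 where z0: "z0 \<in> m" "nzd UNIV z0 I" using Cons.prems(1) k by auto
  define Y where "Y = ideal_gen (set ys)"
  define V where "V = add1 Y y"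
  have Y: "is_ideal Y" and V: "is_ideal V" unfolding Y_def V_def by (intro is_ideal_gen is_ideal_add)+
  have VY: "ideal_gen (set (y # ys)) = V" unfolding V_def Y_def by (simp add: ideal_gen_insert)
  \<comment> \<open>Avoiding N makes the coefficient of y in w a unit, so y can be recovered from w
    and Y.\<close>
  define N where "N = isum Y (xmul y m)"
  have N: "is_ideal N" unfolding N_def by (intro is_ideal_isum is_ideal_xmul Y ideal_m)
  show ?case
  proof (rule ccontr)
    assume neg: "\<not> ?case"
    then have pw: "\<exists>n. z ^ n \<in> isum I V" if "z \<in> m" for z using that VY by auto
    \<comment> \<open>Otherwise y would already lie in Y, and the induction hypothesis would apply
      to ys with the same k.\<close>
    have "\<not> V \<subseteq> N"
    proof
      assume "V \<subseteq> N"
      then have "y \<in> N" using add1_superset(2)[OF Y] by (auto simp: V_def)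
      then obtain a c where ac: "a \<in> Y" "c \<in> m" "y = a + y * c" by (auto simp: N_def isum_def xmul_def)
      have "1 - c \<notin> m"
      proof
        assume h: "1 - c \<in> m"
        have "1 - c + c \<in> m" by (rule is_idealD(2)[OF ideal_m(1) h ac(2)])
        then show False using ideal_m by simp
      qed
      then obtain u where u: "u * (1 - c) = 1" using unit_outside_m by blast
      have "(1 - c) * y = a" using ac(3) by (simp add: algebra_simps)
      then have "y = u * a" using u by (metis mult.assoc mult_1)
      then have "y \<in> Y" using ac(1) is_idealD(4)[OF Y] by blast
      then have "V \<subseteq> Y" unfolding V_def by (intro add1_least Y) auto
      then have "isum I V \<subseteq> isum I Y" by (intro isum_mono) auto
      moreover have "\<exists>z\<in>m. \<forall>n. z ^ n \<notin> isum I Y" unfolding Y_def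
        using Cons.IH[OF Cons.prems(1-3)] Cons.prems(4,5) by simp
      ultimately show False using pw by blast
    qed
    moreover have I': "sideal UNIV I" using I by (simp add: sideal_UNIV)
    have "\<not> V \<subseteq> P \<and> sideal UNIV P" if P: "P \<in> A.ass I" for P
    proof
      have pr: "prime_ideal P" by (rule ass_prime[OF I P])
      then show "sideal UNIV P" by (simp add: prime_ideal_def sideal_UNIV)
      obtain a where a: "a \<notin> I" "P = colon UNIV I a" "I \<subseteq> P" by (rule A.assE[OF I' P]) metis
      show "\<not> V \<subseteq> P"
      proof
        assume "V \<subseteq> P"
        then have "isum I V \<subseteq> P" using a pr by (intro isum_least) (auto simp: prime_ideal_def)
        then have "z0 \<in> P" using pw[OF z0(1)] prime_power[OF pr] by blast
        then show False using a z0 by (auto simp: colon_def nzd_def)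
      qed
    qed
    ultimately have "\<exists>v\<in>V. \<forall>P\<in>insert N (A.ass I). v \<notin> P"
      using V N A.finite_ass[OF I']
      by (intro exists_avoiding_finite_union[OF subring_UNIV A.G A.unit]) (auto simp: sideal_UNIV)
    then obtain w where w: "w \<in> V" "w \<notin> N" "\<And>P. P \<in> A.ass I \<Longrightarrow> w \<notin> P" by auto
    have nw: "nzd UNIV w I" unfolding nzd_def using A.zero_divisor_in_ass[OF I', of _ w] w(3) by blast
    obtain a c where ac: "a \<in> Y" "w = a + y * c" using w(1) unfolding V_def by (rule add1E)
    have "c \<notin> m"
    proof
      assume "c \<in> m"
      then have "a + y * c \<in> N" unfolding N_def using ac(1) by (intro isumI) (auto simp: xmul_def)
      then show False using w ac by simp
    qed
    then obtain u where u: "u * c = 1" using unit_outside_m by blast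
    have "y = (u * c) * y" using u by simp
    also have "\<dots> = u * w - u * a" using ac(2) by (simp add: algebra_simps)
    finally have yw: "y = u * w - u * a" .
    have "V \<subseteq> m" using VY Cons.prems(5) ideal_gen_least[OF ideal_m(1)] by blast
    then have wm: "w \<in> m" using w by blast
    note Iw = is_ideal_add[OF I, of w]
    have Iwm: "add1 I w \<subseteq> m" using proper_sub_m[OF I Cons.prems(3)] wm by (intro add1_least ideal_m)
    have "A.dep k' (add1 I w)"
      using A.dep_exchange[of I k' w] Cons.prems(1) k I' wm nw by (simp add: A_ext)
    moreover have "add1 I w \<noteq> UNIV" using Iwm ideal_m by blast
    ultimately have "\<exists>z\<in>m. \<forall>n. z ^ n \<notin> isum (add1 I w) Y" unfolding Y_def
      using Cons.IH[OF _ Iw] Cons.prems(4,5) k by simp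
    moreover have "isum I V \<subseteq> isum (add1 I w) Y"
    proof -
      note S = is_ideal_isum[OF Iw Y] and s = isum_superset[OF Iw Y]
      have "w \<in> isum (add1 I w) Y" "a \<in> isum (add1 I w) Y" using s add1_superset[OF I, of w] ac by auto
      then have "y \<in> isum (add1 I w) Y" using yw is_idealD(3,4)[OF S] by simp
      then have "V \<subseteq> isum (add1 I w) Y" unfolding V_def using s by (intro add1_least S) auto
      then show ?thesis using s add1_superset(1)[OF I, of w] by (intro isum_least S) auto
    qed
    ultimately show False using pw by blast
  qed
qed

lemma F_not_sub_few_generators:
  assumes "A.dep k {0}" "length ys < k" "set ys \<subseteq> m"
  shows "\<not> F n \<subseteq> ideal_gen (set ys)"
proof
  assume sub: "F n \<subseteq> ideal_gen (set ys)"
  have "{0::'a} \<noteq> UNIV" using ideal_m(3) is_idealD(1)[OF ideal_m(1)] by (metis UNIV_I singletonD)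
  then obtain z where z: "z \<in> m" "\<And>n. z ^ n \<notin> isum {0} (ideal_gen (set ys))"
    using dep_lt_generators[OF assms(1) is_ideal_zero _ assms(2,3)] by blast
  obtain k where "z ^ k \<in> F 1" using m_power[OF z(1)] by blast
  then have "z ^ (k * n) \<in> F n" using F_power by (simp add: power_mult)
  then have "z ^ (k * n) \<in> isum {0} (ideal_gen (set ys))" using sub by (auto simp: isum_def)
  then show False using z by blast
qed

text \<open>A smaller reduction Q' would lie in a hyperplane H of Q modulo mQ. With a generator g
  outside H and the others shifted into H, F_{N+1} = Q' F_N lies in Y + m F_{N+1}, hence in Y, which
  has one generator too few.\<close>

lemma reduction_minimal:
  assumes d: "A.dep (length xs) {0}" and xs: "set xs \<subseteq> F 1" and red: "is_reduction F (ideal_gen (set xs))"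
  shows "minimal_reduction F (ideal_gen (set xs))"
  unfolding minimal_reduction_def
proof (intro conjI allI impI red)
  fix Q' assume "is_reduction F Q' \<and> Q' \<subseteq> ideal_gen (set xs)"
  then obtain N where Q': "is_ideal Q'" "Q' \<subseteq> ideal_gen (set xs)" "\<And>n. n \<ge> N \<Longrightarrow> F (Suc n) = ideal_prod Q' (F n)"
    by (auto simp: is_reduction_def)
  define Q where "Q = ideal_gen (set xs)"
  have Q: "is_ideal Q" unfolding Q_def by (rule is_ideal_gen)
  have "Q \<subseteq> Q'"
  proof (rule ccontr)
    assume "\<not> Q \<subseteq> Q'"
    then obtain T where T: "is_ideal T" "Q' \<subseteq> T" "\<And>c a. c \<in> m \<Longrightarrow> a \<in> Q \<Longrightarrow> c * a \<in> T" "\<not> Q \<subseteq> T"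
      using nakayama[OF Q Q'(1)] by blast
    \<comment> \<open>A maximal H with this property contains Q' and mQ, and any element of Q
      outside it generates Q together with H.\<close>
    define PP where "PP H \<longleftrightarrow> is_ideal H \<and> T \<inter> Q \<subseteq> H \<and> H \<subseteq> Q \<and> \<not> Q \<subseteq> H" for H
    have "PP (T \<inter> Q)" unfolding PP_def using T Q is_ideal_Int by blast
    then obtain H where H: "PP H" "is_ideal H" "\<And>K. PP K \<Longrightarrow> H \<subseteq> K \<Longrightarrow> K = H"
      by (rule noeth_max) (auto simp: PP_def)
    have HQ: "H \<subseteq> Q" "T \<inter> Q \<subseteq> H" "\<not> Q \<subseteq> H" using H(1) by (auto simp: PP_def)
    then obtain g where g: "g \<in> set xs" "g \<notin> H" using ideal_gen_least[OF H(2)] unfolding Q_def by blast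
    have gQ: "g \<in> Q" using g ideal_gen_superset unfolding Q_def by blast
    have QHg: "Q \<subseteq> add1 H g"
    proof (rule ccontr)
      assume "\<not> Q \<subseteq> add1 H g"
      then have "PP (add1 H g)" unfolding PP_def
        using is_ideal_add[OF H(2)] HQ add1_superset(1)[OF H(2), of g] add1_least[OF Q HQ(1) gQ] by blast
      then have "add1 H g = H" using H(3) add1_superset(1)[OF H(2)] by blast
      then show False using g add1_superset(2)[OF H(2), of g] by blast
    qed
    have "\<exists>c. y - g * c \<in> H" if y: "y \<in> Q" for y
    proof -
      obtain h c where "h \<in> H" "y = h + g * c" using QHg y by (blast elim: add1E)
      then show ?thesis by (intro exI[of _ c]) simp
    qed
    then obtain c where c: "\<And>y. y \<in> Q \<Longrightarrow> y - g * c y \<in> H" by metis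
    define ys where "ys = map (\<lambda>y. y - g * c y) (remove1 g xs)"
    define Y where "Y = ideal_gen (set ys)"
    have Y: "is_ideal Y" unfolding Y_def by (rule is_ideal_gen)
    have xsQ: "set xs \<subseteq> Q" unfolding Q_def by (rule ideal_gen_superset)
    have ysH: "set ys \<subseteq> H" using c xsQ set_remove1_subset[of g xs] unfolding ys_def by auto
    then have YH: "Y \<subseteq> H" unfolding Y_def by (intro ideal_gen_least H)
    have QY: "Q \<subseteq> add1 Y g" unfolding Q_def
    proof (intro ideal_gen_least is_ideal_add Y subsetI)
      fix y assume y: "y \<in> set xs"
      show "y \<in> add1 Y g"
      proof (cases "y = g")
        case False
        then have "y \<in> set (remove1 g xs)" using y by simp
        then have "y - g * c y \<in> Y" using ideal_gen_superset[of "set ys"] unfolding Y_def ys_def by auto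
        then have "(y - g * c y) + g * c y \<in> add1 Y g" by (intro isumI) (auto simp: xmul_def)
        then show ?thesis by simp
      qed (use add1_superset(2)[OF Y] in auto)
    qed
    \<comment> \<open>Were b a unit, g*b in H would put g into H.\<close>
    have HY: "\<exists>a\<in>Y. \<exists>b\<in>m. h = a + g * b" if h: "h \<in> H" for h
    proof -
      have "h \<in> add1 Y g" using h HQ QY by blast
      then obtain a b where ab: "a \<in> Y" "h = a + g * b" by (rule add1E)
      have "h - a \<in> H" using h ab YH is_idealD(3)[OF H(2)] by blast
      then have gb: "g * b \<in> H" using ab by simp
      have "b \<in> m"
      proof (rule ccontr)
        assume "b \<notin> m"
        then obtain u where "u * b = 1" using unit_outside_m by blast
        then have "g = u * (g * b)" by (metis mult.assoc mult.commute mult_1)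
        then show False using g gb is_idealD(4)[OF H(2)] by metis
      qed
      then show ?thesis using ab by blast
    qed
    have "F (Suc N) \<subseteq> Y"
    proof (rule nakayama[OF F_ideal Y])
      fix U assume U: "is_ideal U" "Y \<subseteq> U" "\<And>c a. c \<in> m \<Longrightarrow> a \<in> F (Suc N) \<Longrightarrow> c * a \<in> U"
      have "ideal_prod Q' (F N) \<subseteq> U"
      proof (rule ideal_prod_least[OF U(1)])
        fix q f assume q: "q \<in> Q'" and f: "f \<in> F N"
        have "q \<in> H" using q Q'(2) T(2) HQ(2) unfolding Q_def by blast
        then obtain a b where ab: "a \<in> Y" "b \<in> m" "q = a + g * b" using HY by blast
        have "g * f \<in> F (Suc N)" using F_mult[of g 1 f N] g xs f by auto
        then have "b * (g * f) \<in> U" using U(3) ab by blast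
        moreover have "a * f \<in> U" using ab(1) U(2) is_idealD(5)[OF U(1)] by blast
        ultimately have "a * f + b * (g * f) \<in> U" using is_idealD(2)[OF U(1)] by blast
        then show "q * f \<in> U" using ab(3) by (simp add: algebra_simps)
      qed
      then show "F (Suc N) \<subseteq> U" using Q'(3)[of N] by simp
    qed
    moreover have "length ys < length xs" unfolding ys_def using g(1) length_pos_if_in_set[OF g(1)]
      by (simp add: length_remove1)
    moreover have "Q \<subseteq> m" unfolding Q_def using xs F1_sub_m by (intro ideal_gen_least ideal_m) auto
    then have "set ys \<subseteq> m" using ysH HQ by blast
    ultimately show False using F_not_sub_few_generators[OF d, of ys "Suc N"] unfolding Y_def by blast
  qed
  then show "Q' = ideal_gen (set xs)" using Q'(2) unfolding Q_def by blast
qed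

end

section \<open>Prime chains, the counting argument and the Hilbert series\<close>

lemma has_prime_chain_Suc: "has_prime_chain T (Suc k) \<Longrightarrow> has_prime_chain T k"
  unfolding has_prime_chain_def by (metis le_SucI less_SucI)

lemma has_prime_chain_le:
  assumes "has_prime_chain T k" "j \<le> k"
  shows "has_prime_chain T j"
  using assms(2,1) by (induction rule: inc_induct) (auto dest: has_prime_chain_Suc)

text \<open>Beside v 0, the least admissible sequence u has ones up to r-1 and zeros after. It is
  bounded by v termwise and has the same sum, so it equals v.\<close>

lemma forced_ones:
  fixes v :: "nat \<Rightarrow> nat"
  assumes pos: "\<And>n. n < r \<Longrightarrow> v n \<ge> 1" and z: "\<And>n. n \<ge> K \<Longrightarrow> v n = 0" and r: "r \<ge> 1"
    and s: "(\<Sum>n<K. v n) + 1 = r + v 0" and n: "n \<ge> 1"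
  shows "v n = (if n < r then 1 else 0)"
proof -
  obtain r' where r': "r = Suc r'" using r by (cases r) auto
  have rK: "r \<le> K"
  proof (rule ccontr)
    assume "\<not> r \<le> K"
    then show False using pos[of K] z[of K] by simp
  qed
  define u where "u n = (if n = 0 then v 0 else if n < r then 1 else 0)" for n
  have "(\<Sum>n<K. u n) = (\<Sum>n<r. u n)" using rK r' by (intro sum.mono_neutral_right) (auto simp: u_def)
  also have "\<dots> = v 0 + r'" unfolding r' sum.lessThan_Suc_shift by (simp add: u_def r')
  finally have eq: "(\<Sum>n<K. u n) = (\<Sum>n<K. v n)" using s r' by simp
  have le: "u i \<le> v i" for i using pos[of i] by (auto simp: u_def)
  have "u n = v n" if "n < K" using sum_mono_inv[OF eq le, of n] that by simp
  moreover have "u n = v n" if "n \<ge> K" using le[of n] z[OF that] by simp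
  ultimately show ?thesis using n by (cases "n < K") (auto simp: u_def)
qed

theorem theorem3p5:
  fixes m :: "'a::comm_ring_1 set" and F :: "nat \<Rightarrow> 'a set" and d r :: nat
  assumes CM: "cohen_macaulay_local m"
    and dim: "krull_dim_eq TYPE('a) d" and d1: "d \<ge> 1"
    and inf_res: "infinite {{y. y - x \<in> m} | x. True}"
    and filt: "hilbert_filtration m F"
    and depthG: "depth_G m F \<ge> d - 1"
    and r_def: "r = nr F" and r2: "r \<ge> 2"
    and rmax: "int r = hilb_coeff F d 1 - hilb_coeff F d 0 + int (ell (F 1) UNIV) + 1"
  shows "hilbert_series F =
           (fps_const (of_nat (ell (F 1) UNIV))
            + fps_const (of_int (hilb_coeff F d 0 - int (ell (F 1) UNIV) - 1)) * fps_X
            + fps_X ^ r) / (1 - fps_X) ^ d"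
proof -
  interpret hilbert_setup m F
    using CM inf_res filt by unfold_locales (auto simp: cohen_macaulay_local_def)
  obtain k where k: "d = Suc k" using d1 by (cases d) auto
  \<comment> \<open>Both d and \<open>depth_A m\<close> are the Krull dimension; a smaller depth
    would be refuted by truncating a chain of d+1 primes.\<close>
  have dA: "d \<le> depth_A m"
  proof (rule ccontr)
    assume "\<not> d \<le> depth_A m"
    then show False using CM dim has_prime_chain_le[of "TYPE('a)" d "Suc (depth_A m)"]
      by (auto simp: cohen_macaulay_local_def krull_dim_eq_def)
  qed
  have depA: "A.dep (Suc k) {0}" using depth_A_dep[OF dA] k by simp
  have depG: "R.dep k (Gr {0})" using depth_G_dep[of k] depthG k by simp
  obtain xs J where xs: "length xs = k" "set xs \<subseteq> F 1" "J = ideal_gen (set xs)" "A.dep (Suc k - k) J" "VV J"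
    "\<And>P. prime_ideal P \<Longrightarrow> J \<subseteq> P \<Longrightarrow> prime_chain_to k P"
    "HSE J = (1 - fps_X) ^ k * (HSE {0} :: int fps)" "HSE J = (1 - fps_X) ^ k * (HSE {0} :: rat fps)"
    using superficial_sequence[OF depG depA le_refl] by blast
  have J: "is_ideal J" using xs is_ideal_gen by simp
  have JF: "J \<subseteq> F 1" using xs ideal_gen_least[OF F_ideal] by simp
  have "A.dep (Suc 0) J" using xs(4) by simp
  then obtain x where x: "x \<in> F 1" "nzd UNIV x J" "nzd Rees (monom x 1) (Gr_sat J)" using choose_last[OF J] by blast
  \<comment> \<open>A prime above (J,x) has height at least d; were it properly inside m, m would
    top a chain longer than the dimension allows.\<close>
  have zd: "zero_dim (add1 J x)" unfolding zero_dim_def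
  proof (intro allI impI)
    fix P assume P: "prime_ideal P" "add1 J x \<subseteq> P"
    have c: "prime_chain_to (Suc k) P" using prime_chain_to_nzd[OF J x(2) xs(6) P] by blast
    show "P = m"
    proof (rule ccontr)
      assume "P \<noteq> m"
      then have "P \<subset> m" using proper_sub_m[of P] P by (auto simp: prime_ideal_def)
      then have "prime_chain_to (Suc (Suc k)) m" using prime_chain_to_Suc[OF c prime_ideal_m] by blast
      then have "has_prime_chain TYPE('a) (Suc d)" using k by (auto simp: prime_chain_to_def has_prime_chain_def)
      then show False using dim by (simp add: krull_dim_eq_def)
    qed
  qed
  note ctx = J x zd
  define Q where "Q = add1 J x"
  define v where "v = vv J x"
  define e where "e = mult_e J x"
  have Qgen: "Q = ideal_gen (set (x # xs))" unfolding Q_def xs(3) by (simp add: ideal_gen_insert)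
  have "is_reduction F Q" unfolding Q_def by (rule vv_reduction[OF ctx xs(5) JF])
  then have minQ: "minimal_reduction F Q"
    unfolding Qgen using reduction_minimal[of "x # xs"] depA xs x by simp
  have hv: "v n + hE J n = e" for n unfolding v_def e_def by (rule hE_vv[OF ctx])
  obtain K where K: "\<And>n. n \<ge> K \<Longrightarrow> v n = 0" unfolding v_def using vv_eventually_0[OF ctx] by blast
  have vpos: "v n \<ge> 1" if n: "n < r" for n
  proof (rule ccontr)
    assume "\<not> v n \<ge> 1"
    then have "vv J x n = 0" by (simp add: v_def)
    from vv_0_reduction[OF ctx xs(5) JF this] have "F (Suc n) = ideal_prod Q (F n)" by (simp add: Q_def)
    then have "nr_Q F Q \<le> n" unfolding nr_Q_def by (rule Least_le)
    moreover have "nr F \<le> nr_Q F Q" unfolding nr_def by (rule Least_le) (use minQ in blast)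
    ultimately show False using n r_def by simp
  qed
  have E1: "E J 1 = F 1"
    unfolding E_def using isum_least[OF F_ideal _ JF] isum_superset(1)[OF F_ideal J] by blast
  define lam where "lam = ell (F 1) UNIV"
  have lam: "v 0 + lam = e" using hv[of 0] E1 E_0[OF J] by (simp add: hE_def lam_def)
  \<comment> \<open>The length of A/F_{n+1} sits in degree n, so (1-t)*L is the Hilbert series of
    G(F) without a stray factor t.\<close>
  define L where "L = Abs_fps (\<lambda>n. int (ell (F (Suc n)) UNIV))"
  have finF: "finlen (F n) UNIV" for n by (rule zero_dim_finlen[OF F_ideal zero_dim_F])
  have "(1 - fps_X) * L = HSE {0}"
  proof (rule fps_ext)
    fix n
    show "((1 - fps_X) * L) $ n = (HSE {0} :: int fps) $ n"
    proof (cases n)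
      case 0
      then show ?thesis by (simp add: fps_one_minus_X_mult_nth L_def HSE_def hE_def E_zero F_0 del: fps_mult_nth_0)
    next
      case (Suc i)
      have "ell (F (Suc n)) UNIV = ell (F (Suc n)) (F n) + ell (F n) UNIV"
        by (rule ell_split[OF finF F_ideal F_Suc]) auto
      then show ?thesis using Suc by (simp add: fps_one_minus_X_mult_nth L_def HSE_def hE_def E_zero)
    qed
  qed
  then have "(1 - fps_X) ^ Suc k * L = HSE J" unfolding xs(7) by (simp add: mult.assoc power_Suc2 del: power_Suc)
  also have "\<dots> = Abs_fps (\<lambda>n. int e - int (v n))"
  proof (rule fps_ext)
    fix n show "HSE J $ n = Abs_fps (\<lambda>n. int e - int (v n)) $ n" using hv[of n] by (simp add: HSE_def)
  qed
  finally have Leq: "(1 - fps_X) ^ Suc k * Abs_fps (\<lambda>n. int (ell (F (Suc n)) UNIV)) = Abs_fps (\<lambda>n. int e - int (v n))"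
    by (simp only: L_def)
  have c0: "hilb_coeff F d 0 = int e" and c1: "hilb_coeff F d 1 = (\<Sum>n<K. int (v n))"
    unfolding k using hilb_coeff_01[OF Leq, of K] K by auto
  \<comment> \<open>Maximality of r with e_1 = \<Sum> v_n and e_0 = v_0 + lambda substituted, so
    lambda cancels.\<close>
  have "int ((\<Sum>n<K. v n) + 1) = int (r + v 0)" using rmax c0 c1 lam by (simp add: lam_def)
  then have "(\<Sum>n<K. v n) + 1 = r + v 0" by (rule of_nat_eq_iff[THEN iffD1])
  then have v1: "v n = (if n < r then 1 else 0)" if "n \<ge> 1" for n
    using forced_ones[of r v K n, OF vpos K] r2 that by simp
  have "(1 - fps_X) ^ d * hilbert_series F = (1 - fps_X) * (HSE J :: rat fps)"
    unfolding xs(8) k by (simp add: mult.assoc hilbert_series_def HSE_def hE_def E_zero)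
  also have "\<dots> = fps_const (of_nat lam) + fps_const (of_int (hilb_coeff F d 0 - int lam - 1)) * fps_X + fps_X ^ r"
    (is "_ = ?num")
  proof (rule fps_ext)
    fix n
    have H: "(HSE J :: rat fps) $ n = of_nat e - of_nat (v n)" for n
    proof -
      have "(of_nat e :: rat) = of_nat (v n) + of_nat (hE J n)" by (simp flip: hv[of n])
      then show ?thesis by (simp add: HSE_def)
    qed
    have le: "(of_nat e :: rat) = of_nat (v 0) + of_nat lam" by (simp flip: lam)
    \<comment> \<open>The coefficients are lambda, then v_0 - v_1 with v_1 = 1 because r is at least
      2, then v_{n-1} - v_n, which is 1 exactly at n = r.\<close>
    consider "n = 0" | "n = 1" | i where "n = Suc (Suc i)" by (metis One_nat_def old.nat.exhaust)
    then show "((1 - fps_X) * HSE J) $ n = ?num $ n"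
    proof cases
      case 1
      then show ?thesis using r2 le by (simp add: fps_one_minus_X_mult_nth H fps_X_power_iff del: fps_mult_nth_0)
    next
      case 2
      then show ?thesis using r2 le v1[of 1]
        by (simp add: fps_one_minus_X_mult_nth H fps_X_power_iff c0 del: fps_mult_nth_0)
    next
      case 3
      then show ?thesis using v1[of "Suc i"] v1[of "Suc (Suc i)"]
        by (auto simp: fps_one_minus_X_mult_nth H fps_X_power_iff)
    qed
  qed
  finally have "?num = hilbert_series F * (1 - fps_X) ^ d" by (simp add: mult.commute)
  then show ?thesis unfolding lam_def using one_minus_X_neq_0[where ?'c = rat] by simp
qed

end
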